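(* Let $n$ be a natural number. In $\mathbf{2Hilb}$ the object $\mathbf{Hilb}^n$ has a witness, unique up to unitary isomorphism of witnesses. A representative is given by the following data. The 1-cell part consists of the column matrix $W_L=(\mathbb{C},\ldots,\mathbb{C})^{T}:\mathbf{Hilb}\to\mathbf{Hilb}^n$ with $n$ entries, and the row matrix $W_R=(\mathbb{C}\ \cdots\ \mathbb{C}):\mathbf{Hilb}^n\to\mathbf{Hilb}$ with $n$ entries. The 2-cell part is: (Copy) $\mathrm{Copy}:\mathrm{id}_{\mathbf{Hilb}^n}\Rightarrow W_R;W_L$, from the $n\times n$ matrix with $\mathbb{C}$ on the diagonal and $0$ elsewhere to the $n\times n$ matrix with all entries $\mathbb{C}$, has diagonal entries the linear map $1:\mathbb{C}\to\mathbb{C}$ and off-diagonal entries the zero map $0\to\mathbb{C}$; (Compare) $\mathrm{Compare}: W_R;W_L\Rightarrow \mathrm{id}_{\mathbf{Hilb}^n}$ has diagonal entries $1:\mathbb{C}\to\mathbb{C}$ and off-diagonal entries the zero map $\mathbb{C}\to 0$; (Create) $\mathrm{Create}:\mathrm{id}_{\mathbf{Hilb}}\Rightarrow W_L;W_R$ is the $1\times1$ matrix whose entry is the linear map $\mathbb{C}\to\mathbb{C}^n$, $1\mapsto(1,\ldots,1)$; (Delete) $\mathrm{Delete}:W_L;W_R\Rightarrow\mathrm{id}_{\mathbf{Hilb}}$ is the $1\times 1$ matrix whose entry is the linear map $\mathbb{C}^n\to\mathbb{C}$, $(x_1,\ldots,x_n)\mapsto x_1+\cdots+x_n$.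
   Context: $\mathbf{2Hilb}$ is the 2-category of finite-dimensional 2-Hilbert spaces, used in the following (equivalent) matrix form. Objects are $\mathbf{Hilb}^n$, $n\in\mathbb{N}$. A 1-cell $\mathbf{Hilb}^n\to\mathbf{Hilb}^m$ is an $m\times n$ matrix of finite-dimensional Hilbert spaces; 1-cells compose by matrix multiplication with $\oplus$ and $\otimes$ in place of sum and product. A 2-cell $F\Rightarrow G$ is a matrix of linear maps $L_{i,j}:F_{i,j}\to G_{i,j}$. Vertical composition (written $\cdot$) is entrywise composition; horizontal composition of 2-cells is induced by $\oplus$ and $\otimes$. The involution $\dagger$ is the identity on objects and 1-cells and takes entrywise adjoints of 2-cells; a 2-cell $\mu$ is unitary if $\mu^\dagger\cdot\mu=\mathrm{id}$ and $\mu\cdot\mu^\dagger=\mathrm{id}$. The symmetric monoidal unit is $I=\mathbf{Hilb}$. Write $X;Y$ for "first $X$, then $Y$", for horizontal composition of both 1-cells and 2-cells; coherence isomorphisms are suppressed. A witness for an object $A$ consists of 1-cells $W_L:I\to A$ and $W_R:A\to I$ and 2-cells $$\mathrm{Create}:\mathrm{id}_I\Rightarrow W_L;W_R,\quad \mathrm{Delete}=\mathrm{Create}^\dagger,\quad \mathrm{Copy}:\mathrm{id}_A\Rightarrow W_R;W_L,\quad \mathrm{Compare}=\mathrm{Copy}^\dagger$$ such that: (1) $(\mathrm{Compare};\mathrm{id}_{W_R})\cdot(\mathrm{id}_{W_R};\mathrm{Create})=\mathrm{id}_{W_R}$; (2) $(\mathrm{id}_{W_R};\mathrm{Delete})\cdot(\mathrm{Copy};\mathrm{id}_{W_R})=\mathrm{id}_{W_R}$;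 (3) $(\mathrm{id}_{W_L};\mathrm{Compare})\cdot(\mathrm{Create};\mathrm{id}_{W_L})=\mathrm{id}_{W_L}$; (4) $(\mathrm{Delete};\mathrm{id}_{W_L})\cdot(\mathrm{id}_{W_L};\mathrm{Copy})=\mathrm{id}_{W_L}$; (5) $\mathrm{Compare}\cdot\mathrm{Copy}=\mathrm{id}_{\mathrm{id}_A}$; (6) $m\cdot\sigma=m$, where $m=\mathrm{id}_{W_L};\mathrm{Compare};\mathrm{id}_{W_R}$ is a 2-cell $(W_L;W_R);(W_L;W_R)\Rightarrow W_L;W_R$ and $\sigma$ is the symmetry exchanging the two factors $W_L;W_R$ in the symmetric monoidal category $\mathrm{Hom}(I,I)$. A unitary isomorphism between two witnesses $(W_L,W_R,\ldots)$ and $(W_L',W_R',\ldots)$ of $A$ is a pair of unitary 2-cells $W_L\Rightarrow W_L'$, $W_R\Rightarrow W_R'$ carrying Create, Delete, Copy, Compare of the first to those of the second. *)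

theory Defs
  imports Complex_Main "HOL-Library.FuncSet" "HOL-Algebra.Module"
begin

section \<open>Finite-dimensional Hilbert spaces\<close>

text \<open>Hilbert spaces are modules over the complex numbers in the sense of HOL-Algebra, with an
  inner product that is antilinear in its first argument. The multiplicative fields that
  module records inherit from ring records carry no information here.\<close>

definition complex_field :: "complex ring"
  where "complex_field = \<lparr>carrier = UNIV, mult = (*), one = 1, zero = 0, add = (+)\<rparr>"

record 'a hilb = "(complex, 'a) module" +
  ip :: "'a \<Rightarrow> 'a \<Rightarrow> complex"

locale fd_hilbert = module complex_field H for H :: "'a hilb" (structure) +
  assumes ip_add: "\<lbrakk>x \<in> carrier H; y \<in> carrier H; z \<in> carrier H\<rbrakk> \<Longrightarrow> ip H x (y \<oplus> z) = ip H x y + ip H x z"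
    and ip_smult: "\<lbrakk>x \<in> carrier H; y \<in> carrier H\<rbrakk> \<Longrightarrow> ip H x (c \<odot> y) = c * ip H x y"
    and ip_cnj: "\<lbrakk>x \<in> carrier H; y \<in> carrier H\<rbrakk> \<Longrightarrow> ip H y x = cnj (ip H x y)"
    and ip_pos: "\<lbrakk>x \<in> carrier H; x \<noteq> \<zero>\<rbrakk> \<Longrightarrow> 0 < Re (ip H x x)"
    and fin_dim: "\<exists>S. finite S \<and> S \<subseteq> carrier H \<and>
          (\<forall>x\<in>carrier H. \<exists>c. x = (\<Oplus>s\<in>S. c s \<odot> s))"

definition lin_maps :: "'a hilb \<Rightarrow> 'b hilb \<Rightarrow> ('a \<Rightarrow> 'b) set"
  where "lin_maps H K = {T \<in> carrier H \<rightarrow>\<^sub>E carrier K.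
    (\<forall>x\<in>carrier H. \<forall>y\<in>carrier H. T (x \<oplus>\<^bsub>H\<^esub> y) = T x \<oplus>\<^bsub>K\<^esub> T y) \<and>
    (\<forall>c. \<forall>x\<in>carrier H. T (c \<odot>\<^bsub>H\<^esub> x) = c \<odot>\<^bsub>K\<^esub> T x)}"

definition adjoint :: "'a hilb \<Rightarrow> 'b hilb \<Rightarrow> ('a \<Rightarrow> 'b) \<Rightarrow> 'b \<Rightarrow> 'a"
  where "adjoint H K T = (\<lambda>y\<in>carrier K. THE x. x \<in> carrier H \<and>
    (\<forall>z\<in>carrier H. ip H x z = ip K y (T z)))"

definition onb :: "'a hilb \<Rightarrow> 'a set \<Rightarrow> bool"
  where "onb H B \<longleftrightarrow> finite B \<and> B \<subseteq> carrier H \<and>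
    (\<forall>b\<in>B. \<forall>b'\<in>B. ip H b b' = (if b = b' then 1 else 0)) \<and>
    (\<forall>x\<in>carrier H. \<exists>c. x = (\<Oplus>\<^bsub>H\<^esub>b\<in>B. c b \<odot>\<^bsub>H\<^esub> b))"

definition scalar_hilb :: "complex hilb"
  where "scalar_hilb = \<lparr>carrier = UNIV, mult = (*), one = 1, zero = 0, add = (+),
    smult = (*), ip = (\<lambda>x y. cnj x * y)\<rparr>"

definition zero_hilb :: "complex hilb"
  where "zero_hilb = scalar_hilb\<lparr>carrier := {0}\<rparr>"

text \<open>Direct sum of \<open>H 0, \<dots>, H (k - 1)\<close>; its elements are families supported on \<open>{..<k}\<close>.\<close>

definition dsum :: "nat \<Rightarrow> (nat \<Rightarrow> 'a hilb) \<Rightarrow> (nat \<Rightarrow> 'a) hilb"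
  where "dsum k H = \<lparr>carrier = (\<Pi>\<^sub>E i\<in>{..<k}. carrier (H i)), mult = undefined, one = undefined,
    zero = (\<lambda>i\<in>{..<k}. \<zero>\<^bsub>H i\<^esub>),
    add = (\<lambda>u v. \<lambda>i\<in>{..<k}. u i \<oplus>\<^bsub>H i\<^esub> v i),
    smult = (\<lambda>c u. \<lambda>i\<in>{..<k}. c \<odot>\<^bsub>H i\<^esub> u i),
    ip = (\<lambda>u v. \<Sum>i<k. ip (H i) (u i) (v i))\<rparr>"

definition dsum_inj :: "nat \<Rightarrow> (nat \<Rightarrow> 'a hilb) \<Rightarrow> nat \<Rightarrow> 'a \<Rightarrow> nat \<Rightarrow> 'a"
  where "dsum_inj k H i x = (\<lambda>j\<in>{..<k}. if j = i then x else \<zero>\<^bsub>H j\<^esub>)"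

text \<open>Tensor product, in the model where \<open>h \<otimes> k\<close> is the conjugate-bilinear form
  \<open>(x, y) \<mapsto> \<langle>x, h\<rangle> \<langle>y, k\<rangle>\<close> on \<open>H \<times> K\<close> (as in Reed and Simon). In finite dimensions every
  conjugate-bilinear form is a sum of such pure tensors, and the inner product
  determined by \<open>\<langle>h \<otimes> k, h' \<otimes> k'\<rangle> = \<langle>h, h'\<rangle> \<langle>k, k'\<rangle>\<close> is the sum below, for any choice of
  orthonormal bases of \<open>H\<close> and \<open>K\<close>.\<close>

definition conj_bilinear :: "'a hilb \<Rightarrow> 'b hilb \<Rightarrow> ('a \<times> 'b \<Rightarrow> complex) \<Rightarrow> bool"
  where "conj_bilinear H K F \<longleftrightarrow>
    (\<forall>x\<in>carrier H. \<forall>x'\<in>carrier H. \<forall>y\<in>carrier K. F (x \<oplus>\<^bsub>H\<^esub> x', y) = F (x, y) + F (x', y)) \<and>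
    (\<forall>x\<in>carrier H. \<forall>y\<in>carrier K. \<forall>y'\<in>carrier K. F (x, y \<oplus>\<^bsub>K\<^esub> y') = F (x, y) + F (x, y')) \<and>
    (\<forall>c. \<forall>x\<in>carrier H. \<forall>y\<in>carrier K. F (c \<odot>\<^bsub>H\<^esub> x, y) = cnj c * F (x, y)) \<and>
    (\<forall>c. \<forall>x\<in>carrier H. \<forall>y\<in>carrier K. F (x, c \<odot>\<^bsub>K\<^esub> y) = cnj c * F (x, y))"

definition tensor :: "'a hilb \<Rightarrow> 'b hilb \<Rightarrow> ('a \<times> 'b \<Rightarrow> complex) hilb"
  where "tensor H K = (let D = carrier H \<times> carrier K in
    \<lparr>carrier = {F \<in> extensional D. conj_bilinear H K F}, mult = undefined, one = undefined,
     zero = (\<lambda>p\<in>D. 0),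
     add = (\<lambda>F G. \<lambda>p\<in>D. F p + G p),
     smult = (\<lambda>c F. \<lambda>p\<in>D. c * F p),
     ip = (\<lambda>F G. \<Sum>p \<in> (SOME B. onb H B) \<times> (SOME B. onb K B). cnj (F p) * G p)\<rparr>)"

definition pure_tensor :: "'a hilb \<Rightarrow> 'b hilb \<Rightarrow> 'a \<Rightarrow> 'b \<Rightarrow> 'a \<times> 'b \<Rightarrow> complex"
  where "pure_tensor H K h k = (\<lambda>(x, y)\<in>carrier H \<times> carrier K. ip H x h * ip K y k)"

definition tensor_map ::
  "'a hilb \<Rightarrow> 'c hilb \<Rightarrow> 'b hilb \<Rightarrow> 'd hilb \<Rightarrow> ('a \<Rightarrow> 'c) \<Rightarrow> ('b \<Rightarrow> 'd) \<Rightarrow>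
   ('a \<times> 'b \<Rightarrow> complex) \<Rightarrow> ('c \<times> 'd \<Rightarrow> complex)"
  where "tensor_map H H' K K' S T = (THE U. U \<in> lin_maps (tensor H K) (tensor H' K') \<and>
    (\<forall>h\<in>carrier H. \<forall>k\<in>carrier K.
       U (pure_tensor H K h k) = pure_tensor H' K' (S h) (T k)))"


section \<open>The 2-category of finite-dimensional 2-Hilbert spaces\<close>

text \<open>The object \<open>Hilb\<^sup>n\<close> is represented by \<open>n\<close>. A 1-cell from \<open>n = src X\<close> to \<open>m = tgt X\<close> is an
  \<open>m \<times> n\<close> matrix; \<open>ent X (i, j)\<close> is the entry in row \<open>i < m\<close> and column \<open>j < n\<close>
  and is irrelevant for other indices. The vectors of all entries are taken
  from one type \<open>'a\<close>, which varies from 1-cell to 1-cell.\<close>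

record 'a cell1 =
  src :: nat
  tgt :: nat
  ent :: "nat \<times> nat \<Rightarrow> 'a hilb"

definition idx :: "'a cell1 \<Rightarrow> (nat \<times> nat) set"
  where "idx X = {..<tgt X} \<times> {..<src X}"

definition is_cell1 :: "nat \<Rightarrow> nat \<Rightarrow> 'a cell1 \<Rightarrow> bool"
  where "is_cell1 n m X \<longleftrightarrow> src X = n \<and> tgt X = m \<and> (\<forall>p\<in>idx X. fd_hilbert (ent X p))"

definition id1 :: "nat \<Rightarrow> complex cell1"
  where "id1 n = \<lparr>src = n, tgt = n, ent = (\<lambda>(i, j). if i = j then scalar_hilb else zero_hilb)\<rparr>"

type_synonym ('a, 'b) comp_vec = "nat \<Rightarrow> 'b \<times> 'a \<Rightarrow> complex"

text \<open>\<open>X \<Zcomp> Y\<close> is first \<open>X\<close>, then \<open>Y\<close>; as a matrix it is the product \<open>Y X\<close>.\<close>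

definition comp1 :: "'a cell1 \<Rightarrow> 'b cell1 \<Rightarrow> ('a, 'b) comp_vec cell1" (infixr \<open>\<Zcomp>\<close> 75)
  where "X \<Zcomp> Y = \<lparr>src = src X, tgt = tgt Y,
    ent = (\<lambda>(i, l). dsum (tgt X) (\<lambda>j. tensor (ent Y (i, j)) (ent X (j, l))))\<rparr>"

text \<open>The element \<open>y \<otimes> x\<close> in summand \<open>j\<close> of the entry \<open>(i, l)\<close> of \<open>X \<Zcomp> Y\<close>.\<close>

definition gen :: "'a cell1 \<Rightarrow> 'b cell1 \<Rightarrow> nat \<Rightarrow> nat \<Rightarrow> nat \<Rightarrow> 'b \<Rightarrow> 'a \<Rightarrow> ('a, 'b) comp_vec"
  where "gen X Y i l j y x =
    dsum_inj (tgt X) (\<lambda>j. tensor (ent Y (i, j)) (ent X (j, l))) j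
      (pure_tensor (ent Y (i, j)) (ent X (j, l)) y x)"

record ('a, 'b) cell2 =
  src2 :: "'a cell1"
  tgt2 :: "'b cell1"
  mat :: "nat \<times> nat \<Rightarrow> 'a \<Rightarrow> 'b"

definition is_cell2 :: "'a cell1 \<Rightarrow> 'b cell1 \<Rightarrow> ('a, 'b) cell2 \<Rightarrow> bool"
  where "is_cell2 X Y L \<longleftrightarrow> src2 L = X \<and> tgt2 L = Y \<and> src X = src Y \<and> tgt X = tgt Y \<and>
    mat L \<in> (\<Pi>\<^sub>E p\<in>idx X. lin_maps (ent X p) (ent Y p))"

definition id2 :: "'a cell1 \<Rightarrow> ('a, 'a) cell2"
  where "id2 X = \<lparr>src2 = X, tgt2 = X, mat = (\<lambda>p\<in>idx X. \<lambda>x\<in>carrier (ent X p). x)\<rparr>"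

definition vcomp :: "('b, 'c) cell2 \<Rightarrow> ('a, 'b) cell2 \<Rightarrow> ('a, 'c) cell2" (infixr \<open>\<cdot>\<close> 65)
  where "M \<cdot> L = \<lparr>src2 = src2 L, tgt2 = tgt2 M,
    mat = (\<lambda>p\<in>idx (src2 L). compose (carrier (ent (src2 L) p)) (mat M p) (mat L p))\<rparr>"

definition hcomp :: "('a, 'c) cell2 \<Rightarrow> ('b, 'd) cell2 \<Rightarrow>
    (('a, 'b) comp_vec, ('c, 'd) comp_vec) cell2" (infixr \<open>\<Zcomp>\<^sub>2\<close> 75)
  where "L \<Zcomp>\<^sub>2 M = (let X = src2 L; X' = tgt2 L; Y = src2 M; Y' = tgt2 M in
    \<lparr>src2 = X \<Zcomp> Y, tgt2 = X' \<Zcomp> Y',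
     mat = (\<lambda>(i, l)\<in>idx (X \<Zcomp> Y). \<lambda>u\<in>carrier (ent (X \<Zcomp> Y) (i, l)). \<lambda>j\<in>{..<tgt X}.
       tensor_map (ent Y (i, j)) (ent Y' (i, j)) (ent X (j, l)) (ent X' (j, l))
         (mat M (i, j)) (mat L (j, l)) (u j))\<rparr>)"

definition dagger :: "('a, 'b) cell2 \<Rightarrow> ('b, 'a) cell2"
  where "dagger L = \<lparr>src2 = tgt2 L, tgt2 = src2 L,
    mat = (\<lambda>p\<in>idx (src2 L). adjoint (ent (src2 L) p) (ent (tgt2 L) p) (mat L p))\<rparr>"

definition unitary2 :: "('a, 'b) cell2 \<Rightarrow> bool"
  where "unitary2 L \<longleftrightarrow> dagger L \<cdot> L = id2 (src2 L) \<and> L \<cdot> dagger L = id2 (tgt2 L)"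

definition inv2 :: "('a, 'b) cell2 \<Rightarrow> ('b, 'a) cell2"
  where "inv2 L = \<lparr>src2 = tgt2 L, tgt2 = src2 L,
    mat = (\<lambda>p\<in>idx (src2 L). \<lambda>y\<in>carrier (ent (tgt2 L) p).
      inv_into (carrier (ent (src2 L) p)) (mat L p) y)\<rparr>"


subsection \<open>Coherence isomorphisms\<close>

text \<open>Each coherence isomorphism is given entrywise as the unique linear map with the
  displayed values on elements \<^const>\<open>gen\<close>, which span the entries of a composite.\<close>

definition assoc2 :: "'a cell1 \<Rightarrow> 'b cell1 \<Rightarrow> 'c cell1 \<Rightarrow>
    ((('a, 'b) comp_vec, 'c) comp_vec, ('a, ('b, 'c) comp_vec) comp_vec) cell2"
  where "assoc2 X Y Z = \<lparr>src2 = (X \<Zcomp> Y) \<Zcomp> Z, tgt2 = X \<Zcomp> (Y \<Zcomp> Z),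
    mat = (\<lambda>(i, l)\<in>idx ((X \<Zcomp> Y) \<Zcomp> Z).
      THE T. T \<in> lin_maps (ent ((X \<Zcomp> Y) \<Zcomp> Z) (i, l)) (ent (X \<Zcomp> (Y \<Zcomp> Z)) (i, l)) \<and>
        (\<forall>k<tgt Y. \<forall>j<tgt X. \<forall>z\<in>carrier (ent Z (i, k)). \<forall>y\<in>carrier (ent Y (k, j)).
         \<forall>x\<in>carrier (ent X (j, l)).
           T (gen (X \<Zcomp> Y) Z i l k z (gen X Y k l j y x)) =
           gen X (Y \<Zcomp> Z) i l j (gen Y Z i j k z y) x))\<rparr>"

definition lunit2 :: "'a cell1 \<Rightarrow> ((complex, 'a) comp_vec, 'a) cell2"
  where "lunit2 X = (let J = id1 (src X) in \<lparr>src2 = J \<Zcomp> X, tgt2 = X,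
    mat = (\<lambda>(i, l)\<in>idx X.
      THE T. T \<in> lin_maps (ent (J \<Zcomp> X) (i, l)) (ent X (i, l)) \<and>
        (\<forall>x\<in>carrier (ent X (i, l)). \<forall>c. T (gen J X i l l x c) = c \<odot>\<^bsub>ent X (i, l)\<^esub> x))\<rparr>)"

definition runit2 :: "'a cell1 \<Rightarrow> (('a, complex) comp_vec, 'a) cell2"
  where "runit2 X = (let J = id1 (tgt X) in \<lparr>src2 = X \<Zcomp> J, tgt2 = X,
    mat = (\<lambda>(i, l)\<in>idx X.
      THE T. T \<in> lin_maps (ent (X \<Zcomp> J) (i, l)) (ent X (i, l)) \<and>
        (\<forall>x\<in>carrier (ent X (i, l)). \<forall>c. T (gen X J i l i c x) = c \<odot>\<^bsub>ent X (i, l)\<^esub> x))\<rparr>)"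

text \<open>The symmetry \<open>S \<Zcomp> T \<Rightarrow> T \<Zcomp> S\<close> of the symmetric monoidal category \<open>Hom(I, I)\<close>, that is, for
  \<open>1 \<times> 1\<close> matrices \<open>S\<close> and \<open>T\<close>.\<close>

definition sym2 :: "'a cell1 \<Rightarrow> 'b cell1 \<Rightarrow> (('a, 'b) comp_vec, ('b, 'a) comp_vec) cell2"
  where "sym2 S T = \<lparr>src2 = S \<Zcomp> T, tgt2 = T \<Zcomp> S,
    mat = (\<lambda>p\<in>idx (S \<Zcomp> T).
      THE U. U \<in> lin_maps (ent (S \<Zcomp> T) p) (ent (T \<Zcomp> S) p) \<and>
        (\<forall>t\<in>carrier (ent T (0, 0)). \<forall>s\<in>carrier (ent S (0, 0)).
           U (gen S T 0 0 0 t s) = gen T S 0 0 0 s t))\<rparr>"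


section \<open>Witnesses\<close>

record ('a, 'b) witness_data =
  WL :: "'a cell1"
  WR :: "'b cell1"
  Create :: "(complex, ('a, 'b) comp_vec) cell2"
  Delete :: "(('a, 'b) comp_vec, complex) cell2"
  Copy :: "(complex, ('b, 'a) comp_vec) cell2"
  Compare :: "(('b, 'a) comp_vec, complex) cell2"

text \<open>\<open>id\<^bsub>WL\<^esub>; Compare; id\<^bsub>WR\<^esub>\<close> with source \<open>(WL \<Zcomp> WR) \<Zcomp> (WL \<Zcomp> WR)\<close> and target \<open>WL \<Zcomp> WR\<close>.\<close>

definition witness_mult :: "('a, 'b) witness_data \<Rightarrow>
    ((('a, 'b) comp_vec, ('a, 'b) comp_vec) comp_vec, ('a, 'b) comp_vec) cell2"
  where "witness_mult W =
    (id2 (WL W) \<Zcomp>\<^sub>2 (lunit2 (WR W) \<cdot> (Compare W \<Zcomp>\<^sub>2 id2 (WR W)) \<cdot> inv2 (assoc2 (WR W) (WL W) (WR W))))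
    \<cdot> assoc2 (WL W) (WR W) (WL W \<Zcomp> WR W)"

locale witness =
  fixes n :: nat and W :: "('a, 'b) witness_data"
  assumes WL_cell: "is_cell1 1 n (WL W)"
    and WR_cell: "is_cell1 n 1 (WR W)"
    and Create_cell: "is_cell2 (id1 1) (WL W \<Zcomp> WR W) (Create W)"
    and Delete_eq: "Delete W = dagger (Create W)"
    and Copy_cell: "is_cell2 (id1 n) (WR W \<Zcomp> WL W) (Copy W)"
    and Compare_eq: "Compare W = dagger (Copy W)"
    and snake1: "lunit2 (WR W) \<cdot> (Compare W \<Zcomp>\<^sub>2 id2 (WR W)) \<cdot> inv2 (assoc2 (WR W) (WL W) (WR W))
        \<cdot> (id2 (WR W) \<Zcomp>\<^sub>2 Create W) \<cdot> inv2 (runit2 (WR W)) = id2 (WR W)"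
    and snake2: "runit2 (WR W) \<cdot> (id2 (WR W) \<Zcomp>\<^sub>2 Delete W) \<cdot> assoc2 (WR W) (WL W) (WR W)
        \<cdot> (Copy W \<Zcomp>\<^sub>2 id2 (WR W)) \<cdot> inv2 (lunit2 (WR W)) = id2 (WR W)"
    and snake3: "runit2 (WL W) \<cdot> (id2 (WL W) \<Zcomp>\<^sub>2 Compare W) \<cdot> assoc2 (WL W) (WR W) (WL W)
        \<cdot> (Create W \<Zcomp>\<^sub>2 id2 (WL W)) \<cdot> inv2 (lunit2 (WL W)) = id2 (WL W)"
    and snake4: "lunit2 (WL W) \<cdot> (Delete W \<Zcomp>\<^sub>2 id2 (WL W)) \<cdot> inv2 (assoc2 (WL W) (WR W) (WL W))
        \<cdot> (id2 (WL W) \<Zcomp>\<^sub>2 Copy W) \<cdot> inv2 (runit2 (WL W)) = id2 (WL W)"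
    and Compare_Copy: "Compare W \<cdot> Copy W = id2 (id1 n)"
    and commutative: "witness_mult W \<cdot> sym2 (WL W \<Zcomp> WR W) (WL W \<Zcomp> WR W) = witness_mult W"

definition unitary_witness_iso :: "('a, 'b) witness_data \<Rightarrow> ('c, 'd) witness_data \<Rightarrow>
    ('a, 'c) cell2 \<Rightarrow> ('b, 'd) cell2 \<Rightarrow> bool"
  where "unitary_witness_iso W W' \<phi> \<psi> \<longleftrightarrow>
    is_cell2 (WL W) (WL W') \<phi> \<and> unitary2 \<phi> \<and>
    is_cell2 (WR W) (WR W') \<psi> \<and> unitary2 \<psi> \<and>
    (\<phi> \<Zcomp>\<^sub>2 \<psi>) \<cdot> Create W = Create W' \<and>
    Delete W = Delete W' \<cdot> (\<phi> \<Zcomp>\<^sub>2 \<psi>) \<and>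
    (\<psi> \<Zcomp>\<^sub>2 \<phi>) \<cdot> Copy W = Copy W' \<and>
    Compare W = Compare W' \<cdot> (\<psi> \<Zcomp>\<^sub>2 \<phi>)"

definition unitarily_isomorphic :: "('a, 'b) witness_data \<Rightarrow> ('c, 'd) witness_data \<Rightarrow> bool"
  where "unitarily_isomorphic W W' \<longleftrightarrow> (\<exists>\<phi> \<psi>. unitary_witness_iso W W' \<phi> \<psi>)"


subsection \<open>The standard witness\<close>

definition std_WL :: "nat \<Rightarrow> complex cell1"
  where "std_WL n = \<lparr>src = 1, tgt = n, ent = (\<lambda>_. scalar_hilb)\<rparr>"

definition std_WR :: "nat \<Rightarrow> complex cell1"
  where "std_WR n = \<lparr>src = n, tgt = 1, ent = (\<lambda>_. scalar_hilb)\<rparr>"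

text \<open>The isomorphism \<open>\<complex> \<cong> \<complex> \<otimes> \<complex>\<close>, \<open>z \<mapsto> z \<otimes> 1\<close>, and its inverse, which for
  conjugate-bilinear forms on \<open>\<complex>\<close> is evaluation at \<open>(1, 1)\<close>.\<close>

definition to_CC :: "complex \<Rightarrow> complex \<times> complex \<Rightarrow> complex"
  where "to_CC z = pure_tensor scalar_hilb scalar_hilb z 1"

definition of_CC :: "(complex \<times> complex \<Rightarrow> complex) \<Rightarrow> complex"
  where "of_CC F = F (1, 1)"

text \<open>The entries of \<open>WR \<Zcomp> WL\<close> are one-term direct sums of \<open>\<complex> \<otimes> \<complex>\<close>, and the single entry of
  \<open>WL \<Zcomp> WR\<close> is an \<open>n\<close>-term direct sum of \<open>\<complex> \<otimes> \<complex>\<close>.\<close>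

definition std_Create :: "nat \<Rightarrow> (complex, (complex, complex) comp_vec) cell2"
  where "std_Create n = \<lparr>src2 = id1 1, tgt2 = std_WL n \<Zcomp> std_WR n,
    mat = (\<lambda>p\<in>{(0, 0)}. \<lambda>z\<in>UNIV. \<lambda>i\<in>{..<n}. to_CC z)\<rparr>"

definition std_Delete :: "nat \<Rightarrow> ((complex, complex) comp_vec, complex) cell2"
  where "std_Delete n = \<lparr>src2 = std_WL n \<Zcomp> std_WR n, tgt2 = id1 1,
    mat = (\<lambda>p\<in>{(0, 0)}. \<lambda>u\<in>carrier (ent (std_WL n \<Zcomp> std_WR n) p). \<Sum>i<n. of_CC (u i))\<rparr>"

definition std_Copy :: "nat \<Rightarrow> (complex, (complex, complex) comp_vec) cell2"
  where "std_Copy n = \<lparr>src2 = id1 n, tgt2 = std_WR n \<Zcomp> std_WL n,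
    mat = (\<lambda>(i, j)\<in>{..<n} \<times> {..<n}. \<lambda>z\<in>carrier (ent (id1 n) (i, j)).
      if i = j then (\<lambda>k\<in>{..<1}. to_CC z) else \<zero>\<^bsub>ent (std_WR n \<Zcomp> std_WL n) (i, j)\<^esub>)\<rparr>"

definition std_Compare :: "nat \<Rightarrow> ((complex, complex) comp_vec, complex) cell2"
  where "std_Compare n = \<lparr>src2 = std_WR n \<Zcomp> std_WL n, tgt2 = id1 n,
    mat = (\<lambda>(i, j)\<in>{..<n} \<times> {..<n}. \<lambda>u\<in>carrier (ent (std_WR n \<Zcomp> std_WL n) (i, j)).
      if i = j then of_CC (u 0) else 0)\<rparr>"

definition std_witness :: "nat \<Rightarrow> (complex, complex) witness_data"
  where "std_witness n = \<lparr>WL = std_WL n, WR = std_WR n, Create = std_Create n,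
    Delete = std_Delete n, Copy = std_Copy n, Compare = std_Compare n\<rparr>"

end

theory Submission
  imports Defs
begin

text \<open>Write \<open>L\<^sub>i\<close> and \<open>R\<^sub>i\<close> for the entries of \<open>W\<^sub>L\<close> and \<open>W\<^sub>R\<close>. Entrywise, \<open>Copy\<close> is a family of vectors
  \<open>\<kappa>\<^sub>i \<in> L\<^sub>i \<otimes> R\<^sub>i\<close>, and \<open>Create\<close> is a vector \<open>\<eta> = \<Sum>\<^sub>j \<eta>\<^sub>j\<close> with \<open>\<eta>\<^sub>j \<in> R\<^sub>j \<otimes> L\<^sub>j\<close>. The adjoints \<open>Compare\<close> and
  \<open>Delete\<close> are the inner products with these vectors. With \<open>\<beta>\<^sub>i(x, y) = \<langle>\<kappa>\<^sub>i, x \<otimes> y\<rangle>\<close>, the multiplication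
  on the direct sum of the \<open>R\<^sub>j \<otimes> L\<^sub>j\<close> sends the product of \<open>y' \<otimes> x'\<close> and \<open>y \<otimes> x\<close> to \<open>\<beta>\<^sub>j(x', y) y' \<otimes> x\<close>. By
  the snake equations it is the multiplication of a direct sum of matrix algebras. Such an
  algebra is commutative only if all the matrices are \<open>1 \<times> 1\<close>.

  Concretely, \<open>Compare \<cdot> Copy = id\<close> says that each \<open>\<kappa>\<^sub>i\<close> is a unit vector, so some \<open>\<beta>\<^sub>i(x', y)\<close> is not
  zero. Commutativity then makes every \<open>y' \<otimes> x\<close> a multiple of \<open>y \<otimes> x'\<close>. Hence \<open>L\<^sub>i\<close> and \<open>R\<^sub>i\<close> are
  one-dimensional, and there are unit vectors \<open>a\<^sub>i\<close> and \<open>b\<^sub>i\<close> with \<open>\<kappa>\<^sub>i = a\<^sub>i \<otimes> b\<^sub>i\<close>, where a phase is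
  absorbed into \<open>a\<^sub>i\<close>. The first snake equation now gives \<open>\<eta>\<^sub>i = b\<^sub>i \<otimes> a\<^sub>i\<close>. Such a frame of unit vectors
  determines the whole witness (\<open>witness_has_frame\<close>), and mapping one frame to another is a
  unitary isomorphism (\<open>frames_isomorphic\<close>). Conversely any data with a frame satisfy all
  equations (\<open>framed.witness\<close>), and the standard witness has the frame with all vectors equal
  to \<open>1\<close> (\<open>std_framed\<close>).

  Everything is computed on pure tensors, which span the entries of a composite. In the model of
  tensor products by conjugate-bilinear forms, the inner product of \<open>h \<otimes> k\<close> with a form \<open>F\<close> is its value
  \<open>F(h, k)\<close> (\<open>ip_pure_left\<close>). This reproducing property gives the inner products of pure tensors.
  It also suggests the tensor product of linear maps: precomposition with the adjoints. The
  coherence isomorphisms match spanning families with equal Gram matrices, so they exist and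
  are unitary by a single extension lemma (\<open>unitary_extension\<close>).\<close>


section \<open>Finite-dimensional Hilbert spaces through their inner product\<close>

lemma complex_field_simps [simp]:
  "carrier complex_field = UNIV" "a \<otimes>\<^bsub>complex_field\<^esub> b = a * b" "\<one>\<^bsub>complex_field\<^esub> = 1"
  "\<zero>\<^bsub>complex_field\<^esub> = 0" "a \<oplus>\<^bsub>complex_field\<^esub> b = a + b"
  by (simp_all add: complex_field_def)

lemma cring_complex_field: "cring complex_field"
proof (rule cringI)
  show "abelian_group complex_field"
    by (rule abelian_groupI) (auto intro: exI[of _ "- x" for x])
  show "comm_monoid complex_field"
    by (rule comm_monoidI) auto
qed (simp add: algebra_simps)

lemma fd_add_closed [simp]:
  "\<lbrakk>fd_hilbert H; x \<in> carrier H; y \<in> carrier H\<rbrakk> \<Longrightarrow> x \<oplus>\<^bsub>H\<^esub> y \<in> carrier H"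
  by (meson abelian_groupE(1) fd_hilbert.axioms(1) module.axioms(2))

lemma fd_zero_closed [simp]: "fd_hilbert H \<Longrightarrow> \<zero>\<^bsub>H\<^esub> \<in> carrier H"
  by (meson abelian_groupE(2) fd_hilbert.axioms(1) module.axioms(2))

lemma fd_smult_closed [simp]: "\<lbrakk>fd_hilbert H; x \<in> carrier H\<rbrakk> \<Longrightarrow> c \<odot>\<^bsub>H\<^esub> x \<in> carrier H"
  using module.smult_closed[of complex_field H c x] by (simp add: fd_hilbert.axioms(1))

lemma fd_smult_zero [simp]: "\<lbrakk>fd_hilbert H; x \<in> carrier H\<rbrakk> \<Longrightarrow> 0 \<odot>\<^bsub>H\<^esub> x = \<zero>\<^bsub>H\<^esub>"
  using module.smult_l_null[of complex_field H x] by (simp add: fd_hilbert.axioms(1))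

lemma fd_smult_one [simp]: "\<lbrakk>fd_hilbert H; x \<in> carrier H\<rbrakk> \<Longrightarrow> 1 \<odot>\<^bsub>H\<^esub> x = x"
  using module.smult_one[of complex_field H x] by (simp add: fd_hilbert.axioms(1))

lemma ip_add_right [simp]:
  "\<lbrakk>fd_hilbert H; x \<in> carrier H; y \<in> carrier H; z \<in> carrier H\<rbrakk>
    \<Longrightarrow> ip H x (y \<oplus>\<^bsub>H\<^esub> z) = ip H x y + ip H x z"
  by (simp add: fd_hilbert.ip_add)

lemma ip_smult_right [simp]:
  "\<lbrakk>fd_hilbert H; x \<in> carrier H; y \<in> carrier H\<rbrakk> \<Longrightarrow> ip H x (c \<odot>\<^bsub>H\<^esub> y) = c * ip H x y"
  by (simp add: fd_hilbert.ip_smult)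

lemma ip_zero_right [simp]: "\<lbrakk>fd_hilbert H; x \<in> carrier H\<rbrakk> \<Longrightarrow> ip H x \<zero>\<^bsub>H\<^esub> = 0"
  using ip_smult_right[of H x x 0] by simp

lemma ip_swap: "\<lbrakk>fd_hilbert H; x \<in> carrier H; y \<in> carrier H\<rbrakk> \<Longrightarrow> ip H y x = cnj (ip H x y)"
  by (rule fd_hilbert.ip_cnj)

lemma ip_add_left [simp]:
  "\<lbrakk>fd_hilbert H; x \<in> carrier H; y \<in> carrier H; z \<in> carrier H\<rbrakk>
    \<Longrightarrow> ip H (y \<oplus>\<^bsub>H\<^esub> z) x = ip H y x + ip H z x"
  using ip_swap[of H x "y \<oplus>\<^bsub>H\<^esub> z"] ip_swap[of H x y] ip_swap[of H x z] by simp

lemma ip_smult_left [simp]: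
  "\<lbrakk>fd_hilbert H; x \<in> carrier H; y \<in> carrier H\<rbrakk> \<Longrightarrow> ip H (c \<odot>\<^bsub>H\<^esub> y) x = cnj c * ip H y x"
  using ip_swap[of H x "c \<odot>\<^bsub>H\<^esub> y"] ip_swap[of H x y] by simp

lemma ip_zero_left [simp]: "\<lbrakk>fd_hilbert H; x \<in> carrier H\<rbrakk> \<Longrightarrow> ip H \<zero>\<^bsub>H\<^esub> x = 0"
  using ip_swap[of H x "\<zero>\<^bsub>H\<^esub>"] by simp

lemma ip_self_eq_0: "\<lbrakk>fd_hilbert H; x \<in> carrier H; ip H x x = 0\<rbrakk> \<Longrightarrow> x = \<zero>\<^bsub>H\<^esub>"
  by (metis fd_hilbert.ip_pos less_irrefl zero_complex.sel(1))

lemma ip_self_real: "\<lbrakk>fd_hilbert H; x \<in> carrier H\<rbrakk> \<Longrightarrow> ip H x x = complex_of_real (Re (ip H x x))"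
  using arg_cong[OF ip_swap[of H x x], of Im] by (simp add: complex_eq_iff)

text \<open>Vectors with the same inner products are equal. Vector identities are proved below by
  comparing inner products, which turns them into identities of complex numbers.\<close>

lemma fd_hilbert_eqI:
  assumes H: "fd_hilbert H" and x: "x \<in> carrier H" and y: "y \<in> carrier H"
    and eq: "\<And>z. z \<in> carrier H \<Longrightarrow> ip H z x = ip H z y"
  shows "x = y"
proof -
  interpret fd_hilbert H by fact
  let ?d = "x \<oplus>\<^bsub>H\<^esub> (- 1) \<odot>\<^bsub>H\<^esub> y"
  have d: "?d \<in> carrier H" using H x y by simp
  have "ip H ?d ?d = 0" using H x y d eq[OF d] by simp
  then have 0: "?d = \<zero>\<^bsub>H\<^esub>" using ip_self_eq_0[OF H d] by simp
  have "(- 1) \<odot>\<^bsub>H\<^esub> y \<oplus>\<^bsub>H\<^esub> y = (- 1 + 1) \<odot>\<^bsub>H\<^esub> y"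
    using smult_l_distr[of "- 1" 1 y] y H by simp
  then have "(- 1) \<odot>\<^bsub>H\<^esub> y \<oplus>\<^bsub>H\<^esub> y = \<zero>\<^bsub>H\<^esub>" using y H by simp
  then have "x = ?d \<oplus>\<^bsub>H\<^esub> y" using x y H by (simp add: M.a_assoc)
  then show ?thesis using 0 y by simp
qed

lemma smult_assoc_fd: "\<lbrakk>fd_hilbert H; x \<in> carrier H\<rbrakk> \<Longrightarrow> c \<odot>\<^bsub>H\<^esub> (d \<odot>\<^bsub>H\<^esub> x) = (c * d) \<odot>\<^bsub>H\<^esub> x"
  by (rule fd_hilbert_eqI[of H]) simp_all

lemma smult_add_fd: "\<lbrakk>fd_hilbert H; x \<in> carrier H\<rbrakk> \<Longrightarrow>
    (c + d) \<odot>\<^bsub>H\<^esub> x = c \<odot>\<^bsub>H\<^esub> x \<oplus>\<^bsub>H\<^esub> d \<odot>\<^bsub>H\<^esub> x"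
  by (rule fd_hilbert_eqI[of H]) (simp_all add: algebra_simps)

lemma smult_zero_fd: "fd_hilbert H \<Longrightarrow> c \<odot>\<^bsub>H\<^esub> \<zero>\<^bsub>H\<^esub> = \<zero>\<^bsub>H\<^esub>"
  by (rule fd_hilbert_eqI[of H]) simp_all

lemma zero_add_zero_fd: "fd_hilbert H \<Longrightarrow> \<zero>\<^bsub>H\<^esub> \<oplus>\<^bsub>H\<^esub> \<zero>\<^bsub>H\<^esub> = \<zero>\<^bsub>H\<^esub>"
  by (rule fd_hilbert_eqI[of H]) simp_all

lemma finsum_closed_fd [simp]:
  "\<lbrakk>fd_hilbert H; S \<subseteq> carrier H\<rbrakk> \<Longrightarrow> (\<Oplus>\<^bsub>H\<^esub>s\<in>S. c s \<odot>\<^bsub>H\<^esub> s) \<in> carrier H"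
  by (intro abelian_monoid.finsum_closed)
     (auto intro: fd_hilbert.axioms(1) module.axioms abelian_group.axioms)

lemma ip_finsum:
  assumes H: "fd_hilbert H" and S: "finite S" "S \<subseteq> carrier H" and x: "x \<in> carrier H"
  shows "ip H x (\<Oplus>\<^bsub>H\<^esub>s\<in>S. c s \<odot>\<^bsub>H\<^esub> s) = (\<Sum>s\<in>S. c s * ip H x s)"
proof -
  interpret fd_hilbert H by fact
  show ?thesis using S
  proof (induction S rule: finite_induct)
    case (insert s S)
    have "(\<Oplus>\<^bsub>H\<^esub>t\<in>insert s S. c t \<odot>\<^bsub>H\<^esub> t) = c s \<odot>\<^bsub>H\<^esub> s \<oplus>\<^bsub>H\<^esub> (\<Oplus>\<^bsub>H\<^esub>t\<in>S. c t \<odot>\<^bsub>H\<^esub> t)"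
      using insert H by (intro finsum_insert) auto
    then show ?case using insert H x by simp
  qed (use H x in simp)
qed


subsection \<open>Linear spans\<close>

text \<open>Spans are defined inductively, so that a linear identity extends from a set to its span by
  rule induction, with no finite sums in the way.\<close>

inductive_set lspan :: "'a hilb \<Rightarrow> 'a set \<Rightarrow> 'a set" for H A where
  zero: "\<zero>\<^bsub>H\<^esub> \<in> lspan H A"
| base: "a \<in> A \<Longrightarrow> a \<in> lspan H A"
| add: "\<lbrakk>x \<in> lspan H A; y \<in> lspan H A\<rbrakk> \<Longrightarrow> x \<oplus>\<^bsub>H\<^esub> y \<in> lspan H A"
| smult: "x \<in> lspan H A \<Longrightarrow> c \<odot>\<^bsub>H\<^esub> x \<in> lspan H A"

definition spans :: "'a hilb \<Rightarrow> 'a set \<Rightarrow> bool"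
  where "spans H A \<longleftrightarrow> A \<subseteq> carrier H \<and> carrier H \<subseteq> lspan H A"

lemma lspan_closed:
  assumes "fd_hilbert H" "A \<subseteq> carrier H" "x \<in> lspan H A"
  shows "x \<in> carrier H"
  using assms(3) by induction (use assms in auto)

lemma lspan_least: "A \<subseteq> lspan H B \<Longrightarrow> lspan H A \<subseteq> lspan H B"
proof
  fix x assume "A \<subseteq> lspan H B" "x \<in> lspan H A"
  from this(2) show "x \<in> lspan H B" 
    by induction (use \<open>A \<subseteq> lspan H B\<close> in \<open>auto intro: lspan.intros\<close>)
qed

lemma spans_carrier: "spans H (carrier H)"
  by (auto simp: spans_def intro: lspan.base)

lemma spans_trans: "\<lbrakk>spans H A; A \<subseteq> lspan H B; B \<subseteq> carrier H\<rbrakk> \<Longrightarrow> spans H B"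
  using lspan_least[of A H B] by (auto simp: spans_def)

lemma finsum_in_lspan:
  assumes H: "fd_hilbert H" and S: "finite S" "S \<subseteq> carrier H"
  shows "(\<Oplus>\<^bsub>H\<^esub>s\<in>S. c s \<odot>\<^bsub>H\<^esub> s) \<in> lspan H S"
proof -
  interpret fd_hilbert H by fact
  have "(\<Oplus>\<^bsub>H\<^esub>s\<in>T. c s \<odot>\<^bsub>H\<^esub> s) \<in> lspan H S" if "finite T" "T \<subseteq> S" for T
    using that
  proof (induction T rule: finite_induct)
    case (insert s T)
    have "(\<Oplus>\<^bsub>H\<^esub>t\<in>insert s T. c t \<odot>\<^bsub>H\<^esub> t) = c s \<odot>\<^bsub>H\<^esub> s \<oplus>\<^bsub>H\<^esub> (\<Oplus>\<^bsub>H\<^esub>t\<in>T. c t \<odot>\<^bsub>H\<^esub> t)"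
      using insert H S by (intro finsum_insert) auto
    then show ?case using insert by (auto intro: lspan.intros)
  qed (auto intro: lspan.intros)
  then show ?thesis using S by blast
qed

lemma finite_spanning_set:
  assumes "fd_hilbert H"
  obtains S where "finite S" "spans H S"
proof -
  from fd_hilbert.fin_dim[OF assms] obtain S where S: "finite S" "S \<subseteq> carrier H"
    and "\<forall>x\<in>carrier H. \<exists>c. x = (\<Oplus>\<^bsub>H\<^esub>s\<in>S. c s \<odot>\<^bsub>H\<^esub> s)" by blast
  then have "carrier H \<subseteq> lspan H S" using finsum_in_lspan[OF assms S] by fastforce
  then show ?thesis using S that by (auto simp: spans_def)
qed

text \<open>If a separating family of functionals turns the operations into those of the complex
  numbers, then the module axioms hold because they hold for complex numbers. Evaluation at
  points is such a family for tensor products, and inner products with vectors of the summands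
  are one for direct sums.\<close>

lemma fd_hilbertI:
  fixes H :: "'a hilb" and e :: "'t \<Rightarrow> 'a \<Rightarrow> complex"
  assumes zero: "\<zero>\<^bsub>H\<^esub> \<in> carrier H" "\<And>t. t \<in> I \<Longrightarrow> e t \<zero>\<^bsub>H\<^esub> = 0"
    and add: "\<And>x y. \<lbrakk>x \<in> carrier H; y \<in> carrier H\<rbrakk> \<Longrightarrow> x \<oplus>\<^bsub>H\<^esub> y \<in> carrier H"
      "\<And>t x y. \<lbrakk>t \<in> I; x \<in> carrier H; y \<in> carrier H\<rbrakk> \<Longrightarrow> e t (x \<oplus>\<^bsub>H\<^esub> y) = e t x + e t y"
    and smult: "\<And>c x. x \<in> carrier H \<Longrightarrow> c \<odot>\<^bsub>H\<^esub> x \<in> carrier H"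
      "\<And>t c x. \<lbrakk>t \<in> I; x \<in> carrier H\<rbrakk> \<Longrightarrow> e t (c \<odot>\<^bsub>H\<^esub> x) = c * e t x"
    and sep: "\<And>x y. \<lbrakk>x \<in> carrier H; y \<in> carrier H; \<And>t. t \<in> I \<Longrightarrow> e t x = e t y\<rbrakk> \<Longrightarrow> x = y"
    and ip: "\<And>x y z. \<lbrakk>x \<in> carrier H; y \<in> carrier H; z \<in> carrier H\<rbrakk>
        \<Longrightarrow> ip H x (y \<oplus>\<^bsub>H\<^esub> z) = ip H x y + ip H x z"
      "\<And>c x y. \<lbrakk>x \<in> carrier H; y \<in> carrier H\<rbrakk> \<Longrightarrow> ip H x (c \<odot>\<^bsub>H\<^esub> y) = c * ip H x y"
      "\<And>x y. \<lbrakk>x \<in> carrier H; y \<in> carrier H\<rbrakk> \<Longrightarrow> ip H y x = cnj (ip H x y)"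
      "\<And>x. \<lbrakk>x \<in> carrier H; x \<noteq> \<zero>\<^bsub>H\<^esub>\<rbrakk> \<Longrightarrow> 0 < Re (ip H x x)"
    and S: "finite S" "spans H S"
  shows "fd_hilbert H"
proof -
  have ag: "abelian_group H"
  proof (rule abelian_groupI)
    fix x assume x: "x \<in> carrier H"
    have "(- 1) \<odot>\<^bsub>H\<^esub> x \<oplus>\<^bsub>H\<^esub> x = \<zero>\<^bsub>H\<^esub>"
      by (rule sep) (simp_all add: zero add smult x)
    then show "\<exists>y\<in>carrier H. y \<oplus>\<^bsub>H\<^esub> x = \<zero>\<^bsub>H\<^esub>" using smult(1)[OF x] by blast
  qed (simp add: add, simp add: zero, (rule sep; simp add: zero add algebra_simps)+)
  have mod: "module complex_field H"
    by (rule moduleI[OF cring_complex_field ag])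
       (simp add: smult(1), (rule sep; simp add: smult add algebra_simps)+)
  interpret module complex_field H by (rule mod)
  have comb: "\<exists>c. x = (\<Oplus>\<^bsub>H\<^esub>s\<in>S. c s \<odot>\<^bsub>H\<^esub> s)" if "x \<in> lspan H S" for x
  proof -
    have SC: "S \<subseteq> carrier H" using S by (simp add: spans_def)
    have ecomb: "e t (\<Oplus>\<^bsub>H\<^esub>s\<in>T. c s \<odot>\<^bsub>H\<^esub> s) = (\<Sum>s\<in>T. c s * e t s)"
      if "finite T" "T \<subseteq> carrier H" "t \<in> I" for T t c
      using that
    proof (induction T rule: finite_induct)
      case (insert s T)
      have "(\<Oplus>\<^bsub>H\<^esub>t\<in>insert s T. c t \<odot>\<^bsub>H\<^esub> t) = c s \<odot>\<^bsub>H\<^esub> s \<oplus>\<^bsub>H\<^esub> (\<Oplus>\<^bsub>H\<^esub>t\<in>T. c t \<odot>\<^bsub>H\<^esub> t)"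
        using insert by (intro finsum_insert) (auto intro: smult(1))
      moreover have "(\<Oplus>\<^bsub>H\<^esub>t\<in>T. c t \<odot>\<^bsub>H\<^esub> t) \<in> carrier H"
        using insert by (intro finsum_closed) (auto intro: smult(1))
      ultimately show ?case using insert by (simp add: add smult)
    qed (simp add: zero)
    have closed: "(\<Oplus>\<^bsub>H\<^esub>s\<in>S. c s \<odot>\<^bsub>H\<^esub> s) \<in> carrier H" for c
      using SC by (intro finsum_closed) (auto intro: smult(1))
    note simps = zero add smult ecomb[OF S(1) SC] closed
    show ?thesis using that
    proof induction
      case zero
      have "\<zero>\<^bsub>H\<^esub> = (\<Oplus>\<^bsub>H\<^esub>s\<in>S. 0 \<odot>\<^bsub>H\<^esub> s)"
        by (rule sep) (simp_all add: simps)
      then show ?case by auto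
    next
      case (base a)
      have "a = (\<Oplus>\<^bsub>H\<^esub>s\<in>S. (if s = a then 1 else 0) \<odot>\<^bsub>H\<^esub> s)"
        by (rule sep)
          (use SC S base in \<open>simp_all add: simps subset_eq if_distrib[of "\<lambda>c. c * _"] cong: if_cong\<close>)
      then show ?case by (intro exI)
    next
      case (add x y)
      then obtain c d where c: "x = (\<Oplus>\<^bsub>H\<^esub>s\<in>S. c s \<odot>\<^bsub>H\<^esub> s)" and d: "y = (\<Oplus>\<^bsub>H\<^esub>s\<in>S. d s \<odot>\<^bsub>H\<^esub> s)"
        by auto
      have "x \<oplus>\<^bsub>H\<^esub> y = (\<Oplus>\<^bsub>H\<^esub>s\<in>S. (c s + d s) \<odot>\<^bsub>H\<^esub> s)" unfolding c d
        by (rule sep) (simp_all add: simps sum.distrib algebra_simps)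
      then show ?case by (intro exI)
    next
      case (smult x d)
      then obtain c where c: "x = (\<Oplus>\<^bsub>H\<^esub>s\<in>S. c s \<odot>\<^bsub>H\<^esub> s)"
        by auto
      have "d \<odot>\<^bsub>H\<^esub> x = (\<Oplus>\<^bsub>H\<^esub>s\<in>S. (d * c s) \<odot>\<^bsub>H\<^esub> s)" unfolding c
        by (rule sep) (simp_all add: simps sum_distrib_left algebra_simps)
      then show ?case by (intro exI)
    qed
  qed
  show ?thesis
  proof (intro fd_hilbert.intro mod fd_hilbert_axioms.intro)
    show "\<exists>S. finite S \<and> S \<subseteq> carrier H \<and> (\<forall>x\<in>carrier H. \<exists>c. x = (\<Oplus>\<^bsub>H\<^esub>s\<in>S. c s \<odot>\<^bsub>H\<^esub> s))"
      using S comb by (intro exI[of _ S]) (auto simp: spans_def)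
  qed (rule ip; assumption)+
qed


subsection \<open>Orthonormal bases\<close>

text \<open>One step of the Gram-Schmidt process per vector: subtract the projection, then normalise
  the rest unless it vanishes.\<close>

lemma gram_schmidt:
  assumes H: "fd_hilbert H" and "finite S" "S \<subseteq> carrier H"
  shows "\<exists>B. finite B \<and> B \<subseteq> carrier H \<and> (\<forall>b\<in>B. \<forall>b'\<in>B. ip H b b' = (if b = b' then 1 else 0)) \<and>
    S \<subseteq> lspan H B"
  using assms(2,3)
proof (induction S rule: finite_induct)
  case (insert s S)
  then obtain B where B: "finite B" "B \<subseteq> carrier H" "S \<subseteq> lspan H B"
    and on: "\<And>b b'. \<lbrakk>b \<in> B; b' \<in> B\<rbrakk> \<Longrightarrow> ip H b b' = (if b = b' then 1 else 0)" by auto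
  have s: "s \<in> carrier H" using insert by simp
  define p where "p = (\<Oplus>\<^bsub>H\<^esub>b\<in>B. ip H b s \<odot>\<^bsub>H\<^esub> b)"
  have p: "p \<in> carrier H" "p \<in> lspan H B"
    unfolding p_def using finsum_in_lspan[OF H B(1,2)] H B by auto
  have ip_p: "ip H b p = ip H b s" if "b \<in> B" for b
  proof -
    have "ip H b p = (\<Sum>b'\<in>B. ip H b' s * ip H b b')"
      unfolding p_def using that B H by (simp add: ip_finsum subset_eq)
    also have "\<dots> = (\<Sum>b'\<in>B. if b = b' then ip H b' s else 0)"
      by (rule sum.cong) (auto simp: on that)
    finally show ?thesis using that B by simp
  qed
  define d where "d = s \<oplus>\<^bsub>H\<^esub> (- 1) \<odot>\<^bsub>H\<^esub> p"
  have d: "d \<in> carrier H" using H s p by (simp add: d_def)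
  have orth: "ip H b d = 0" if "b \<in> B" for b
    using that H s p B by (simp add: d_def ip_p subset_eq)
  have orth': "ip H d b = 0" if "b \<in> B" for b
    using orth[OF that] ip_swap[of H b d] that B H d by auto
  show ?case
  proof (cases "d = \<zero>\<^bsub>H\<^esub>")
    case True
    have "s = p"
    proof (rule fd_hilbert_eqI[OF H s p(1)])
      fix z assume "z \<in> carrier H"
      then have "ip H z d = ip H z s - ip H z p" using H s p by (simp add: d_def)
      then show "ip H z s = ip H z p" using True H \<open>z \<in> carrier H\<close> by simp
    qed
    then show ?thesis using B on p(2) by (intro exI[of _ B] conjI ballI) simp_all
  next
    case False
    define r where "r = Re (ip H d d)"
    have r: "0 < r" "ip H d d = complex_of_real r"
      using fd_hilbert.ip_pos[OF H d False] ip_self_real[OF H d] by (simp_all add: r_def)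
    define e where "e = complex_of_real (1 / sqrt r) \<odot>\<^bsub>H\<^esub> d"
    have e: "e \<in> carrier H" using H d by (simp add: e_def)
    have ee: "ip H e e = 1"
      using r H d by (simp add: e_def flip: of_real_mult)
    have eb: "ip H e b = 0" "ip H b e = 0" if "b \<in> B" for b
      using that orth orth' H d B by (auto simp: e_def subset_eq)
    have "s = complex_of_real (sqrt r) \<odot>\<^bsub>H\<^esub> e \<oplus>\<^bsub>H\<^esub> p"
      by (rule fd_hilbert_eqI[OF H s])
        (use H d p s r in \<open>simp_all add: e_def d_def flip: of_real_mult\<close>)
    moreover have "p \<in> lspan H (insert e B)" "S \<subseteq> lspan H (insert e B)"
      using p B lspan_least[of B H "insert e B"] by (auto intro: lspan.base)
    ultimately have "insert s S \<subseteq> lspan H (insert e B)"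
      by (auto intro: lspan.intros)
    moreover have "\<forall>b\<in>insert e B. \<forall>b'\<in>insert e B. ip H b b' = (if b = b' then 1 else 0)"
      using on ee eb by force
    ultimately show ?thesis using B(1,2) e by (intro exI[of _ "insert e B"] conjI) simp_all
  qed
qed (rule exI[of _ "{}"], simp)

lemma onb_ip: "\<lbrakk>onb H B; b \<in> B; b' \<in> B\<rbrakk> \<Longrightarrow> ip H b b' = (if b = b' then 1 else 0)"
  by (simp add: onb_def)

lemma onb_expand:
  assumes H: "fd_hilbert H" and B: "onb H B" and x: "x \<in> carrier H"
  shows "x = (\<Oplus>\<^bsub>H\<^esub>b\<in>B. ip H b x \<odot>\<^bsub>H\<^esub> b)"
proof -
  have fB: "finite B" "B \<subseteq> carrier H" using B by (auto simp: onb_def)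
  obtain c where c: "x = (\<Oplus>\<^bsub>H\<^esub>b\<in>B. c b \<odot>\<^bsub>H\<^esub> b)" using B x unfolding onb_def by blast
  have "ip H b x = c b" if "b \<in> B" for b
  proof -
    have "ip H b x = (\<Sum>b'\<in>B. c b' * ip H b b')"
      by (subst c, rule ip_finsum[OF H fB]) (use that fB in auto)
    also have "\<dots> = (\<Sum>b'\<in>B. if b = b' then c b' else 0)"
      using B that by (intro sum.cong) (auto simp: onb_def)
    finally show ?thesis using that fB by simp
  qed
  note cb = this
  show ?thesis
  proof (rule fd_hilbert_eqI[OF H x])
    fix z assume z: "z \<in> carrier H"
    have "ip H z x = (\<Sum>b\<in>B. c b * ip H z b)"
      unfolding ip_finsum[OF H fB z, symmetric] c[symmetric] ..
    also have "\<dots> = (\<Sum>b\<in>B. ip H b x * ip H z b)"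
      by (rule sum.cong) (simp_all add: cb)
    finally show "ip H z x = ip H z (\<Oplus>\<^bsub>H\<^esub>b\<in>B. ip H b x \<odot>\<^bsub>H\<^esub> b)"
      unfolding ip_finsum[OF H fB z] .
  qed (use H fB in simp)
qed

lemma onb_exists:
  assumes H: "fd_hilbert H"
  shows "\<exists>B. onb H B"
proof -
  obtain S where S: "finite S" "spans H S" by (rule finite_spanning_set[OF H])
  then obtain B where B: "finite B" "B \<subseteq> carrier H" "S \<subseteq> lspan H B"
    and on: "\<forall>b\<in>B. \<forall>b'\<in>B. ip H b b' = (if b = b' then 1 else 0)"
    using gram_schmidt[OF H, of S] by (auto simp: spans_def)
  have "x = (\<Oplus>\<^bsub>H\<^esub>b\<in>B. ip H b x \<odot>\<^bsub>H\<^esub> b)" if "x \<in> lspan H B" for x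
  proof (rule fd_hilbert_eqI[OF H])
    fix z assume z: "z \<in> carrier H"
    have "ip H z x = (\<Sum>b\<in>B. ip H b x * ip H z b)" using that
    proof induction
      case (base a)
      have "(\<Sum>b\<in>B. ip H b a * ip H z b) = (\<Sum>b\<in>B. if b = a then ip H z b else 0)"
        using base on by (intro sum.cong) auto
      then show ?case using B base by simp
    qed (use H B lspan_closed[OF H B(2)] z in
        \<open>auto simp: subset_eq sum.distrib algebra_simps sum_distrib_left\<close>)
    then show "ip H z x = ip H z (\<Oplus>\<^bsub>H\<^esub>b\<in>B. ip H b x \<odot>\<^bsub>H\<^esub> b)" using H B z by (simp add: ip_finsum)
  qed (use that H B lspan_closed[OF H B(2)] in auto)
  note expand = this
  have "\<exists>c. x = (\<Oplus>\<^bsub>H\<^esub>b\<in>B. c b \<odot>\<^bsub>H\<^esub> b)" if "x \<in> carrier H" for x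
    using expand[of x] that S(2) lspan_least[OF B(3)] unfolding spans_def by (intro exI) auto
  then have "onb H B" using B(1,2) on by (simp add: onb_def)
  then show ?thesis ..
qed

lemma onb_some: "fd_hilbert H \<Longrightarrow> onb H (SOME B. onb H B)"
  using onb_exists someI_ex by metis

lemma onb_spans:
  assumes H: "fd_hilbert H" and B: "onb H B"
  shows "spans H B"
  using onb_expand[OF H B] finsum_in_lspan[OF H, of B] B
  by (fastforce simp: onb_def spans_def)


subsection \<open>Linear maps\<close>

text \<open>The next facts must be instantiated before they serve as rewrite rules, because their left
  sides have a variable in function position.\<close>

lemma lin_closed: "\<lbrakk>T \<in> lin_maps H K; x \<in> carrier H\<rbrakk> \<Longrightarrow> T x \<in> carrier K"
  by (auto simp: lin_maps_def)

lemma lin_add: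
  "\<lbrakk>T \<in> lin_maps H K; x \<in> carrier H; y \<in> carrier H\<rbrakk> \<Longrightarrow> T (x \<oplus>\<^bsub>H\<^esub> y) = T x \<oplus>\<^bsub>K\<^esub> T y"
  by (auto simp: lin_maps_def)

lemma lin_smult:
  "\<lbrakk>T \<in> lin_maps H K; x \<in> carrier H\<rbrakk> \<Longrightarrow> T (c \<odot>\<^bsub>H\<^esub> x) = c \<odot>\<^bsub>K\<^esub> T x"
  by (auto simp: lin_maps_def)

lemma lin_zero:
  "\<lbrakk>fd_hilbert H; fd_hilbert K; T \<in> lin_maps H K\<rbrakk> \<Longrightarrow> T \<zero>\<^bsub>H\<^esub> = \<zero>\<^bsub>K\<^esub>"
  using lin_smult[of T H K "\<zero>\<^bsub>H\<^esub>" 0] lin_closed[of T H K "\<zero>\<^bsub>H\<^esub>"] by simp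

lemmas lin = lin_closed lin_add lin_smult

lemma lin_mapsI:
  assumes "\<And>x. x \<in> carrier H \<Longrightarrow> T x \<in> carrier K" "T \<in> extensional (carrier H)"
    "\<And>x y. \<lbrakk>x \<in> carrier H; y \<in> carrier H\<rbrakk> \<Longrightarrow> T (x \<oplus>\<^bsub>H\<^esub> y) = T x \<oplus>\<^bsub>K\<^esub> T y"
    "\<And>c x. x \<in> carrier H \<Longrightarrow> T (c \<odot>\<^bsub>H\<^esub> x) = c \<odot>\<^bsub>K\<^esub> T x"
  shows "T \<in> lin_maps H K"
  using assms by (auto simp: lin_maps_def PiE_def)

lemma lin_maps_eqI:
  assumes H: "fd_hilbert H" and K: "fd_hilbert K" and A: "spans H A"
    and T: "T \<in> lin_maps H K" and T': "T' \<in> lin_maps H K"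
    and eq: "\<And>a. a \<in> A \<Longrightarrow> T a = T' a"
  shows "T = T'"
proof (rule extensionalityI[of _ "carrier H"])
  have AH: "A \<subseteq> carrier H" using A by (simp add: spans_def)
  fix x assume "x \<in> carrier H"
  then have "x \<in> lspan H A" using A by (auto simp: spans_def)
  then show "T x = T' x"
    by induction
      (simp_all add: lin[OF T] lin[OF T'] lin_zero[OF H K T] lin_zero[OF H K T'] eq
        lspan_closed[OF H AH])
qed (use T T' in \<open>auto simp: lin_maps_def PiE_def\<close>)

lemma id_lin: "fd_hilbert H \<Longrightarrow> (\<lambda>x\<in>carrier H. x) \<in> lin_maps H H"
  by (rule lin_mapsI) auto

lemma compose_lin:
  assumes "fd_hilbert H" "T \<in> lin_maps H K" "S \<in> lin_maps K M"
  shows "compose (carrier H) S T \<in> lin_maps H M"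
  by (rule lin_mapsI) (simp_all add: compose_def assms(1) lin[OF assms(2)] lin[OF assms(3)])

text \<open>Nondegeneracy of the inner product turns an adjointness relation into linearity.\<close>

lemma lin_of_adjointness:
  assumes H: "fd_hilbert H" and K: "fd_hilbert K"
    and closed: "\<And>y. y \<in> carrier K \<Longrightarrow> S y \<in> carrier H" and ext: "S \<in> extensional (carrier K)"
    and T: "\<And>z. z \<in> carrier H \<Longrightarrow> T z \<in> carrier K"
    and adj: "\<And>y z. \<lbrakk>y \<in> carrier K; z \<in> carrier H\<rbrakk> \<Longrightarrow> ip H (S y) z = ip K y (T z)"
  shows "S \<in> lin_maps K H"
proof -
  have adj': "ip H z (S y) = ip K (T z) y" if "y \<in> carrier K" "z \<in> carrier H" for y z
    using adj[OF that] ip_swap[OF H closed[OF that(1)] that(2)]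
      ip_swap[OF K that(1) T[OF that(2)]] by simp
  show ?thesis
  proof (rule lin_mapsI)
    fix x y assume "x \<in> carrier K" "y \<in> carrier K"
    then show "S (x \<oplus>\<^bsub>K\<^esub> y) = S x \<oplus>\<^bsub>H\<^esub> S y"
      by (intro fd_hilbert_eqI[OF H]) (simp_all add: H K closed adj' T)
  next
    fix c x assume "x \<in> carrier K"
    then show "S (c \<odot>\<^bsub>K\<^esub> x) = c \<odot>\<^bsub>H\<^esub> S x"
      by (intro fd_hilbert_eqI[OF H]) (simp_all add: H K closed adj' T)
  qed (use closed ext in auto)
qed

text \<open>The vector that represents \<open>f\<close> has the coefficients \<open>cnj (f b)\<close> in an orthonormal basis.\<close>

lemma riesz:
  assumes H: "fd_hilbert H"
    and add: "\<And>x y. \<lbrakk>x \<in> carrier H; y \<in> carrier H\<rbrakk> \<Longrightarrow> f (x \<oplus>\<^bsub>H\<^esub> y) = f x + f y"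
    and smult: "\<And>c x. x \<in> carrier H \<Longrightarrow> f (c \<odot>\<^bsub>H\<^esub> x) = c * f x"
  shows "\<exists>!x. x \<in> carrier H \<and> (\<forall>z\<in>carrier H. ip H x z = f z)"
proof (rule ex_ex1I)
  obtain B where B: "onb H B" using onb_exists[OF H] ..
  then have fB: "finite B" "B \<subseteq> carrier H" by (auto simp: onb_def)
  define x where "x = (\<Oplus>\<^bsub>H\<^esub>b\<in>B. cnj (f b) \<odot>\<^bsub>H\<^esub> b)"
  have x: "x \<in> carrier H" using H fB by (simp add: x_def)
  have f0: "f \<zero>\<^bsub>H\<^esub> = 0" using smult[of "\<zero>\<^bsub>H\<^esub>" 0] H by simp
  have "ip H x z = f z" if "z \<in> carrier H" for z
  proof -
    have "z \<in> lspan H B" using onb_spans[OF H B] that by (auto simp: spans_def)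
    then show ?thesis
    proof induction
      case (base a)
      have "ip H a x = (\<Sum>b\<in>B. cnj (f b) * ip H a b)"
        unfolding x_def using H fB base by (intro ip_finsum) auto
      also have "\<dots> = (\<Sum>b\<in>B. if a = b then cnj (f b) else 0)"
        using B base by (intro sum.cong) (auto simp: onb_def)
      finally have "ip H a x = cnj (f a)" using fB base by simp
      then show ?case using ip_swap[OF H, of a x] x base fB by auto
    qed (use H x lspan_closed[OF H fB(2)] in \<open>auto simp: add smult f0\<close>)
  qed
  then show "\<exists>x. x \<in> carrier H \<and> (\<forall>z\<in>carrier H. ip H x z = f z)" using x by blast
next
  fix x y assume xy: "x \<in> carrier H \<and> (\<forall>z\<in>carrier H. ip H x z = f z)"
    "y \<in> carrier H \<and> (\<forall>z\<in>carrier H. ip H y z = f z)"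
  show "x = y"
  proof (rule fd_hilbert_eqI[OF H])
    fix z assume "z \<in> carrier H"
    then show "ip H z x = ip H z y"
      using xy ip_swap[OF H, of x z] ip_swap[OF H, of y z] by metis
  qed (use xy in auto)
qed

context
  fixes H :: "'a hilb" and K :: "'b hilb" and T
  assumes H: "fd_hilbert H" and K: "fd_hilbert K" and T: "T \<in> lin_maps H K"
begin

lemma adjoint_char:
  assumes y: "y \<in> carrier K"
  shows "adjoint H K T y \<in> carrier H \<and> (\<forall>z\<in>carrier H. ip H (adjoint H K T y) z = ip K y (T z))"
proof -
  have "\<exists>!x. x \<in> carrier H \<and> (\<forall>z\<in>carrier H. ip H x z = ip K y (T z))"
    by (rule riesz[OF H]) (simp_all add: H K y lin[OF T])
  from theI'[OF this] show ?thesis using y by (simp add: adjoint_def)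
qed

lemma adjoint_closed [simp]: "y \<in> carrier K \<Longrightarrow> adjoint H K T y \<in> carrier H"
  using adjoint_char by blast

lemma adjoint_ip: "\<lbrakk>y \<in> carrier K; z \<in> carrier H\<rbrakk> \<Longrightarrow> ip H (adjoint H K T y) z = ip K y (T z)"
  using adjoint_char by blast

lemma adjoint_ip': "\<lbrakk>y \<in> carrier K; z \<in> carrier H\<rbrakk> \<Longrightarrow> ip H z (adjoint H K T y) = ip K (T z) y"
  using adjoint_ip[of y z] ip_swap[OF H, of "adjoint H K T y" z] ip_swap[OF K, of y "T z"] lin_closed[OF T] by simp

lemma adjoint_lin: "adjoint H K T \<in> lin_maps K H"
proof (rule lin_of_adjointness[OF H K])
  show "adjoint H K T \<in> extensional (carrier K)" by (auto simp: adjoint_def)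
qed (simp_all add: adjoint_ip lin[OF T])

lemma adjoint_eqI:
  assumes "\<And>y. y \<in> carrier K \<Longrightarrow> S y \<in> carrier H" and "S \<in> extensional (carrier K)"
    and "\<And>y z. \<lbrakk>y \<in> carrier K; z \<in> carrier H\<rbrakk> \<Longrightarrow> ip H z (S y) = ip K (T z) y"
  shows "S = adjoint H K T"
proof (rule extensionalityI[of _ "carrier K"])
  fix y assume "y \<in> carrier K"
  then show "S y = adjoint H K T y"
    by (intro fd_hilbert_eqI[OF H]) (auto simp: assms adjoint_ip')
qed (use assms in \<open>auto simp: adjoint_def\<close>)

end


subsection \<open>Linear maps given on spanning families\<close>

text \<open>The graph of the linear extension of \<open>g i \<mapsto> k i\<close>. It is single-valued as soon as the two
  families have the same Gram matrix, since the difference of two values then has norm zero.\<close>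

inductive ext_graph :: "'a hilb \<Rightarrow> 'b hilb \<Rightarrow> 'i set \<Rightarrow> ('i \<Rightarrow> 'a) \<Rightarrow> ('i \<Rightarrow> 'b) \<Rightarrow> 'a \<Rightarrow> 'b \<Rightarrow> bool"
  for H K I g k where
  zero: "ext_graph H K I g k \<zero>\<^bsub>H\<^esub> \<zero>\<^bsub>K\<^esub>"
| base: "i \<in> I \<Longrightarrow> ext_graph H K I g k (g i) (k i)"
| add: "\<lbrakk>ext_graph H K I g k x y; ext_graph H K I g k x' y'\<rbrakk>
    \<Longrightarrow> ext_graph H K I g k (x \<oplus>\<^bsub>H\<^esub> x') (y \<oplus>\<^bsub>K\<^esub> y')"
| smult: "ext_graph H K I g k x y \<Longrightarrow> ext_graph H K I g k (c \<odot>\<^bsub>H\<^esub> x) (c \<odot>\<^bsub>K\<^esub> y)"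

lemma isometric_extension:
  fixes g :: "'i \<Rightarrow> 'a" and k :: "'i \<Rightarrow> 'b"
  assumes H: "fd_hilbert H" and K: "fd_hilbert K"
    and g: "spans H (g ` I)" and k: "k ` I \<subseteq> carrier K"
    and gram: "\<And>i j. \<lbrakk>i \<in> I; j \<in> I\<rbrakk> \<Longrightarrow> ip K (k i) (k j) = ip H (g i) (g j)"
  obtains T where "T \<in> lin_maps H K" "\<And>i. i \<in> I \<Longrightarrow> T (g i) = k i"
proof -
  let ?G = "ext_graph H K I g k"
  have gH: "g ` I \<subseteq> carrier H" using g by (simp add: spans_def)
  have closed: "x \<in> carrier H \<and> y \<in> carrier K" if "?G x y" for x y
    using that by induction (use H K gH k in auto)
  have ip1: "ip K (k i) y = ip H (g i) x" if "?G x y" "i \<in> I" for x y i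
    using that by induction (use H K gH k gram closed in \<open>auto simp: image_subset_iff\<close>)
  have ip2: "ip K y' y = ip H x' x" if "?G x' y'" "?G x y" for x y x' y'
    using that by induction (use H K gH k ip1 closed in \<open>auto simp: image_subset_iff\<close>)
  have total: "\<exists>y. ?G x y" if "x \<in> carrier H" for x
  proof -
    have "x \<in> lspan H (g ` I)" using that g by (auto simp: spans_def)
    then show ?thesis by induction (auto intro: ext_graph.intros)
  qed
  have uniq: "y = y'" if "?G x y" "?G x y'" for x y y'
  proof -
    let ?d = "y \<oplus>\<^bsub>K\<^esub> (- 1) \<odot>\<^bsub>K\<^esub> y'"
    have c: "x \<in> carrier H" "y \<in> carrier K" "y' \<in> carrier K" using closed that by auto
    have "?G (x \<oplus>\<^bsub>H\<^esub> (- 1) \<odot>\<^bsub>H\<^esub> x) ?d" using that by (intro ext_graph.intros)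
    from ip2[OF this this] have "ip K ?d ?d = 0" using H c by simp
    then have d: "?d = \<zero>\<^bsub>K\<^esub>" using ip_self_eq_0[OF K] K c by simp
    show "y = y'"
    proof (rule fd_hilbert_eqI[OF K])
      fix z assume z: "z \<in> carrier K"
      then have "ip K z ?d = ip K z y - ip K z y'" using K c by simp
      then show "ip K z y = ip K z y'" using d K z by simp
    qed (use c in auto)
  qed
  define T where "T = (\<lambda>x\<in>carrier H. SOME y. ?G x y)"
  have T: "?G x (T x)" if "x \<in> carrier H" for x
    using someI_ex[OF total[OF that]] that by (simp add: T_def)
  have "T \<in> lin_maps H K"
  proof (rule lin_mapsI)
    fix x y assume "x \<in> carrier H" "y \<in> carrier H"
    then show "T (x \<oplus>\<^bsub>H\<^esub> y) = T x \<oplus>\<^bsub>K\<^esub> T y"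
      using H by (intro uniq[OF T ext_graph.add[OF T T]]) auto
  next
    fix c x assume "x \<in> carrier H"
    then show "T (c \<odot>\<^bsub>H\<^esub> x) = c \<odot>\<^bsub>K\<^esub> T x"
      using H by (intro uniq[OF T ext_graph.smult[OF T]]) auto
  qed (use closed T in \<open>auto simp: T_def\<close>)
  moreover have "T (g i) = k i" if "i \<in> I" for i
    using that gH by (intro uniq[OF T ext_graph.base]) auto
  ultimately show ?thesis by (rule that)
qed

text \<open>This is the form in which the coherence isomorphisms are defined: a definite description
  by the values on a spanning family. They are unitary since they match families with the same
  Gram matrix. The predicate \<open>P\<close> stands for the differently quantified ways of stating the
  values.\<close>

lemma unitary_extension:
  fixes g :: "'i \<Rightarrow> 'a" and k :: "'i \<Rightarrow> 'b"
  assumes H: "fd_hilbert H" and K: "fd_hilbert K"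
    and g: "spans H (g ` I)" and k: "spans K (k ` I)"
    and gram: "\<And>i j. \<lbrakk>i \<in> I; j \<in> I\<rbrakk> \<Longrightarrow> ip K (k i) (k j) = ip H (g i) (g j)"
    and P: "\<And>T. P T \<longleftrightarrow> (\<forall>i\<in>I. T (g i) = k i)"
  defines "U \<equiv> THE T. T \<in> lin_maps H K \<and> P T"
  shows "U \<in> lin_maps H K" and "i \<in> I \<Longrightarrow> U (g i) = k i"
    and "bij_betw U (carrier H) (carrier K)"
proof -
  have gH: "g ` I \<subseteq> carrier H" and kK: "k ` I \<subseteq> carrier K" using g k by (auto simp: spans_def)
  obtain T where T: "T \<in> lin_maps H K" "\<And>i. i \<in> I \<Longrightarrow> T (g i) = k i"
    using isometric_extension[OF H K g kK gram] by blast
  obtain T' where T': "T' \<in> lin_maps K H" "\<And>i. i \<in> I \<Longrightarrow> T' (k i) = g i"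
    using isometric_extension[OF K H k gH gram[symmetric]] by blast
  have U: "U = T" unfolding U_def
  proof (rule the_equality)
    fix S assume "S \<in> lin_maps H K \<and> P S"
    then show "S = T" using T by (intro lin_maps_eqI[OF H K g]) (auto simp: P)
  qed (use T in \<open>auto simp: P\<close>)
  have "compose (carrier H) T' T = (\<lambda>x\<in>carrier H. x)"
    by (rule lin_maps_eqI[OF H H g])
      (use T T' H K gH in \<open>auto simp: id_lin compose_eq image_subset_iff intro: compose_lin\<close>)
  then have "T' (T x) = x" if "x \<in> carrier H" for x
    using that by (metis compose_eq restrict_apply')
  moreover have "compose (carrier K) T T' = (\<lambda>x\<in>carrier K. x)"
    by (rule lin_maps_eqI[OF K K k])
      (use T T' H K kK in \<open>auto simp: id_lin compose_eq image_subset_iff intro: compose_lin\<close>)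
  then have "T (T' x) = x" if "x \<in> carrier K" for x
    using that by (metis compose_eq restrict_apply')
  ultimately have "bij_betw T (carrier H) (carrier K)"
    by (intro bij_betw_byWitness[of _ T']) (auto simp: lin_closed[OF T(1)] lin_closed[OF T'(1)])
  then show "U \<in> lin_maps H K" "i \<in> I \<Longrightarrow> U (g i) = k i" "bij_betw U (carrier H) (carrier K)"
    using T U by auto
qed

lemma inv_into_lin:
  assumes H: "fd_hilbert H" and T: "T \<in> lin_maps H K" and bij: "bij_betw T (carrier H) (carrier K)"
  shows "(\<lambda>y\<in>carrier K. inv_into (carrier H) T y) \<in> lin_maps K H"
proof -
  have inv: "inv_into (carrier H) T y \<in> carrier H" "T (inv_into (carrier H) T y) = y"
    if "y \<in> carrier K" for y
    using bij that by (auto simp: bij_betw_def inv_into_into f_inv_into_f)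
  have eq: "inv_into (carrier H) T y = x" if "x \<in> carrier H" "T x = y" for x y
    using bij that by (auto simp: bij_betw_def inv_into_f_eq)
  have img: "y \<in> carrier K \<longleftrightarrow> (\<exists>x\<in>carrier H. y = T x)" for y
    using bij by (auto simp: bij_betw_def)
  show ?thesis
  proof (rule lin_mapsI)
    fix x y assume xy: "x \<in> carrier K" "y \<in> carrier K"
    let ?i = "inv_into (carrier H) T"
    have "T (?i x \<oplus>\<^bsub>H\<^esub> ?i y) = x \<oplus>\<^bsub>K\<^esub> y" "?i x \<oplus>\<^bsub>H\<^esub> ?i y \<in> carrier H"
      using xy by (simp_all add: inv H lin[OF T])
    then show "(\<lambda>y\<in>carrier K. ?i y) (x \<oplus>\<^bsub>K\<^esub> y) = (\<lambda>y\<in>carrier K. ?i y) x \<oplus>\<^bsub>H\<^esub> (\<lambda>y\<in>carrier K. ?i y) y"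
      using eq xy img by (metis restrict_apply')
  next
    fix c x assume x: "x \<in> carrier K"
    let ?i = "inv_into (carrier H) T"
    have "T (c \<odot>\<^bsub>H\<^esub> ?i x) = c \<odot>\<^bsub>K\<^esub> x" "c \<odot>\<^bsub>H\<^esub> ?i x \<in> carrier H"
      using x by (simp_all add: inv H lin[OF T])
    then show "(\<lambda>y\<in>carrier K. ?i y) (c \<odot>\<^bsub>K\<^esub> x) = c \<odot>\<^bsub>H\<^esub> (\<lambda>y\<in>carrier K. ?i y) x"
      using eq x img by (metis restrict_apply')
  qed (use inv in auto)
qed


section \<open>Tensor products and direct sums\<close>

subsection \<open>Scalars\<close>

lemma scalar_hilb_simps [simp]:
  "carrier scalar_hilb = UNIV" "\<zero>\<^bsub>scalar_hilb\<^esub> = 0" "x \<oplus>\<^bsub>scalar_hilb\<^esub> y = x + y"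
  "c \<odot>\<^bsub>scalar_hilb\<^esub> x = c * x" "ip scalar_hilb x y = cnj x * y"
  by (simp_all add: scalar_hilb_def)

lemma zero_hilb_simps [simp]:
  "carrier zero_hilb = {0}" "\<zero>\<^bsub>zero_hilb\<^esub> = 0" "x \<oplus>\<^bsub>zero_hilb\<^esub> y = x + y"
  "c \<odot>\<^bsub>zero_hilb\<^esub> x = c * x" "ip zero_hilb x y = cnj x * y"
  by (simp_all add: zero_hilb_def scalar_hilb_def)

lemma scalar_hilb_spans: "spans scalar_hilb {1}"
proof -
  have "x \<in> lspan scalar_hilb {1}" for x
    using lspan.smult[OF lspan.base, of 1 "{1}" scalar_hilb x] by simp
  then show ?thesis by (auto simp: spans_def)
qed

lemma fd_scalar_hilb [simp]: "fd_hilbert scalar_hilb"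
proof (rule fd_hilbertI[where I = UNIV and e = "\<lambda>_. id"])
  fix x :: complex assume "x \<noteq> \<zero>\<^bsub>scalar_hilb\<^esub>"
  then show "0 < Re (ip scalar_hilb x x)"
    by (simp add: complex_eq_iff) (metis not_sum_power2_lt_zero not_less_iff_gr_or_eq 
        power2_eq_square sum_power2_eq_zero_iff)
qed (use scalar_hilb_spans in \<open>auto simp: algebra_simps\<close>)

lemma fd_zero_hilb [simp]: "fd_hilbert zero_hilb"
proof (rule fd_hilbertI[where I = UNIV and e = "\<lambda>_. id"])
  show "spans zero_hilb {}"
    using lspan.zero[of zero_hilb "{}"] by (simp add: spans_def)
qed auto


subsection \<open>Tensor products\<close>

lemma tensor_carrier:
  "F \<in> carrier (tensor H K) \<longleftrightarrow> F \<in> extensional (carrier H \<times> carrier K) \<and> conj_bilinear H K F"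
  by (simp add: tensor_def Let_def)

lemma tensor_ops:
  "\<zero>\<^bsub>tensor H K\<^esub> = (\<lambda>p\<in>carrier H \<times> carrier K. 0)"
  "F \<oplus>\<^bsub>tensor H K\<^esub> G = (\<lambda>p\<in>carrier H \<times> carrier K. F p + G p)"
  "c \<odot>\<^bsub>tensor H K\<^esub> F = (\<lambda>p\<in>carrier H \<times> carrier K. c * F p)"
  "ip (tensor H K) F G = (\<Sum>p \<in> (SOME B. onb H B) \<times> (SOME B. onb K B). cnj (F p) * G p)"
  by (simp_all add: tensor_def Let_def)

lemma tensor_eqI:
  assumes "F \<in> carrier (tensor H K)" "G \<in> carrier (tensor H K)"
    and "\<And>x y. \<lbrakk>x \<in> carrier H; y \<in> carrier K\<rbrakk> \<Longrightarrow> F (x, y) = G (x, y)"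
  shows "F = G"
  by (rule extensionalityI[of _ "carrier H \<times> carrier K"]) (use assms in \<open>auto simp: tensor_carrier\<close>)

lemma pure_tensor_apply [simp]:
  "\<lbrakk>x \<in> carrier H; y \<in> carrier K\<rbrakk> \<Longrightarrow> pure_tensor H K h k (x, y) = ip H x h * ip K y k"
  by (simp add: pure_tensor_def)

lemma conj_bilinear_simps:
  assumes "conj_bilinear H K F"
  shows "\<lbrakk>x \<in> carrier H; x' \<in> carrier H; y \<in> carrier K\<rbrakk> \<Longrightarrow> F (x \<oplus>\<^bsub>H\<^esub> x', y) = F (x, y) + F (x', y)"
    and "\<lbrakk>x \<in> carrier H; y \<in> carrier K; y' \<in> carrier K\<rbrakk> \<Longrightarrow> F (x, y \<oplus>\<^bsub>K\<^esub> y') = F (x, y) + F (x, y')"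
    and "\<lbrakk>x \<in> carrier H; y \<in> carrier K\<rbrakk> \<Longrightarrow> F (c \<odot>\<^bsub>H\<^esub> x, y) = cnj c * F (x, y)"
    and "\<lbrakk>x \<in> carrier H; y \<in> carrier K\<rbrakk> \<Longrightarrow> F (x, c \<odot>\<^bsub>K\<^esub> y) = cnj c * F (x, y)"
  using assms by (auto simp: conj_bilinear_def)

context
  fixes H :: "'a hilb" and K :: "'b hilb"
  assumes H: "fd_hilbert H" and K: "fd_hilbert K"
begin

lemma conj_bilinear_zero:
  assumes F: "conj_bilinear H K F"
  shows "x \<in> carrier H \<Longrightarrow> F (x, \<zero>\<^bsub>K\<^esub>) = 0" "y \<in> carrier K \<Longrightarrow> F (\<zero>\<^bsub>H\<^esub>, y) = 0"
  using conj_bilinear_simps(4)[OF F, of x "\<zero>\<^bsub>K\<^esub>" 0] conj_bilinear_simps(3)[OF F, of "\<zero>\<^bsub>H\<^esub>" y 0]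
  by (simp_all add: H K)

lemma conj_bilinear_eqI:
  assumes A: "spans H A" and B: "spans K B" and F: "conj_bilinear H K F" and G: "conj_bilinear H K G"
    and eq: "\<And>a b. \<lbrakk>a \<in> A; b \<in> B\<rbrakk> \<Longrightarrow> F (a, b) = G (a, b)"
    and x: "x \<in> carrier H" and y: "y \<in> carrier K"
  shows "F (x, y) = G (x, y)"
proof -
  have AH: "A \<subseteq> carrier H" and BK: "B \<subseteq> carrier K" using A B by (auto simp: spans_def)
  note simps = H K conj_bilinear_simps[OF F] conj_bilinear_simps[OF G] conj_bilinear_zero[OF F]
    conj_bilinear_zero[OF G] lspan_closed[OF H AH] lspan_closed[OF K BK]
  have 1: "F (a, y) = G (a, y)" if a: "a \<in> A" for a
  proof -
    have aH: "a \<in> carrier H" using a AH by auto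
    have "y \<in> lspan K B" using y B by (auto simp: spans_def)
    then show ?thesis by induction (simp_all add: simps aH a eq)
  qed
  have "x \<in> lspan H A" using x A by (auto simp: spans_def)
  then show ?thesis by induction (simp_all add: simps y 1)
qed

lemma conj_bilinear_expand:
  assumes B: "onb H B" and C: "onb K C" and F: "conj_bilinear H K F"
    and x: "x \<in> carrier H" and y: "y \<in> carrier K"
  shows "F (x, y) = (\<Sum>q\<in>B \<times> C. F q * (ip H x (fst q) * ip K y (snd q)))"
proof -
  let ?G = "\<lambda>(x, y). \<Sum>q\<in>B \<times> C. F q * (ip H x (fst q) * ip K y (snd q))"
  have fB: "finite B" "B \<subseteq> carrier H" "finite C" "C \<subseteq> carrier K"
    using B C by (auto simp: onb_def)
  have "F (x, y) = ?G (x, y)"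
  proof (rule conj_bilinear_eqI[OF onb_spans[OF H B] onb_spans[OF K C] F _ _ x y])
    have "\<And>p. p \<in> B \<times> C \<Longrightarrow> fst p \<in> carrier H \<and> snd p \<in> carrier K" using fB by auto
    then show "conj_bilinear H K ?G"
      by (auto simp: conj_bilinear_def H K sum_distrib_left algebra_simps
          simp flip: sum.distrib intro!: sum.cong)
    fix a b assume ab: "a \<in> B" "b \<in> C"
    have "?G (a, b) = (\<Sum>q\<in>B \<times> C. if q = (a, b) then F q else 0)"
      unfolding prod.case
    proof (rule sum.cong)
      fix q assume "q \<in> B \<times> C"
      then show "F q * (ip H a (fst q) * ip K b (snd q)) = (if q = (a, b) then F q else 0)"
        using onb_ip[OF B ab(1), of "fst q"] onb_ip[OF C ab(2), of "snd q"] by (auto split: if_splits)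
    qed simp
    then show "F (a, b) = ?G (a, b)" using fB ab by simp
  qed
  then show ?thesis by simp
qed

lemma pure_conj_bilinear: "\<lbrakk>h \<in> carrier H; k \<in> carrier K\<rbrakk> \<Longrightarrow> conj_bilinear H K (pure_tensor H K h k)"
  by (simp add: conj_bilinear_def H K algebra_simps)

lemma pure_tensor_closed: "\<lbrakk>h \<in> carrier H; k \<in> carrier K\<rbrakk> \<Longrightarrow> pure_tensor H K h k \<in> carrier (tensor H K)"
  by (simp add: tensor_carrier pure_conj_bilinear) (simp add: pure_tensor_def)

lemma pure_tensor_bilinear:
  "\<lbrakk>h \<in> carrier H; h' \<in> carrier H\<rbrakk>
    \<Longrightarrow> pure_tensor H K (h \<oplus>\<^bsub>H\<^esub> h') k = pure_tensor H K h k \<oplus>\<^bsub>tensor H K\<^esub> pure_tensor H K h' k"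
  "\<lbrakk>k \<in> carrier K; k' \<in> carrier K\<rbrakk>
    \<Longrightarrow> pure_tensor H K h (k \<oplus>\<^bsub>K\<^esub> k') = pure_tensor H K h k \<oplus>\<^bsub>tensor H K\<^esub> pure_tensor H K h k'"
  "h \<in> carrier H \<Longrightarrow> pure_tensor H K (c \<odot>\<^bsub>H\<^esub> h) k = c \<odot>\<^bsub>tensor H K\<^esub> pure_tensor H K h k"
  "k \<in> carrier K \<Longrightarrow> pure_tensor H K h (c \<odot>\<^bsub>K\<^esub> k) = c \<odot>\<^bsub>tensor H K\<^esub> pure_tensor H K h k"
  "pure_tensor H K \<zero>\<^bsub>H\<^esub> k = \<zero>\<^bsub>tensor H K\<^esub>"
  "pure_tensor H K h \<zero>\<^bsub>K\<^esub> = \<zero>\<^bsub>tensor H K\<^esub>"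
  by (auto simp: pure_tensor_def tensor_ops H K algebra_simps intro!: restrict_ext)

lemma pure_in_lspan:
  assumes A: "spans H A" and B: "spans K B" and h: "h \<in> carrier H" and k: "k \<in> carrier K"
  shows "pure_tensor H K h k \<in> lspan (tensor H K) {pure_tensor H K a b |a b. a \<in> A \<and> b \<in> B}"
    (is "_ \<in> ?L")
proof -
  have AH: "A \<subseteq> carrier H" and BK: "B \<subseteq> carrier K" using A B by (auto simp: spans_def)
  have 1: "pure_tensor H K a k \<in> ?L" if a: "a \<in> A" for a
  proof -
    have aH: "a \<in> carrier H" using a AH by auto
    have "k \<in> lspan K B" using k B by (auto simp: spans_def)
    then show ?thesis
    proof induction
      case (base b)
      then show ?case using a by (intro lspan.base) auto
    qed (simp_all add: pure_tensor_bilinear aH lspan_closed[OF K BK] lspan.intros)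
  qed
  have "h \<in> lspan H A" using h A by (auto simp: spans_def)
  then show ?thesis
    by induction (simp_all add: pure_tensor_bilinear k lspan_closed[OF H AH] lspan.intros 1)
qed

text \<open>The sum that defines this inner product is the expansion of \<open>F(h, k)\<close> in two orthonormal bases.
  So pure tensors reproduce values, whichever bases are chosen.\<close>

lemma ip_pure_left:
  assumes F: "F \<in> carrier (tensor H K)" and h: "h \<in> carrier H" and k: "k \<in> carrier K"
  shows "ip (tensor H K) (pure_tensor H K h k) F = F (h, k)"
proof -
  define B where "B = (SOME B. onb H B)"
  define C where "C = (SOME B. onb K B)"
  have B: "onb H B" and C: "onb K C" using onb_some H K by (auto simp: B_def C_def)
  have fB: "finite B" "B \<subseteq> carrier H" "finite C" "C \<subseteq> carrier K"
    using B C by (auto simp: onb_def)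
  have bil: "conj_bilinear H K F" using F by (simp add: tensor_carrier)
  have "F (h, k) = (\<Sum>p\<in>B \<times> C. F p * (ip H h (fst p) * ip K k (snd p)))"
    by (rule conj_bilinear_expand[OF B C bil h k])
  also have "\<dots> = (\<Sum>p\<in>B \<times> C. cnj (pure_tensor H K h k p) * F p)"
  proof (rule sum.cong)
    fix p assume "p \<in> B \<times> C"
    then obtain b c where p: "p = (b, c)" "b \<in> carrier H" "c \<in> carrier K" using fB by auto
    then show "F p * (ip H h (fst p) * ip K k (snd p)) = cnj (pure_tensor H K h k p) * F p"
      using ip_swap[OF H p(2) h] ip_swap[OF K p(3) k] by simp
  qed simp
  finally show ?thesis by (simp add: tensor_ops B_def C_def)
qed

text \<open>The expansion of a form in two orthonormal bases says that the tensor products of basis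
  vectors span. It also gives positivity: a form that vanishes on all pairs of basis vectors is
  zero.\<close>

lemma fd_tensor: "fd_hilbert (tensor H K)"
  and spans_tensor_onb: "\<lbrakk>onb H B; onb K C\<rbrakk>
    \<Longrightarrow> spans (tensor H K) {pure_tensor H K b c |b c. b \<in> B \<and> c \<in> C}"
proof -
  let ?D = "carrier H \<times> carrier K"
  have span: "spans (tensor H K) {pure_tensor H K b c |b c. b \<in> B \<and> c \<in> C}" (is "spans _ ?S")
    if BC: "onb H B" "onb K C" for B C
    unfolding spans_def
  proof (intro conjI subsetI)
    have fB: "finite B" "B \<subseteq> carrier H" "finite C" "C \<subseteq> carrier K"
      using BC by (auto simp: onb_def)
    then show "x \<in> carrier (tensor H K)" if "x \<in> ?S" for x
      using that by (auto intro!: pure_tensor_closed)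
    fix F assume F: "F \<in> carrier (tensor H K)"
    then have bil: "conj_bilinear H K F" by (simp add: tensor_carrier)
    let ?p = "\<lambda>q. pure_tensor H K (fst q) (snd q)"
    let ?G = "\<lambda>Q. \<lambda>p\<in>?D. \<Sum>q\<in>Q. F q * ?p q p"
    have "?G Q \<in> lspan (tensor H K) ?S" if "finite Q" "Q \<subseteq> B \<times> C" for Q
      using that
    proof (induction Q rule: finite_induct)
      case empty
      have G: "?G {} = \<zero>\<^bsub>tensor H K\<^esub>" by (simp add: tensor_ops)
      show ?case unfolding G by (rule lspan.zero)
    next
      case (insert q Q)
      have eq: "?G (insert q Q) = F q \<odot>\<^bsub>tensor H K\<^esub> ?p q \<oplus>\<^bsub>tensor H K\<^esub> ?G Q"
        using insert by (auto simp: tensor_ops intro!: restrict_ext)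
      obtain b c where "q = (b, c)" "b \<in> B" "c \<in> C" using insert.prems by auto
      then have "?p q \<in> ?S" by (intro CollectI exI[of _ b] exI[of _ c]) simp
      moreover have "?G Q \<in> lspan (tensor H K) ?S"
        by (rule insert.IH) (use insert.prems in simp)
      ultimately show ?case unfolding eq by (rule lspan.add[OF lspan.smult[OF lspan.base]])
    qed
    from this[of "B \<times> C"] have G: "?G (B \<times> C) \<in> lspan (tensor H K) ?S" using fB by simp
    have "F = ?G (B \<times> C)"
    proof (rule extensionalityI[of _ ?D])
      fix p assume "p \<in> ?D"
      then obtain x y where p: "p = (x, y)" "x \<in> carrier H" "y \<in> carrier K" by auto
      have "F (x, y) = (\<Sum>q\<in>B \<times> C. F q * (ip H x (fst q) * ip K y (snd q)))"
        by (rule conj_bilinear_expand[OF BC bil p(2,3)])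
      then show "F p = ?G (B \<times> C) p" using p by (simp add: pure_tensor_def)
    qed (use F in \<open>auto simp: tensor_carrier\<close>)
    then show "F \<in> lspan (tensor H K) ?S" using G by simp
  qed
  then show "\<lbrakk>onb H B; onb K C\<rbrakk> \<Longrightarrow> spans (tensor H K) {pure_tensor H K b c |b c. b \<in> B \<and> c \<in> C}" .
  define B where "B = (SOME B. onb H B)"
  define C where "C = (SOME B. onb K B)"
  have B: "onb H B" and C: "onb K C" using onb_some H K by (auto simp: B_def C_def)
  have fB: "finite B" "B \<subseteq> carrier H" "finite C" "C \<subseteq> carrier K"
    using B C by (auto simp: onb_def)
  note ip = tensor_ops(4)[of H K, folded B_def C_def]
  show "fd_hilbert (tensor H K)"
  proof (rule fd_hilbertI[where I = ?D and e = "\<lambda>p F. F p" and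
        S = "{pure_tensor H K b c |b c. b \<in> B \<and> c \<in> C}"])
    show "\<zero>\<^bsub>tensor H K\<^esub> \<in> carrier (tensor H K)"
      by (auto simp: tensor_carrier tensor_ops conj_bilinear_def H K)
    show "x \<oplus>\<^bsub>tensor H K\<^esub> y \<in> carrier (tensor H K)"
      if "x \<in> carrier (tensor H K)" "y \<in> carrier (tensor H K)" for x y
      using that by (auto simp: tensor_carrier tensor_ops conj_bilinear_def H K algebra_simps)
    show "c \<odot>\<^bsub>tensor H K\<^esub> x \<in> carrier (tensor H K)"
      if "x \<in> carrier (tensor H K)" for c x
      using that by (auto simp: tensor_carrier tensor_ops conj_bilinear_def H K algebra_simps)
    show "x = y" if "x \<in> carrier (tensor H K)" "y \<in> carrier (tensor H K)"
      "\<And>p. p \<in> ?D \<Longrightarrow> x p = y p" for x y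
      using that by (intro tensor_eqI) auto
    show "ip (tensor H K) x (y \<oplus>\<^bsub>tensor H K\<^esub> z) = ip (tensor H K) x y + ip (tensor H K) x z" for x y z
      using fB by (auto simp: ip tensor_ops(2) algebra_simps subset_eq simp flip: sum.distrib
          intro!: sum.cong)
    show "ip (tensor H K) x (c \<odot>\<^bsub>tensor H K\<^esub> y) = c * ip (tensor H K) x y" for c x y
      using fB by (auto simp: ip tensor_ops(3) sum_distrib_left subset_eq intro!: sum.cong)
    show "ip (tensor H K) y x = cnj (ip (tensor H K) x y)" for x y
      by (simp add: ip mult.commute)
    show "0 < Re (ip (tensor H K) F F)"
      if F: "F \<in> carrier (tensor H K)" and nz: "F \<noteq> \<zero>\<^bsub>tensor H K\<^esub>" for F
    proof -
      have bil: "conj_bilinear H K F" using F by (simp add: tensor_carrier)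
      have "\<exists>p\<in>B \<times> C. F p \<noteq> 0"
      proof (rule ccontr)
        assume "\<not> (\<exists>p\<in>B \<times> C. F p \<noteq> 0)"
        then have 0: "F (b, c) = 0" if "b \<in> B" "c \<in> C" for b c using that by auto
        have cz: "conj_bilinear H K (\<lambda>p. 0)" by (simp add: conj_bilinear_def)
        have "F = \<zero>\<^bsub>tensor H K\<^esub>"
        proof (rule extensionalityI[of _ ?D])
          fix p assume p: "p \<in> ?D"
          have "F (fst p, snd p) = 0"
            by (rule conj_bilinear_eqI[OF onb_spans[OF H B] onb_spans[OF K C] bil cz])
               (use 0 p in auto)
          then show "F p = \<zero>\<^bsub>tensor H K\<^esub> p" using p by (simp add: tensor_ops)
        qed (use F in \<open>auto simp: tensor_carrier tensor_ops\<close>)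
        then show False using nz by simp
      qed
      then obtain p where p: "p \<in> B \<times> C" "F p \<noteq> 0" by auto
      have "ip (tensor H K) F F = complex_of_real (\<Sum>p\<in>B \<times> C. (cmod (F p))\<^sup>2)"
        unfolding ip of_real_sum complex_norm_square by (simp add: mult.commute)
      moreover have "0 < (\<Sum>p\<in>B \<times> C. (cmod (F p))\<^sup>2)"
        using p fB by (intro sum_pos2[of _ p]) auto
      ultimately show ?thesis by simp
    qed
    have "{pure_tensor H K b c |b c. b \<in> B \<and> c \<in> C} = (\<lambda>(b, c). pure_tensor H K b c) ` (B \<times> C)"
      by auto
    then show "finite {pure_tensor H K b c |b c. b \<in> B \<and> c \<in> C}" using fB by simp
  qed (use span[OF B C] in \<open>auto simp: tensor_ops\<close>)
qed

lemma spans_tensor: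
  assumes "spans H A" "spans K B"
  shows "spans (tensor H K) {pure_tensor H K a b |a b. a \<in> A \<and> b \<in> B}"
proof -
  obtain B' C' where BC: "onb H B'" "onb K C'" using onb_exists[OF H] onb_exists[OF K] by blast
  show ?thesis
  proof (rule spans_trans[OF spans_tensor_onb[OF BC]])
    show "{pure_tensor H K b c |b c. b \<in> B' \<and> c \<in> C'}
      \<subseteq> lspan (tensor H K) {pure_tensor H K a b |a b. a \<in> A \<and> b \<in> B}"
      using BC pure_in_lspan[OF assms] by (auto simp: onb_def)
  qed (use assms in \<open>auto simp: spans_def intro!: pure_tensor_closed\<close>)
qed

end

text \<open>Since inner products with pure tensors are evaluations, \<open>S \<otimes> T\<close> is precomposition with the
  two adjoints.\<close>

lemma
  assumes H: "fd_hilbert H" and K: "fd_hilbert K" and H': "fd_hilbert H'" and K': "fd_hilbert K'"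
    and S: "S \<in> lin_maps H H'" and T: "T \<in> lin_maps K K'"
  shows tensor_map_lin: "tensor_map H H' K K' S T \<in> lin_maps (tensor H K) (tensor H' K')"
    and tensor_map_pure: "\<And>h k. \<lbrakk>h \<in> carrier H; k \<in> carrier K\<rbrakk> \<Longrightarrow>
      tensor_map H H' K K' S T (pure_tensor H K h k) = pure_tensor H' K' (S h) (T k)"
proof -
  define U where "U = (\<lambda>F\<in>carrier (tensor H K). \<lambda>(x, y)\<in>carrier H' \<times> carrier K'.
    F (adjoint H H' S x, adjoint K K' T y))"
  note adj = adjoint_closed[OF H H' S] adjoint_closed[OF K K' T]
    lin_add[OF adjoint_lin[OF H H' S]] lin_add[OF adjoint_lin[OF K K' T]]
    lin_smult[OF adjoint_lin[OF H H' S]] lin_smult[OF adjoint_lin[OF K K' T]]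
  have U: "U \<in> lin_maps (tensor H K) (tensor H' K')"
  proof (rule lin_mapsI)
    fix F assume F: "F \<in> carrier (tensor H K)"
    then have bil: "conj_bilinear H K F" by (simp add: tensor_carrier)
    show "U F \<in> carrier (tensor H' K')"
      using F by (simp add: U_def tensor_carrier conj_bilinear_def[of H' K'] H' K' adj
          conj_bilinear_simps[OF bil])
  next
    fix F G assume F: "F \<in> carrier (tensor H K)" and G: "G \<in> carrier (tensor H K)"
    have "U (F \<oplus>\<^bsub>tensor H K\<^esub> G) = (\<lambda>(x, y)\<in>carrier H' \<times> carrier K'.
        (F \<oplus>\<^bsub>tensor H K\<^esub> G) (adjoint H H' S x, adjoint K K' T y))"
      using fd_add_closed[OF fd_tensor[OF H K] F G] by (simp add: U_def)
    also have "\<dots> = U F \<oplus>\<^bsub>tensor H' K'\<^esub> U G"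
      using F G by (auto simp: U_def tensor_ops adj intro!: restrict_ext)
    finally show "U (F \<oplus>\<^bsub>tensor H K\<^esub> G) = U F \<oplus>\<^bsub>tensor H' K'\<^esub> U G" .
  next
    fix c F assume F: "F \<in> carrier (tensor H K)"
    have "U (c \<odot>\<^bsub>tensor H K\<^esub> F) = (\<lambda>(x, y)\<in>carrier H' \<times> carrier K'.
        (c \<odot>\<^bsub>tensor H K\<^esub> F) (adjoint H H' S x, adjoint K K' T y))"
      using fd_smult_closed[OF fd_tensor[OF H K] F] by (simp add: U_def)
    also have "\<dots> = c \<odot>\<^bsub>tensor H' K'\<^esub> U F"
      using F by (auto simp: U_def tensor_ops adj intro!: restrict_ext)
    finally show "U (c \<odot>\<^bsub>tensor H K\<^esub> F) = c \<odot>\<^bsub>tensor H' K'\<^esub> U F" .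
  qed (auto simp: U_def)
  have pure: "U (pure_tensor H K h k) = pure_tensor H' K' (S h) (T k)"
    if "h \<in> carrier H" "k \<in> carrier K" for h k
    using that by (simp add: U_def pure_tensor_closed H K)
      (auto simp: pure_tensor_def[of H' K'] adj adjoint_ip[OF H H' S] adjoint_ip[OF K K' T] intro!: restrict_ext)
  have "tensor_map H H' K K' S T = U" unfolding tensor_map_def
  proof (rule the_equality)
    fix V assume "V \<in> lin_maps (tensor H K) (tensor H' K') \<and>
      (\<forall>h\<in>carrier H. \<forall>k\<in>carrier K. V (pure_tensor H K h k) = pure_tensor H' K' (S h) (T k))"
    then show "V = U"
      by (intro lin_maps_eqI[OF fd_tensor[OF H K] fd_tensor[OF H' K']
            spans_tensor[OF H K spans_carrier spans_carrier] _ U]) (auto simp: pure)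
  qed (use U pure in auto)
  then show "tensor_map H H' K K' S T \<in> lin_maps (tensor H K) (tensor H' K')"
    "\<And>h k. \<lbrakk>h \<in> carrier H; k \<in> carrier K\<rbrakk> \<Longrightarrow>
      tensor_map H H' K K' S T (pure_tensor H K h k) = pure_tensor H' K' (S h) (T k)"
    using U pure by auto
qed


subsection \<open>Direct sums\<close>

lemma dsum_simps [simp]:
  "carrier (dsum k H) = (\<Pi>\<^sub>E i\<in>{..<k}. carrier (H i))"
  "\<zero>\<^bsub>dsum k H\<^esub> = (\<lambda>i\<in>{..<k}. \<zero>\<^bsub>H i\<^esub>)"
  "u \<oplus>\<^bsub>dsum k H\<^esub> v = (\<lambda>i\<in>{..<k}. u i \<oplus>\<^bsub>H i\<^esub> v i)"
  "c \<odot>\<^bsub>dsum k H\<^esub> u = (\<lambda>i\<in>{..<k}. c \<odot>\<^bsub>H i\<^esub> u i)"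
  "ip (dsum k H) u v = (\<Sum>i<k. ip (H i) (u i) (v i))"
  by (simp_all add: dsum_def)

context
  fixes k :: nat and H :: "nat \<Rightarrow> 'a hilb"
  assumes H: "\<And>i. i < k \<Longrightarrow> fd_hilbert (H i)"
begin

lemma dsum_inj_closed: "\<lbrakk>i < k; x \<in> carrier (H i)\<rbrakk> \<Longrightarrow> dsum_inj k H i x \<in> carrier (dsum k H)"
  by (auto simp: dsum_inj_def H)

lemma dsum_inj_linear:
  shows "\<lbrakk>x \<in> carrier (H i); y \<in> carrier (H i)\<rbrakk> \<Longrightarrow>
      dsum_inj k H i (x \<oplus>\<^bsub>H i\<^esub> y) = dsum_inj k H i x \<oplus>\<^bsub>dsum k H\<^esub> dsum_inj k H i y"
    and "x \<in> carrier (H i) \<Longrightarrow>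
      dsum_inj k H i (c \<odot>\<^bsub>H i\<^esub> x) = c \<odot>\<^bsub>dsum k H\<^esub> dsum_inj k H i x"
    and "dsum_inj k H i \<zero>\<^bsub>H i\<^esub> = \<zero>\<^bsub>dsum k H\<^esub>"
  by (auto simp: dsum_inj_def zero_add_zero_fd smult_zero_fd H intro!: restrict_ext)

text \<open>An element of the sum is reached by switching on its components one after the other.\<close>

lemma spans_dsum:
  assumes A: "\<And>i. i < k \<Longrightarrow> spans (H i) (A i)"
  shows "spans (dsum k H) (\<Union>i<k. dsum_inj k H i ` A i)" (is "spans _ ?S")
  unfolding spans_def
proof (intro conjI subsetI)
  have AH: "A i \<subseteq> carrier (H i)" if "i < k" for i using A[OF that] by (simp add: spans_def)
  then show "u \<in> carrier (dsum k H)" if "u \<in> ?S" for u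
    using that dsum_inj_closed by blast
  fix u assume u: "u \<in> carrier (dsum k H)"
  have inj: "dsum_inj k H i x \<in> lspan (dsum k H) ?S" if i: "i < k" and "x \<in> carrier (H i)" for i x
  proof -
    have "x \<in> lspan (H i) (A i)" using that A by (auto simp: spans_def)
    then show ?thesis
    proof induction
      case zero
      show ?case unfolding dsum_inj_linear(3)
        by (rule lspan.zero)
    next
      case (base a)
      then show ?case using i by (intro lspan.base) auto
    next
      case (add x y)
      show ?case
        unfolding dsum_inj_linear(1)[OF lspan_closed[OF H[OF i] AH[OF i] add.hyps(1)]
            lspan_closed[OF H[OF i] AH[OF i] add.hyps(2)]]
        by (rule lspan.add) (fact add.IH)+
    next
      case (smult x c)
      note x = lspan_closed[OF H[OF i] AH[OF i] smult.hyps]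
      show ?case
        unfolding dsum_inj_linear(2)[OF x] by (rule lspan.smult) (fact smult.IH)
    qed
  qed
  have "(\<lambda>i\<in>{..<k}. if i < m then u i else \<zero>\<^bsub>H i\<^esub>) \<in> lspan (dsum k H) ?S" if "m \<le> k" for m
    using that
  proof (induction m)
    case 0
    have "(\<lambda>i\<in>{..<k}. if i < 0 then u i else \<zero>\<^bsub>H i\<^esub>) = \<zero>\<^bsub>dsum k H\<^esub>" by simp
    then show ?case using lspan.zero[of "dsum k H" ?S] by (simp del: dsum_simps)
  next
    case (Suc m)
    have um: "u m \<in> carrier (H m)" using u Suc.prems by (simp add: PiE_def Pi_def)
    have eq: "(\<lambda>i\<in>{..<k}. if i < Suc m then u i else \<zero>\<^bsub>H i\<^esub>) =
      (\<lambda>i\<in>{..<k}. if i < m then u i else \<zero>\<^bsub>H i\<^esub>) \<oplus>\<^bsub>dsum k H\<^esub> dsum_inj k H m (u m)"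
    proof -
      have "(if i < Suc m then u i else \<zero>\<^bsub>H i\<^esub>) =
        (if i < m then u i else \<zero>\<^bsub>H i\<^esub>) \<oplus>\<^bsub>H i\<^esub> (if i = m then u m else \<zero>\<^bsub>H i\<^esub>)"
        if "i < k" for i
      proof -
        have "u i \<in> carrier (H i)" using u that by (simp add: PiE_def Pi_def)
        then show ?thesis
          using H[OF that] by (intro fd_hilbert_eqI[OF H[OF that]]) (auto simp: less_Suc_eq)
      qed
      then show ?thesis by (auto simp: dsum_inj_def intro!: restrict_ext)
    qed
    have "(\<lambda>i\<in>{..<k}. if i < m then u i else \<zero>\<^bsub>H i\<^esub>) \<in> lspan (dsum k H) ?S"
      by (rule Suc.IH) (use Suc.prems in simp)
    moreover have "dsum_inj k H m (u m) \<in> lspan (dsum k H) ?S"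
      using Suc.prems um by (intro inj) auto
    ultimately show ?case unfolding eq by (rule lspan.add)
  qed
  from this[of k] have "(\<lambda>i\<in>{..<k}. u i) \<in> lspan (dsum k H) ?S"
    by (simp cong: restrict_cong)
  then show "u \<in> lspan (dsum k H) ?S"
    using u by (simp add: PiE_def extensional_restrict)
qed

lemma fd_dsum: "fd_hilbert (dsum k H)"
proof -
  have "\<exists>S. finite S \<and> spans (H i) S" if "i < k" for i
    using finite_spanning_set[OF H[OF that]] by metis
  then obtain S where S: "\<And>i. i < k \<Longrightarrow> finite (S i) \<and> spans (H i) (S i)" by metis
  show ?thesis
  proof (rule fd_hilbertI[where I = "SIGMA i:{..<k}. carrier (H i)" and
        e = "\<lambda>(i, z) u. ip (H i) z (u i)" and S = "\<Union>i<k. dsum_inj k H i ` S i"])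
    show "finite (\<Union>i<k. dsum_inj k H i ` S i)" "spans (dsum k H) (\<Union>i<k. dsum_inj k H i ` S i)"
      using S spans_dsum by auto
    show "x = y" if xy: "x \<in> carrier (dsum k H)" "y \<in> carrier (dsum k H)"
      and eq: "\<And>t. t \<in> (SIGMA i:{..<k}. carrier (H i)) \<Longrightarrow>
        (case t of (i, z) \<Rightarrow> \<lambda>u. ip (H i) z (u i)) x = (case t of (i, z) \<Rightarrow> \<lambda>u. ip (H i) z (u i)) y"
      for x y
    proof (rule PiE_ext)
      show "x \<in> (\<Pi>\<^sub>E i\<in>{..<k}. carrier (H i))" "y \<in> (\<Pi>\<^sub>E i\<in>{..<k}. carrier (H i))" using xy by auto
      fix i assume i: "i \<in> {..<k}"
      show "x i = y i"
        by (rule fd_hilbert_eqI[OF H, of i]) (use i xy eq[of "(i, z)" for z] in auto)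
    qed
    show "0 < Re (ip (dsum k H) u u)" if u: "u \<in> carrier (dsum k H)" "u \<noteq> \<zero>\<^bsub>dsum k H\<^esub>" for u
    proof -
      have "\<exists>i<k. u i \<noteq> \<zero>\<^bsub>H i\<^esub>"
      proof (rule ccontr)
        assume "\<not> (\<exists>i<k. u i \<noteq> \<zero>\<^bsub>H i\<^esub>)"
        then have "u = \<zero>\<^bsub>dsum k H\<^esub>"
          using u(1) by (intro extensionalityI[of _ "{..<k}"]) (auto simp: PiE_def)
        then show False using u by blast
      qed
      then obtain i where i: "i < k" "u i \<noteq> \<zero>\<^bsub>H i\<^esub>" by blast
      have nn: "0 \<le> Re (ip (H j) (u j) (u j))" if "j < k" for j
        using fd_hilbert.ip_pos[OF H[OF that], of "u j"] u(1) that H[OF that]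
        by (cases "u j = \<zero>\<^bsub>H j\<^esub>") (auto simp: PiE_def Pi_def less_imp_le)
      have "0 < (\<Sum>j<k. Re (ip (H j) (u j) (u j)))"
        using i u(1) nn fd_hilbert.ip_pos[OF H[OF i(1)], of "u i"]
        by (intro sum_pos2[of _ i]) (auto simp: PiE_def Pi_def)
      then show ?thesis by simp
    qed
    show "ip (dsum k H) y x = cnj (ip (dsum k H) x y)"
      if "x \<in> carrier (dsum k H)" "y \<in> carrier (dsum k H)" for x y
    proof -
      have "ip (H i) (y i) (x i) = cnj (ip (H i) (x i) (y i))" if "i < k" for i
        using \<open>x \<in> _\<close> \<open>y \<in> _\<close> that by (intro ip_swap H) auto
      then show ?thesis by simp
    qed
  qed (auto simp: H PiE_def Pi_def sum.distrib sum_distrib_left intro!: sum.cong)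
qed

lemma ip_dsum_inj:
  assumes i: "i < k" and x: "x \<in> carrier (H i)" and u: "u \<in> carrier (dsum k H)"
  shows "ip (dsum k H) (dsum_inj k H i x) u = ip (H i) x (u i)"
proof -
  have "ip (dsum k H) (dsum_inj k H i x) u = (\<Sum>j<k. if j = i then ip (H i) x (u i) else 0)"
    unfolding dsum_simps by (rule sum.cong) (use u in \<open>auto simp: dsum_inj_def H PiE_def Pi_def\<close>)
  then show ?thesis using i by simp
qed

end


section \<open>Cells and their values on pure tensors\<close>

subsection \<open>Composite 1-cells\<close>

lemma cell1_fd: "\<lbrakk>is_cell1 n m X; i < m; l < n\<rbrakk> \<Longrightarrow> fd_hilbert (ent X (i, l))"
  by (auto simp: is_cell1_def idx_def)

lemma cell1_dims: "is_cell1 n m X \<Longrightarrow> src X = n \<and> tgt X = m"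
  by (simp add: is_cell1_def)

lemma comp1_dims [simp]: "src (X \<Zcomp> Y) = src X" "tgt (X \<Zcomp> Y) = tgt Y"
  by (simp_all add: comp1_def)

lemma id1_dims [simp]: "src (id1 n) = n" "tgt (id1 n) = n"
  by (simp_all add: id1_def)

lemma ent_id1 [simp]: "ent (id1 n) (i, j) = (if i = j then scalar_hilb else zero_hilb)"
  by (simp add: id1_def)

lemma id1_cell: "is_cell1 n n (id1 n)"
  by (auto simp: is_cell1_def idx_def)

text \<open>Within the following context an entry of a composite is unfolded into its direct sum of tensor
  products. The computations with pasting diagrams rest on three facts about the elements
  \<^const>\<open>gen\<close>: they span the entry, they are bilinear, and their inner products multiply.\<close>

context
  fixes X :: "'a cell1" and Y :: "'b cell1" and n m k i l :: nat
  assumes X: "is_cell1 n m X" and Y: "is_cell1 m k Y" and i: "i < k" and l: "l < n"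
begin

private abbreviation "XY \<equiv> ent (X \<Zcomp> Y) (i, l)"
private abbreviation "T \<equiv> \<lambda>j. tensor (ent Y (i, j)) (ent X (j, l))"
private abbreviation "P \<equiv> \<lambda>j. pure_tensor (ent Y (i, j)) (ent X (j, l))"

private lemma ent_comp: "XY = dsum m T"
  using cell1_dims[OF X] by (simp add: comp1_def)

private lemma gen_eq: "gen X Y i l j y x = dsum_inj m T j
    (P j y x)"
  using cell1_dims[OF X] by (simp add: gen_def)

private lemma fdX: "j < m \<Longrightarrow> fd_hilbert (ent X (j, l))" and fdY: "j < m \<Longrightarrow> fd_hilbert (ent Y (i, j))"
  using cell1_fd[OF X] cell1_fd[OF Y] i l by auto

private lemma fdT: "j < m \<Longrightarrow> fd_hilbert (T j)"
  by (rule fd_tensor[OF fdY fdX])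

lemma fd_comp: "fd_hilbert XY"
  unfolding ent_comp by (rule fd_dsum[OF fdT])

lemma comp_carrier: "u \<in> carrier XY \<longleftrightarrow>
    u \<in> (\<Pi>\<^sub>E j\<in>{..<m}. carrier (T j))"
  unfolding ent_comp by simp

lemma comp_add: "u \<oplus>\<^bsub>XY\<^esub> v =
    (\<lambda>j\<in>{..<m}. u j \<oplus>\<^bsub>T j\<^esub> v j)"
  and comp_smult: "c \<odot>\<^bsub>XY\<^esub> u =
    (\<lambda>j\<in>{..<m}. c \<odot>\<^bsub>T j\<^esub> u j)"
  unfolding ent_comp by simp_all

lemma gen_apply: "gen X Y i l j y x = (\<lambda>j'\<in>{..<m}. if j' = j then
    P j y x else \<zero>\<^bsub>T j'\<^esub>)"
  unfolding gen_eq by (simp add: dsum_inj_def)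

lemma gen_closed:
  "\<lbrakk>j < m; y \<in> carrier (ent Y (i, j)); x \<in> carrier (ent X (j, l))\<rbrakk>
    \<Longrightarrow> gen X Y i l j y x \<in> carrier XY"
  unfolding ent_comp gen_eq by (intro dsum_inj_closed[OF fdT] pure_tensor_closed fdX fdY)

text \<open>The reproducing property of pure tensors, for the summand \<open>j\<close>.\<close>

lemma ip_gen:
  assumes "j < m" "y \<in> carrier (ent Y (i, j))" "x \<in> carrier (ent X (j, l))"
    and u: "u \<in> carrier XY"
  shows "ip XY (gen X Y i l j y x) u = u j (y, x)"
proof -
  have "u j \<in> carrier (T j)"
    using u assms(1) by (simp add: comp_carrier PiE_def Pi_def)
  moreover have "ip XY (gen X Y i l j y x) u =
    ip (T j) (P j y x) (u j)"
    unfolding ent_comp gen_eq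
    using assms ip_dsum_inj[OF fdT, OF _ assms(1) pure_tensor_closed[OF fdY fdX]]
    by (simp add: ent_comp del: dsum_simps)
  ultimately show ?thesis using assms by (simp add: ip_pure_left fdX fdY)
qed

lemma ip_gen_gen:
  assumes "j < m" "y \<in> carrier (ent Y (i, j))" "x \<in> carrier (ent X (j, l))"
    and "j' < m" "y' \<in> carrier (ent Y (i, j'))" "x' \<in> carrier (ent X (j', l))"
  shows "ip XY (gen X Y i l j y x) (gen X Y i l j' y' x') =
    (if j = j' then ip (ent Y (i, j)) y y' * ip (ent X (j, l)) x x' else 0)"
  unfolding ip_gen[OF assms(1-3) gen_closed[OF assms(4-6)]]
  using assms by (cases "j = j'") (simp_all add: gen_apply tensor_ops)

lemma gen_bilinear:
  assumes j: "j < m"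
  shows "\<lbrakk>y \<in> carrier (ent Y (i, j)); y' \<in> carrier (ent Y (i, j)); x \<in> carrier (ent X (j, l))\<rbrakk> \<Longrightarrow>
      gen X Y i l j (y \<oplus>\<^bsub>ent Y (i, j)\<^esub> y') x =
      gen X Y i l j y x \<oplus>\<^bsub>XY\<^esub> gen X Y i l j y' x"
    and "\<lbrakk>y \<in> carrier (ent Y (i, j)); x \<in> carrier (ent X (j, l)); x' \<in> carrier (ent X (j, l))\<rbrakk> \<Longrightarrow>
      gen X Y i l j y (x \<oplus>\<^bsub>ent X (j, l)\<^esub> x') =
      gen X Y i l j y x \<oplus>\<^bsub>XY\<^esub> gen X Y i l j y x'"
    and "\<lbrakk>y \<in> carrier (ent Y (i, j)); x \<in> carrier (ent X (j, l))\<rbrakk> \<Longrightarrow>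
      gen X Y i l j (c \<odot>\<^bsub>ent Y (i, j)\<^esub> y) x = c \<odot>\<^bsub>XY\<^esub> gen X Y i l j y x"
    and "\<lbrakk>y \<in> carrier (ent Y (i, j)); x \<in> carrier (ent X (j, l))\<rbrakk> \<Longrightarrow>
      gen X Y i l j y (c \<odot>\<^bsub>ent X (j, l)\<^esub> x) = c \<odot>\<^bsub>XY\<^esub> gen X Y i l j y x"
    and "x \<in> carrier (ent X (j, l)) \<Longrightarrow>
      gen X Y i l j \<zero>\<^bsub>ent Y (i, j)\<^esub> x = \<zero>\<^bsub>XY\<^esub>"
    and "y \<in> carrier (ent Y (i, j)) \<Longrightarrow>
      gen X Y i l j y \<zero>\<^bsub>ent X (j, l)\<^esub> = \<zero>\<^bsub>XY\<^esub>"
  using fdX[OF j] fdY[OF j] fd_tensor[OF fdY[OF j] fdX[OF j]]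
  by (simp_all add: gen_eq ent_comp pure_tensor_bilinear pure_tensor_closed
      dsum_inj_linear[where H = T and k = m and i = j, OF fdT]
      del: dsum_simps)

lemma spans_comp:
  assumes B: "\<And>j. j < m \<Longrightarrow> spans (ent Y (i, j)) (B j)"
    and A: "\<And>j. j < m \<Longrightarrow> spans (ent X (j, l)) (A j)"
  shows "spans XY {gen X Y i l j y x |j y x. j < m \<and> y \<in> B j \<and> x \<in> A j}"
proof -
  have "{gen X Y i l j y x |j y x. j < m \<and> y \<in> B j \<and> x \<in> A j} =
    (\<Union>j<m. dsum_inj m T j `
      {P j y x |y x. y \<in> B j \<and> x \<in> A j})"
    by (auto simp: gen_eq)
  then show ?thesis
    unfolding ent_comp using spans_dsum[OF fdT spans_tensor[OF fdY fdX B A]] by simp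
qed

end

lemma comp_cell: "\<lbrakk>is_cell1 n m X; is_cell1 m k Y\<rbrakk> \<Longrightarrow> is_cell1 n k (X \<Zcomp> Y)"
  using fd_comp[of n m X k Y] by (auto simp: is_cell1_def[of n k] idx_def cell1_dims)

lemma spans_mono: "\<lbrakk>spans H A; A \<subseteq> B; B \<subseteq> carrier H\<rbrakk> \<Longrightarrow> spans H B"
  by (rule spans_trans) (auto intro: lspan.base)


subsection \<open>2-cells\<close>

text \<open>A 2-cell between well-formed 1-cells, with their common shape. The rules for this predicate
  compose, so the type of a pasting diagram follows from the types of its parts.\<close>

definition two_cell :: "nat \<Rightarrow> nat \<Rightarrow> 'a cell1 \<Rightarrow> 'b cell1 \<Rightarrow> ('a, 'b) cell2 \<Rightarrow> bool"
  where "two_cell n m X Y L \<longleftrightarrow> is_cell1 n m X \<and> is_cell1 n m Y \<and> is_cell2 X Y L"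

lemma two_cellD:
  assumes "two_cell n m X Y L"
  shows "is_cell1 n m X" "is_cell1 n m Y" "is_cell2 X Y L" "src2 L = X" "tgt2 L = Y"
    and "\<lbrakk>i < m; l < n\<rbrakk> \<Longrightarrow> mat L (i, l) \<in> lin_maps (ent X (i, l)) (ent Y (i, l))"
    and "\<lbrakk>i < m; l < n; x \<in> carrier (ent X (i, l))\<rbrakk> \<Longrightarrow> mat L (i, l) x \<in> carrier (ent Y (i, l))"
proof -
  show L: "is_cell1 n m X" "is_cell1 n m Y" "is_cell2 X Y L" "src2 L = X" "tgt2 L = Y"
    using assms by (simp_all add: two_cell_def is_cell2_def)
  show lin: "mat L (i, l) \<in> lin_maps (ent X (i, l)) (ent Y (i, l))" if "i < m" "l < n" for i l
    using that L(1,3) by (auto simp: is_cell2_def is_cell1_def idx_def)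
  show "mat L (i, l) x \<in> carrier (ent Y (i, l))"
    if "i < m" "l < n" "x \<in> carrier (ent X (i, l))"
    by (rule lin_closed[OF lin[OF that(1,2)] that(3)])
qed

lemma two_cellI:
  assumes "is_cell1 n m X" "is_cell1 n m Y" "src2 L = X" "tgt2 L = Y"
    and "mat L \<in> extensional (idx X)"
    and "\<And>i l. \<lbrakk>i < m; l < n\<rbrakk> \<Longrightarrow> mat L (i, l) \<in> lin_maps (ent X (i, l)) (ent Y (i, l))"
  shows "two_cell n m X Y L"
  using assms by (auto simp: two_cell_def is_cell2_def is_cell1_def idx_def PiE_def Pi_def)

lemma two_cell_eqI:
  assumes L: "two_cell n m X Y L" and M: "two_cell n m X Y M"
    and eq: "\<And>i l x. \<lbrakk>i < m; l < n; x \<in> carrier (ent X (i, l))\<rbrakk> \<Longrightarrow> mat L (i, l) x = mat M (i, l) x"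
  shows "L = M"
proof -
  have "mat L = mat M"
  proof (rule extensionalityI[of _ "idx X"])
    fix p assume "p \<in> idx X"
    then obtain i l where p: "p = (i, l)" "i < m" "l < n"
      using two_cellD(1)[OF L] by (auto simp: is_cell1_def idx_def)
    show "mat L p = mat M p" unfolding p(1)
      by (rule extensionalityI[of _ "carrier (ent X (i, l))"])
        (use two_cellD(6)[OF L p(2,3)] two_cellD(6)[OF M p(2,3)] eq[OF p(2,3)] in
          \<open>auto simp: lin_maps_def PiE_def\<close>)
  qed (use two_cellD(3)[OF L] two_cellD(3)[OF M] in \<open>auto simp: is_cell2_def PiE_def\<close>)
  then show ?thesis using two_cellD(4,5)[OF L] two_cellD(4,5)[OF M] by simp
qed

lemma mat_eqI:
  assumes L: "two_cell n m X Y L" and M: "two_cell n m X Y M" and "i < m" "l < n"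
    and A: "spans (ent X (i, l)) A" and eq: "\<And>a. a \<in> A \<Longrightarrow> mat L (i, l) a = mat M (i, l) a"
  shows "mat L (i, l) = mat M (i, l)"
  by (rule lin_maps_eqI[OF cell1_fd[OF two_cellD(1)[OF L]] cell1_fd[OF two_cellD(2)[OF L]] A
        two_cellD(6)[OF L] two_cellD(6)[OF M] eq]) (fact assms)+

lemma id2_cell: "is_cell1 n m X \<Longrightarrow> two_cell n m X X (id2 X)"
  by (rule two_cellI) (auto simp: id2_def idx_def is_cell1_def intro!: id_lin)

lemma mat_id2:
  "\<lbrakk>is_cell1 n m X; i < m; l < n; x \<in> carrier (ent X (i, l))\<rbrakk> \<Longrightarrow> mat (id2 X) (i, l) x = x"
  by (simp add: id2_def idx_def is_cell1_def)

lemma mat_vcomp: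
  "\<lbrakk>two_cell n m X Y L; i < m; l < n; x \<in> carrier (ent X (i, l))\<rbrakk>
    \<Longrightarrow> mat (M \<cdot> L) (i, l) x = mat M (i, l) (mat L (i, l) x)"
  using two_cellD(1,4)[of n m X Y L]
  by (simp add: vcomp_def idx_def is_cell1_def compose_eq)

lemma vcomp_cell:
  assumes L: "two_cell n m X Y L" and M: "two_cell n m Y Z M"
  shows "two_cell n m X Z (M \<cdot> L)"
proof (rule two_cellI)
  fix i l assume "i < m" "l < n"
  then have "mat (M \<cdot> L) (i, l) = compose (carrier (ent X (i, l))) (mat M (i, l)) (mat L (i, l))"
    using two_cellD(1,4)[OF L] by (simp add: vcomp_def idx_def is_cell1_def)
  then show "mat (M \<cdot> L) (i, l) \<in> lin_maps (ent X (i, l)) (ent Z (i, l))"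
    using compose_lin[OF cell1_fd[OF two_cellD(1)[OF L]] two_cellD(6)[OF L] two_cellD(6)[OF M]]
      \<open>i < m\<close> \<open>l < n\<close> by simp
qed (use two_cellD[OF L] two_cellD[OF M] in \<open>auto simp: vcomp_def\<close>)

lemma dagger_cell:
  assumes L: "two_cell n m X Y L"
  shows "two_cell n m Y X (dagger L)"
proof (rule two_cellI)
  fix i l assume il: "i < m" "l < n"
  then have "mat (dagger L) (i, l) = adjoint (ent X (i, l)) (ent Y (i, l)) (mat L (i, l))"
    using two_cellD(1,4,5)[OF L] by (simp add: dagger_def idx_def is_cell1_def)
  then show "mat (dagger L) (i, l) \<in> lin_maps (ent Y (i, l)) (ent X (i, l))"
    using il cell1_fd[OF two_cellD(1)[OF L]] cell1_fd[OF two_cellD(2)[OF L]] two_cellD(6)[OF L]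
    by (simp add: adjoint_lin)
qed (use two_cellD(1,2,4,5)[OF L] in \<open>auto simp: dagger_def is_cell1_def idx_def\<close>)

lemma ip_dagger:
  assumes L: "two_cell n m X Y L" and il: "i < m" "l < n"
    and "y \<in> carrier (ent Y (i, l))" "z \<in> carrier (ent X (i, l))"
  shows "ip (ent X (i, l)) z (mat (dagger L) (i, l) y) = ip (ent Y (i, l)) (mat L (i, l) z) y"
proof -
  have "mat (dagger L) (i, l) = adjoint (ent X (i, l)) (ent Y (i, l)) (mat L (i, l))"
    using il two_cellD(1,4,5)[OF L] by (simp add: dagger_def idx_def is_cell1_def)
  then show ?thesis using assms
    by (simp add: adjoint_ip' cell1_fd[OF two_cellD(1)[OF L]] cell1_fd[OF two_cellD(2)[OF L]] two_cellD(6)[OF L])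
qed

text \<open>The adjointness relation implies that \<open>M\<close> is linear and determines it.\<close>

lemma dagger_eqI:
  assumes L: "two_cell n m X Y L" and M: "src2 M = Y" "tgt2 M = X" "mat M \<in> extensional (idx X)"
    and closed: "\<And>i l y. \<lbrakk>i < m; l < n; y \<in> carrier (ent Y (i, l))\<rbrakk>
      \<Longrightarrow> mat M (i, l) y \<in> carrier (ent X (i, l))"
    and ext: "\<And>i l. \<lbrakk>i < m; l < n\<rbrakk> \<Longrightarrow> mat M (i, l) \<in> extensional (carrier (ent Y (i, l)))"
    and adj: "\<And>i l y z. \<lbrakk>i < m; l < n; y \<in> carrier (ent Y (i, l)); z \<in> carrier (ent X (i, l))\<rbrakk>
      \<Longrightarrow> ip (ent X (i, l)) z (mat M (i, l) y) = ip (ent Y (i, l)) (mat L (i, l) z) y"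
  shows "M = dagger L"
proof -
  have "mat M = mat (dagger L)"
  proof (rule extensionalityI[of _ "idx X"])
    fix p assume "p \<in> idx X"
    then obtain i l where p: "p = (i, l)" "i < m" "l < n"
      using two_cellD(1)[OF L] by (auto simp: is_cell1_def idx_def)
    have "mat (dagger L) p = adjoint (ent X (i, l)) (ent Y (i, l)) (mat L (i, l))"
      using p two_cellD(1,4,5)[OF L] by (simp add: dagger_def idx_def is_cell1_def)
    moreover have "mat M (i, l) = adjoint (ent X (i, l)) (ent Y (i, l)) (mat L (i, l))"
      using p by (intro adjoint_eqI cell1_fd[OF two_cellD(1)[OF L]] cell1_fd[OF two_cellD(2)[OF L]]
          two_cellD(6)[OF L] closed ext adj)
    ultimately show "mat M p = mat (dagger L) p" using p by simp
  qed (use M two_cellD(4)[OF L] in \<open>auto simp: dagger_def\<close>)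
  then show ?thesis using M two_cellD(4,5)[OF L] by (simp add: dagger_def)
qed

text \<open>A horizontal composite acts on each summand as the tensor product of two linear maps, so it
  sends the pure tensor of two vectors to the pure tensor of their images.\<close>

lemma
  assumes L: "two_cell n m X X' L" and M: "two_cell m k Y Y' M"
  shows hcomp_cell: "two_cell n k (X \<Zcomp> Y) (X' \<Zcomp> Y') (L \<Zcomp>\<^sub>2 M)"
    and mat_hcomp: "\<And>i l j y x. \<lbrakk>i < k; l < n; j < m; y \<in> carrier (ent Y (i, j)); x \<in> carrier (ent X (j, l))\<rbrakk>
      \<Longrightarrow> mat (L \<Zcomp>\<^sub>2 M) (i, l) (gen X Y i l j y x) =
        gen X' Y' i l j (mat M (i, j) y) (mat L (j, l) x)"
proof -
  note cL = two_cellD[OF L] and cM = two_cellD[OF M]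
  define t where "t i l j = tensor_map (ent Y (i, j)) (ent Y' (i, j)) (ent X (j, l)) (ent X' (j, l))
    (mat M (i, j)) (mat L (j, l))" for i l j
  have t: "t i l j \<in> lin_maps (tensor (ent Y (i, j)) (ent X (j, l))) (tensor (ent Y' (i, j)) (ent X' (j, l)))"
    "\<And>y x. \<lbrakk>y \<in> carrier (ent Y (i, j)); x \<in> carrier (ent X (j, l))\<rbrakk> \<Longrightarrow>
      t i l j (pure_tensor (ent Y (i, j)) (ent X (j, l)) y x) =
      pure_tensor (ent Y' (i, j)) (ent X' (j, l)) (mat M (i, j) y) (mat L (j, l) x)"
    "t i l j \<zero>\<^bsub>tensor (ent Y (i, j)) (ent X (j, l))\<^esub> = \<zero>\<^bsub>tensor (ent Y' (i, j)) (ent X' (j, l))\<^esub>"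
    if "i < k" "l < n" "j < m" for i l j
  proof -
    note fd = cell1_fd[OF cL(1) that(3,2)] cell1_fd[OF cL(2) that(3,2)]
      cell1_fd[OF cM(1) that(1,3)] cell1_fd[OF cM(2) that(1,3)]
    note lin = cL(6)[OF that(3,2)] cM(6)[OF that(1,3)]
    show 1: "t i l j \<in> lin_maps (tensor (ent Y (i, j)) (ent X (j, l))) (tensor (ent Y' (i, j)) (ent X' (j, l)))"
      unfolding t_def by (rule tensor_map_lin) (use fd lin in auto)
    show "t i l j (pure_tensor (ent Y (i, j)) (ent X (j, l)) y x) =
      pure_tensor (ent Y' (i, j)) (ent X' (j, l)) (mat M (i, j) y) (mat L (j, l) x)"
      if "y \<in> carrier (ent Y (i, j))" "x \<in> carrier (ent X (j, l))" for y x
      unfolding t_def by (rule tensor_map_pure) (use fd lin that in auto)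
    show "t i l j \<zero>\<^bsub>tensor (ent Y (i, j)) (ent X (j, l))\<^esub> = \<zero>\<^bsub>tensor (ent Y' (i, j)) (ent X' (j, l))\<^esub>"
      by (rule lin_zero[OF _ _ 1]) (use fd in \<open>auto intro: fd_tensor\<close>)
  qed
  have mat: "mat (L \<Zcomp>\<^sub>2 M) (i, l) = (\<lambda>u\<in>carrier (ent (X \<Zcomp> Y) (i, l)). \<lambda>j\<in>{..<m}. t i l j (u j))"
    if "i < k" "l < n" for i l
    using that cL(1,4,5) cM(1,4,5) by (simp add: hcomp_def Let_def idx_def is_cell1_def t_def)
  show "two_cell n k (X \<Zcomp> Y) (X' \<Zcomp> Y') (L \<Zcomp>\<^sub>2 M)"
  proof (rule two_cellI)
    fix i l assume il: "i < k" "l < n"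
    note XY = cL(1) cM(1) il and XY' = cL(2) cM(2) il
    have fd: "fd_hilbert (ent (X \<Zcomp> Y) (i, l))" by (rule fd_comp[OF XY])
    have uj: "u j \<in> carrier (tensor (ent Y (i, j)) (ent X (j, l)))"
      if "u \<in> carrier (ent (X \<Zcomp> Y) (i, l))" "j < m" for u j
      using that by (simp add: comp_carrier[OF XY] PiE_def Pi_def)
    let ?f = "\<lambda>u\<in>carrier (ent (X \<Zcomp> Y) (i, l)). \<lambda>j\<in>{..<m}. t i l j (u j)"
    show "mat (L \<Zcomp>\<^sub>2 M) (i, l) \<in> lin_maps (ent (X \<Zcomp> Y) (i, l)) (ent (X' \<Zcomp> Y') (i, l))"
      unfolding mat[OF il]
    proof (rule lin_mapsI)
      fix u v assume u: "u \<in> carrier (ent (X \<Zcomp> Y) (i, l))" and v: "v \<in> carrier (ent (X \<Zcomp> Y) (i, l))"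
      show "?f (u \<oplus>\<^bsub>ent (X \<Zcomp> Y) (i, l)\<^esub> v) =
        ?f u \<oplus>\<^bsub>ent (X' \<Zcomp> Y') (i, l)\<^esub> ?f v"
        using u v fd_add_closed[OF fd u v]
        by (auto simp: comp_add[OF XY] comp_add[OF XY'] lin_add[OF t(1)[OF il]] uj intro!: restrict_ext)
    next
      fix c u assume u: "u \<in> carrier (ent (X \<Zcomp> Y) (i, l))"
      show "?f (c \<odot>\<^bsub>ent (X \<Zcomp> Y) (i, l)\<^esub> u) =
        c \<odot>\<^bsub>ent (X' \<Zcomp> Y') (i, l)\<^esub> ?f u"
        using u fd_smult_closed[OF fd u]
        by (auto simp: comp_smult[OF XY] comp_smult[OF XY'] lin_smult[OF t(1)[OF il]] uj intro!: restrict_ext)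
    qed (auto simp: comp_carrier[OF XY'] lin_closed[OF t(1)[OF il]] uj)
  qed (use cL cM in \<open>auto simp: hcomp_def Let_def intro: comp_cell\<close>)
  fix i l j y x
  assume il: "i < k" "l < n" and j: "j < m"
    and y: "y \<in> carrier (ent Y (i, j))" and x: "x \<in> carrier (ent X (j, l))"
  note XY = cL(1) cM(1) il and XY' = cL(2) cM(2) il
  show "mat (L \<Zcomp>\<^sub>2 M) (i, l) (gen X Y i l j y x) = gen X' Y' i l j (mat M (i, j) y) (mat L (j, l) x)"
    unfolding mat[OF il] using gen_closed[OF XY j y x]
    by (auto simp: gen_apply[OF XY] gen_apply[OF XY'] t[OF il] y x intro!: restrict_ext)
qed


subsection \<open>Coherence isomorphisms\<close>

definition iso2 :: "nat \<Rightarrow> nat \<Rightarrow> 'a cell1 \<Rightarrow> 'b cell1 \<Rightarrow> ('a, 'b) cell2 \<Rightarrow> bool"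
  where "iso2 n m X Y L \<longleftrightarrow> two_cell n m X Y L \<and>
    (\<forall>i<m. \<forall>l<n. bij_betw (mat L (i, l)) (carrier (ent X (i, l))) (carrier (ent Y (i, l))))"

lemma
  assumes L: "iso2 n m X Y L"
  shows inv2_cell: "two_cell n m Y X (inv2 L)"
    and mat_inv2: "\<And>i l x. \<lbrakk>i < m; l < n; x \<in> carrier (ent X (i, l))\<rbrakk>
      \<Longrightarrow> mat (inv2 L) (i, l) (mat L (i, l) x) = x"
proof -
  have c: "two_cell n m X Y L" using L by (simp add: iso2_def)
  note D = two_cellD[OF c]
  have bij: "bij_betw (mat L (i, l)) (carrier (ent X (i, l))) (carrier (ent Y (i, l)))"
    if "i < m" "l < n" for i l using that L by (simp add: iso2_def)
  have mat: "mat (inv2 L) (i, l) =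
    (\<lambda>y\<in>carrier (ent Y (i, l)). inv_into (carrier (ent X (i, l))) (mat L (i, l)) y)"
    if "i < m" "l < n" for i l
    using that D(1,4,5) by (simp add: inv2_def idx_def is_cell1_def)
  show "two_cell n m Y X (inv2 L)"
  proof (rule two_cellI)
    fix i l assume "i < m" "l < n"
    then show "mat (inv2 L) (i, l) \<in> lin_maps (ent Y (i, l)) (ent X (i, l))"
      unfolding mat[OF \<open>i < m\<close> \<open>l < n\<close>]
      by (intro inv_into_lin bij cell1_fd[OF D(1)] D(6))
  qed (use D(1,2,4,5) in \<open>auto simp: inv2_def is_cell1_def idx_def\<close>)
  fix i l x assume "i < m" "l < n" "x \<in> carrier (ent X (i, l))"
  then show "mat (inv2 L) (i, l) (mat L (i, l) x) = x"
    using bij[of i l] D(7)[of i l x] by (simp add: mat bij_betw_inv_into_left)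
qed

lemma iso2I:
  assumes "is_cell1 n m X" "is_cell1 n m Y" "src2 L = X" "tgt2 L = Y"
    and "mat L \<in> extensional (idx X)"
    and "\<And>i l. \<lbrakk>i < m; l < n\<rbrakk> \<Longrightarrow> mat L (i, l) \<in> lin_maps (ent X (i, l)) (ent Y (i, l)) \<and>
      bij_betw (mat L (i, l)) (carrier (ent X (i, l))) (carrier (ent Y (i, l)))"
  shows "iso2 n m X Y L"
  using assms by (auto simp: iso2_def intro!: two_cellI)

text \<open>Both bracketings are spanned by triple tensors, with \<open>\<langle>z, z'\<rangle> \<langle>y, y'\<rangle> \<langle>x, x'\<rangle>\<close> as inner products,
  so matching them is unitary.\<close>

lemma
  fixes X :: "'a cell1" and Y :: "'b cell1" and Z :: "'c cell1"
  assumes X: "is_cell1 n m X" and Y: "is_cell1 m p Y" and Z: "is_cell1 p q Z"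
  shows assoc2_iso: "iso2 n q ((X \<Zcomp> Y) \<Zcomp> Z) (X \<Zcomp> (Y \<Zcomp> Z)) (assoc2 X Y Z)"
    and mat_assoc2: "\<And>i l k j z y x. \<lbrakk>i < q; l < n; k < p; j < m; z \<in> carrier (ent Z (i, k));
        y \<in> carrier (ent Y (k, j)); x \<in> carrier (ent X (j, l))\<rbrakk> \<Longrightarrow>
      mat (assoc2 X Y Z) (i, l) (gen (X \<Zcomp> Y) Z i l k z (gen X Y k l j y x)) =
      gen X (Y \<Zcomp> Z) i l j (gen Y Z i j k z y) x"
proof -
  note XY = comp_cell[OF X Y] and YZ = comp_cell[OF Y Z]
  define S where "S = (X \<Zcomp> Y) \<Zcomp> Z"
  define T where "T = X \<Zcomp> (Y \<Zcomp> Z)"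
  have ST: "is_cell1 n q S" "is_cell1 n q T"
    using comp_cell[OF XY Z] comp_cell[OF X YZ] by (simp_all add: S_def T_def)
  define I where "I i l = {(k, j, z, y, x). k < p \<and> j < m \<and> z \<in> carrier (ent Z (i, k)) \<and>
    y \<in> carrier (ent Y (k, j)) \<and> x \<in> carrier (ent X (j, l))}" for i l
  define g where "g i l = (\<lambda>(k, j, z, y, x). gen (X \<Zcomp> Y) Z i l k z (gen X Y k l j y x))" for i l
  define h where "h i l = (\<lambda>(k, j, z, y, x). gen X (Y \<Zcomp> Z) i l j (gen Y Z i j k z y) x)" for i l
  have main: "mat (assoc2 X Y Z) (i, l) \<in> lin_maps (ent S (i, l)) (ent T (i, l)) \<and>
     (\<forall>t\<in>I i l. mat (assoc2 X Y Z) (i, l) (g i l t) = h i l t) \<and>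
     bij_betw (mat (assoc2 X Y Z) (i, l)) (carrier (ent S (i, l))) (carrier (ent T (i, l)))"
    if i: "i < q" and l: "l < n" for i l
  proof -
    let ?P = "\<lambda>T. \<forall>k<tgt Y. \<forall>j<tgt X. \<forall>z\<in>carrier (ent Z (i, k)). \<forall>y\<in>carrier (ent Y (k, j)).
         \<forall>x\<in>carrier (ent X (j, l)).
           T (gen (X \<Zcomp> Y) Z i l k z (gen X Y k l j y x)) =
           gen X (Y \<Zcomp> Z) i l j (gen Y Z i j k z y) x"
    have mat: "mat (assoc2 X Y Z) (i, l) = (THE U. U \<in> lin_maps (ent S (i, l)) (ent T (i, l)) \<and> ?P U)"
      using i l cell1_dims[OF X] cell1_dims[OF Z] by (simp add: assoc2_def idx_def S_def T_def)
    have P: "?P U \<longleftrightarrow> (\<forall>t\<in>I i l. U (g i l t) = h i l t)" for U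
      using cell1_dims[OF X] cell1_dims[OF Y] by (auto simp: I_def g_def h_def)
    have XYc: "gen X Y k l j y x \<in> carrier (ent (X \<Zcomp> Y) (k, l))"
      if "k < p" "j < m" "y \<in> carrier (ent Y (k, j))" "x \<in> carrier (ent X (j, l))" for k j y x
      by (rule gen_closed[OF X Y that(1) l that(2-4)])
    have YZc: "gen Y Z i j k z y \<in> carrier (ent (Y \<Zcomp> Z) (i, j))"
      if "k < p" "j < m" "z \<in> carrier (ent Z (i, k))" "y \<in> carrier (ent Y (k, j))" for k j z y
      by (rule gen_closed[OF Y Z i that(2,1,3,4)])
    have gc: "g i l ` I i l \<subseteq> carrier (ent S (i, l))"
      unfolding S_def by (auto simp: g_def I_def intro!: gen_closed[OF XY Z i l] XYc)
    have hc: "h i l ` I i l \<subseteq> carrier (ent T (i, l))"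
      unfolding T_def by (auto simp: h_def I_def intro!: gen_closed[OF X YZ i l] YZc)
    have g: "spans (ent S (i, l)) (g i l ` I i l)"
      unfolding S_def
    proof (rule spans_mono[OF spans_comp[OF XY Z i l spans_carrier spans_comp[OF X Y _ l spans_carrier spans_carrier]]])
      show "{gen (X \<Zcomp> Y) Z i l k z w |k z w. k < p \<and> z \<in> carrier (ent Z (i, k)) \<and>
        w \<in> {gen X Y k l j y x |j y x. j < m \<and> y \<in> carrier (ent Y (k, j)) \<and> x \<in> carrier (ent X (j, l))}}
        \<subseteq> g i l ` I i l"
        by (force simp: g_def I_def)
    qed (use gc in \<open>simp_all add: S_def\<close>)
    have h: "spans (ent T (i, l)) (h i l ` I i l)"
      unfolding T_def
    proof (rule spans_mono[OF spans_comp[OF X YZ i l spans_comp[OF Y Z i _ spans_carrier spans_carrier] spans_carrier]])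
      show "{gen X (Y \<Zcomp> Z) i l j w x |j w x. j < m \<and>
        w \<in> {gen Y Z i j k z y |k z y. k < p \<and> z \<in> carrier (ent Z (i, k)) \<and> y \<in> carrier (ent Y (k, j))} \<and>
        x \<in> carrier (ent X (j, l))} \<subseteq> h i l ` I i l"
        by (force simp: h_def I_def)
    qed (use hc in \<open>simp_all add: T_def\<close>)
    have gram: "ip (ent T (i, l)) (h i l s) (h i l t) = ip (ent S (i, l)) (g i l s) (g i l t)"
      if "s \<in> I i l" "t \<in> I i l" for s t
      using that unfolding S_def T_def
      by (auto simp: I_def g_def h_def ip_gen_gen[OF XY Z i l] ip_gen_gen[OF X YZ i l]
          ip_gen_gen[OF X Y _ l] ip_gen_gen[OF Y Z i] XYc YZc)
    note U = unitary_extension[OF cell1_fd[OF ST(1) i l] cell1_fd[OF ST(2) i l] g h gram P, folded mat]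
    show ?thesis using U(1,3) U(2) by blast
  qed
  show "iso2 n q ((X \<Zcomp> Y) \<Zcomp> Z) (X \<Zcomp> (Y \<Zcomp> Z)) (assoc2 X Y Z)"
    by (rule iso2I)
      (use ST main in \<open>auto simp: S_def T_def assoc2_def\<close>)
  show "mat (assoc2 X Y Z) (i, l) (gen (X \<Zcomp> Y) Z i l k z (gen X Y k l j y x)) =
      gen X (Y \<Zcomp> Z) i l j (gen Y Z i j k z y) x"
    if "i < q" "l < n" "k < p" "j < m" "z \<in> carrier (ent Z (i, k))"
        "y \<in> carrier (ent Y (k, j))" "x \<in> carrier (ent X (j, l))" for i l k j z y x
    using main[OF that(1,2)] that by (force simp: I_def g_def h_def)
qed

text \<open>The common part of both unitors: \<open>g x c\<close> is the tensor product of \<open>x\<close> and \<open>c\<close>, in either order.\<close>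

lemma unitor_entry:
  fixes g :: "'a \<Rightarrow> complex \<Rightarrow> 'b"
  assumes H: "fd_hilbert H" and K: "fd_hilbert K"
    and g: "spans K {g x c |x c. x \<in> carrier H}"
    and gram: "\<And>x x' c c'. \<lbrakk>x \<in> carrier H; x' \<in> carrier H\<rbrakk>
      \<Longrightarrow> ip K (g x c) (g x' c') = cnj c * c' * ip H x x'"
  defines "U \<equiv> THE T. T \<in> lin_maps K H \<and> (\<forall>x\<in>carrier H. \<forall>c. T (g x c) = c \<odot>\<^bsub>H\<^esub> x)"
  shows "U \<in> lin_maps K H" and "x \<in> carrier H \<Longrightarrow> U (g x c) = c \<odot>\<^bsub>H\<^esub> x"
    and "bij_betw U (carrier K) (carrier H)"
proof -
  let ?I = "carrier H \<times> UNIV"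
  let ?g = "\<lambda>(x, c). g x c" and ?h = "\<lambda>(x, c). c \<odot>\<^bsub>H\<^esub> x"
  have "{g x c |x c. x \<in> carrier H} = ?g ` ?I" by auto
  then have g': "spans K (?g ` ?I)" using g by simp
  have h: "spans H (?h ` ?I)"
  proof (rule spans_mono[OF spans_carrier])
    show "carrier H \<subseteq> ?h ` ?I"
    proof
      fix x assume "x \<in> carrier H"
      then have "x = ?h (x, 1)" "(x, 1) \<in> ?I" using H by auto
      then show "x \<in> ?h ` ?I" by (rule image_eqI)
    qed
  qed (use H in auto)
  have gram': "ip H (?h s) (?h t) = ip K (?g s) (?g t)" if "s \<in> ?I" "t \<in> ?I" for s t
    using that H by (auto simp: gram)
  note E = unitary_extension[OF K H g' h gram',
      of "\<lambda>T. \<forall>x\<in>carrier H. \<forall>c. T (g x c) = c \<odot>\<^bsub>H\<^esub> x", folded U_def]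
  show "U \<in> lin_maps K H" "bij_betw U (carrier K) (carrier H)" by (rule E; auto)+
  show "U (g x c) = c \<odot>\<^bsub>H\<^esub> x" if "x \<in> carrier H"
    using E(2)[of "(x, c)"] that by auto
qed

text \<open>In a composite with an identity only one summand survives, since the off-diagonal entries of
  the identity are zero.\<close>

lemma
  fixes X :: "'a cell1"
  assumes X: "is_cell1 n m X"
  shows lunit2_iso: "iso2 n m (id1 n \<Zcomp> X) X (lunit2 X)"
    and mat_lunit2: "\<And>i l x c. \<lbrakk>i < m; l < n; x \<in> carrier (ent X (i, l))\<rbrakk> \<Longrightarrow>
      mat (lunit2 X) (i, l) (gen (id1 n) X i l l x c) = c \<odot>\<^bsub>ent X (i, l)\<^esub> x"
proof -
  note J = id1_cell[of n]
  note JX = comp_cell[OF J X]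
  have main: "mat (lunit2 X) (i, l) \<in> lin_maps (ent (id1 n \<Zcomp> X) (i, l)) (ent X (i, l))" (is ?lin)
    "\<And>x c. x \<in> carrier (ent X (i, l)) \<Longrightarrow>
      mat (lunit2 X) (i, l) (gen (id1 n) X i l l x c) = c \<odot>\<^bsub>ent X (i, l)\<^esub> x"
    "bij_betw (mat (lunit2 X) (i, l)) (carrier (ent (id1 n \<Zcomp> X) (i, l))) (carrier (ent X (i, l)))" (is ?bij)
    if i: "i < m" and l: "l < n" for i l
  proof -
    let ?S = "{gen (id1 n) X i l l x c |x c. x \<in> carrier (ent X (i, l))}"
    have mat: "mat (lunit2 X) (i, l) = (THE U. U \<in> lin_maps (ent (id1 n \<Zcomp> X) (i, l)) (ent X (i, l)) \<and>
      (\<forall>x\<in>carrier (ent X (i, l)). \<forall>c. U (gen (id1 n) X i l l x c) = c \<odot>\<^bsub>ent X (i, l)\<^esub> x))"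
      using i l cell1_dims[OF X] by (simp add: lunit2_def idx_def Let_def)
    have g: "spans (ent (id1 n \<Zcomp> X) (i, l)) ?S"
    proof (rule spans_trans[OF spans_comp[OF J X i l spans_carrier spans_carrier]])
      have "gen (id1 n) X i l j x c \<in> lspan (ent (id1 n \<Zcomp> X) (i, l)) ?S"
        if "j < n" "x \<in> carrier (ent X (i, j))" "c \<in> carrier (ent (id1 n) (j, l))" for j x c
      proof (cases "j = l")
        case True
        then show ?thesis using that by (intro lspan.base) auto
      next
        case False
        then have "gen (id1 n) X i l j x c = \<zero>\<^bsub>ent (id1 n \<Zcomp> X) (i, l)\<^esub>"
          using gen_bilinear(6)[OF J X i l that(1,2)] that(3) by simp
        then show ?thesis by (simp add: lspan.zero)
      qed
      then show "{gen (id1 n) X i l j x c |j x c. j < n \<and> x \<in> carrier (ent X (i, j)) \<and>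
          c \<in> carrier (ent (id1 n) (j, l))} \<subseteq> lspan (ent (id1 n \<Zcomp> X) (i, l)) ?S"
        by blast
    qed (use l in \<open>auto intro!: gen_closed[OF J X i l]\<close>)
    note U = unitor_entry[OF cell1_fd[OF X i l] cell1_fd[OF JX i l] g, folded mat]
    show ?lin
      "\<And>x c. x \<in> carrier (ent X (i, l)) \<Longrightarrow>
        mat (lunit2 X) (i, l) (gen (id1 n) X i l l x c) = c \<odot>\<^bsub>ent X (i, l)\<^esub> x"
      ?bij
      by (rule U; simp add: ip_gen_gen[OF J X i l] l)+
  qed
  show "iso2 n m (id1 n \<Zcomp> X) X (lunit2 X)"
    by (rule iso2I) (use JX X main(1,3) cell1_dims[OF X] in \<open>auto simp: lunit2_def Let_def idx_def\<close>)
  show "mat (lunit2 X) (i, l) (gen (id1 n) X i l l x c) = c \<odot>\<^bsub>ent X (i, l)\<^esub> x"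
    if "i < m" "l < n" "x \<in> carrier (ent X (i, l))" for i l x c
    by (rule main(2)[OF that])
qed

lemma
  fixes X :: "'a cell1"
  assumes X: "is_cell1 n m X"
  shows runit2_iso: "iso2 n m (X \<Zcomp> id1 m) X (runit2 X)"
    and mat_runit2: "\<And>i l x c. \<lbrakk>i < m; l < n; x \<in> carrier (ent X (i, l))\<rbrakk> \<Longrightarrow>
      mat (runit2 X) (i, l) (gen X (id1 m) i l i c x) = c \<odot>\<^bsub>ent X (i, l)\<^esub> x"
proof -
  note J = id1_cell[of m]
  note XJ = comp_cell[OF X J]
  have main: "mat (runit2 X) (i, l) \<in> lin_maps (ent (X \<Zcomp> id1 m) (i, l)) (ent X (i, l))" (is ?lin)
    "\<And>x c. x \<in> carrier (ent X (i, l)) \<Longrightarrow>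
      mat (runit2 X) (i, l) (gen X (id1 m) i l i c x) = c \<odot>\<^bsub>ent X (i, l)\<^esub> x"
    "bij_betw (mat (runit2 X) (i, l)) (carrier (ent (X \<Zcomp> id1 m) (i, l))) (carrier (ent X (i, l)))" (is ?bij)
    if i: "i < m" and l: "l < n" for i l
  proof -
    let ?S = "{gen X (id1 m) i l i c x |x c. x \<in> carrier (ent X (i, l))}"
    have mat: "mat (runit2 X) (i, l) = (THE U. U \<in> lin_maps (ent (X \<Zcomp> id1 m) (i, l)) (ent X (i, l)) \<and>
      (\<forall>x\<in>carrier (ent X (i, l)). \<forall>c. U (gen X (id1 m) i l i c x) = c \<odot>\<^bsub>ent X (i, l)\<^esub> x))"
      using i l cell1_dims[OF X] by (simp add: runit2_def idx_def Let_def)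
    have g: "spans (ent (X \<Zcomp> id1 m) (i, l)) ?S"
    proof (rule spans_trans[OF spans_comp[OF X J i l spans_carrier spans_carrier]])
      have "gen X (id1 m) i l j c x \<in> lspan (ent (X \<Zcomp> id1 m) (i, l)) ?S"
        if "j < m" "c \<in> carrier (ent (id1 m) (i, j))" "x \<in> carrier (ent X (j, l))" for j x c
      proof (cases "i = j")
        case True
        then show ?thesis using that by (intro lspan.base) auto
      next
        case False
        then have "gen X (id1 m) i l j c x = \<zero>\<^bsub>ent (X \<Zcomp> id1 m) (i, l)\<^esub>"
          using gen_bilinear(5)[OF X J i l that(1,3)] that(2) by simp
        then show ?thesis by (simp add: lspan.zero)
      qed
      then show "{gen X (id1 m) i l j c x |j c x. j < m \<and> c \<in> carrier (ent (id1 m) (i, j)) \<and>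
          x \<in> carrier (ent X (j, l))} \<subseteq> lspan (ent (X \<Zcomp> id1 m) (i, l)) ?S"
        by blast
    qed (use i in \<open>auto intro!: gen_closed[OF X J i l]\<close>)
    note U = unitor_entry[where g = "\<lambda>x c. gen X (id1 m) i l i c x",
        OF cell1_fd[OF X i l] cell1_fd[OF XJ i l] g, folded mat]
    show ?lin
      "\<And>x c. x \<in> carrier (ent X (i, l)) \<Longrightarrow>
        mat (runit2 X) (i, l) (gen X (id1 m) i l i c x) = c \<odot>\<^bsub>ent X (i, l)\<^esub> x"
      ?bij
      by (rule U; simp add: ip_gen_gen[OF X J i l] i)+
  qed
  show "iso2 n m (X \<Zcomp> id1 m) X (runit2 X)"
    by (rule iso2I) (use XJ X main(1,3) cell1_dims[OF X] in \<open>auto simp: runit2_def Let_def idx_def\<close>)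
  show "mat (runit2 X) (i, l) (gen X (id1 m) i l i c x) = c \<odot>\<^bsub>ent X (i, l)\<^esub> x"
    if "i < m" "l < n" "x \<in> carrier (ent X (i, l))" for i l x c
    by (rule main(2)[OF that])
qed

lemma
  fixes S :: "'a cell1" and T :: "'b cell1"
  assumes S: "is_cell1 1 1 S" and T: "is_cell1 1 1 T"
  shows sym2_cell: "two_cell 1 1 (S \<Zcomp> T) (T \<Zcomp> S) (sym2 S T)"
    and mat_sym2: "\<And>s t. \<lbrakk>s \<in> carrier (ent S (0, 0)); t \<in> carrier (ent T (0, 0))\<rbrakk> \<Longrightarrow>
      mat (sym2 S T) (0, 0) (gen S T 0 0 0 t s) = gen T S 0 0 0 s t"
proof -
  note ST = comp_cell[OF S T] and TS = comp_cell[OF T S]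
  have z: "0 < (1::nat)" by simp
  let ?P = "\<lambda>U. \<forall>t\<in>carrier (ent T (0, 0)). \<forall>s\<in>carrier (ent S (0, 0)).
    U (gen S T 0 0 0 t s) = gen T S 0 0 0 s t"
  let ?I = "carrier (ent T (0, 0)) \<times> carrier (ent S (0, 0))"
  let ?g = "\<lambda>(t, s). gen S T 0 0 0 t s"
  let ?h = "\<lambda>(t, s). gen T S 0 0 0 s t"
  have mat: "mat (sym2 S T) (0, 0) =
    (THE U. U \<in> lin_maps (ent (S \<Zcomp> T) (0, 0)) (ent (T \<Zcomp> S) (0, 0)) \<and> ?P U)"
    using cell1_dims[OF S] cell1_dims[OF T] by (simp add: sym2_def idx_def)
  have P: "?P U \<longleftrightarrow> (\<forall>t\<in>?I. U (?g t) = ?h t)" for U by auto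
  have gc: "?g ` ?I \<subseteq> carrier (ent (S \<Zcomp> T) (0, 0))"
    by (auto intro!: gen_closed[OF S T z z])
  have hc: "?h ` ?I \<subseteq> carrier (ent (T \<Zcomp> S) (0, 0))"
    by (auto intro!: gen_closed[OF T S z z])
  have g: "spans (ent (S \<Zcomp> T) (0, 0)) (?g ` ?I)"
    by (rule spans_mono[OF spans_comp[OF S T z z spans_carrier spans_carrier] _ gc]) force
  have h: "spans (ent (T \<Zcomp> S) (0, 0)) (?h ` ?I)"
    by (rule spans_mono[OF spans_comp[OF T S z z spans_carrier spans_carrier] _ hc]) force
  have gram: "ip (ent (T \<Zcomp> S) (0, 0)) (?h s) (?h t) = ip (ent (S \<Zcomp> T) (0, 0)) (?g s) (?g t)"
    if "s \<in> ?I" "t \<in> ?I" for s t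
    using that by (auto simp: ip_gen_gen[OF S T z z] ip_gen_gen[OF T S z z])
  note U = unitary_extension[OF cell1_fd[OF ST z z] cell1_fd[OF TS z z] g h gram P, folded mat]
  show "two_cell 1 1 (S \<Zcomp> T) (T \<Zcomp> S) (sym2 S T)"
    by (rule two_cellI) (use ST TS U(1) in \<open>auto simp: sym2_def\<close>)
  show "mat (sym2 S T) (0, 0) (gen S T 0 0 0 t s) = gen T S 0 0 0 s t"
    if "s \<in> carrier (ent S (0, 0))" "t \<in> carrier (ent T (0, 0))" for s t
    using U(2)[of "(t, s)"] that by simp
qed


section \<open>Linear identities on spanning sets\<close>

text \<open>A version of extensionality for expressions in a vector, as they arise when one argument of a
  pasting diagram is kept fixed.\<close>

lemma linear_eqI:
  assumes "fd_hilbert H" "fd_hilbert K" "spans H A"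
    and "restrict F (carrier H) \<in> lin_maps H K" "restrict G (carrier H) \<in> lin_maps H K"
    and eq: "\<And>a. a \<in> A \<Longrightarrow> F a = G a" and x: "x \<in> carrier H"
  shows "F x = G x"
proof -
  have "restrict F (carrier H) = restrict G (carrier H)"
    by (rule lin_maps_eqI[OF assms(1-5)]) (use eq assms(3) in \<open>auto simp: spans_def\<close>)
  then show ?thesis using x by (metis restrict_apply')
qed

lemma lin_chain:
  assumes "fd_hilbert H" and f: "restrict f (carrier H) \<in> lin_maps H K" and T: "T \<in> lin_maps K M"
  shows "restrict (\<lambda>x. T (f x)) (carrier H) \<in> lin_maps H M"
proof -
  have "restrict (\<lambda>x. T (f x)) (carrier H) = compose (carrier H) T (restrict f (carrier H))"
    by (auto simp: compose_def intro!: restrict_ext)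
  then show ?thesis using compose_lin[OF assms] by simp
qed

lemma rank_one_lin:
  "\<lbrakk>fd_hilbert H; fd_hilbert K; v \<in> carrier H; w \<in> carrier K\<rbrakk>
    \<Longrightarrow> (\<lambda>u\<in>carrier H. ip H v u \<odot>\<^bsub>K\<^esub> w) \<in> lin_maps H K"
  by (rule lin_mapsI) (simp_all add: smult_assoc_fd smult_add_fd)

lemma gen_left_lin:
  assumes XY: "is_cell1 n m X" "is_cell1 m k Y" "i < k" "l < n" and j: "j < m" and x: "x \<in> carrier (ent X (j, l))"
  shows "(\<lambda>y\<in>carrier (ent Y (i, j)). gen X Y i l j y x) \<in> lin_maps (ent Y (i, j)) (ent (X \<Zcomp> Y) (i, l))"
  by (rule lin_mapsI)
    (simp_all add: gen_closed[OF XY] gen_bilinear[OF XY] j x cell1_fd[OF XY(2)] XY(3))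

lemma gen_right_lin:
  assumes XY: "is_cell1 n m X" "is_cell1 m k Y" "i < k" "l < n" and j: "j < m" and y: "y \<in> carrier (ent Y (i, j))"
  shows "(\<lambda>x\<in>carrier (ent X (j, l)). gen X Y i l j y x) \<in> lin_maps (ent X (j, l)) (ent (X \<Zcomp> Y) (i, l))"
  by (rule lin_mapsI)
    (simp_all add: gen_closed[OF XY] gen_bilinear[OF XY] j y cell1_fd[OF XY(1)] XY(4))

lemma comp_eqI:
  assumes XY: "is_cell1 n m X" "is_cell1 m k Y" "i < k" "l < n"
    and u: "u \<in> carrier (ent (X \<Zcomp> Y) (i, l))" and v: "v \<in> carrier (ent (X \<Zcomp> Y) (i, l))"
    and eq: "\<And>j y x. \<lbrakk>j < m; y \<in> carrier (ent Y (i, j)); x \<in> carrier (ent X (j, l))\<rbrakk>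
      \<Longrightarrow> u j (y, x) = v j (y, x)"
  shows "u = v"
proof (rule PiE_ext)
  show uv: "u \<in> (\<Pi>\<^sub>E j\<in>{..<m}. carrier (tensor (ent Y (i, j)) (ent X (j, l))))"
    "v \<in> (\<Pi>\<^sub>E j\<in>{..<m}. carrier (tensor (ent Y (i, j)) (ent X (j, l))))"
    using u v by (simp_all add: comp_carrier[OF XY])
  fix j assume j: "j \<in> {..<m}"
  show "u j = v j"
    by (rule tensor_eqI[OF PiE_mem[OF uv(1) j] PiE_mem[OF uv(2) j]]) (use eq j in auto)
qed

text \<open>The diagonal entries of an identity 1-cell are spanned by \<open>1\<close>, and the other ones are zero.\<close>

lemma id1_source_eqI:
  assumes L: "two_cell n n (id1 n) Y L" and M: "two_cell n n (id1 n) Y M"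
    and eq: "\<And>i. i < n \<Longrightarrow> mat L (i, i) 1 = mat M (i, i) 1"
  shows "L = M"
proof (rule two_cell_eqI[OF L M])
  fix i l x assume il: "i < n" "l < n" and x: "x \<in> carrier (ent (id1 n) (i, l))"
  note LM = two_cellD(6)[OF L il] two_cellD(6)[OF M il]
  have fY: "fd_hilbert (ent Y (i, l))" by (rule cell1_fd[OF two_cellD(2)[OF L] il])
  show "mat L (i, l) x = mat M (i, l) x"
  proof (cases "i = l")
    case True
    have "mat L (i, i) (x * 1) = mat M (i, i) (x * 1)"
      using lin_smult[OF LM(1), of 1 x] lin_smult[OF LM(2), of 1 x] True eq il by simp
    then show ?thesis using True by simp
  next
    case False
    then have "x = \<zero>\<^bsub>ent (id1 n) (i, l)\<^esub>" "fd_hilbert (ent (id1 n) (i, l))" using x by auto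
    then show ?thesis using lin_zero[OF _ fY LM(1)] lin_zero[OF _ fY LM(2)] by simp
  qed
qed

lemma iso2_cell: "iso2 n m X Y L \<Longrightarrow> two_cell n m X Y L"
  by (simp add: iso2_def)

lemma mat_inv2_eqI:
  "\<lbrakk>iso2 n m X Y L; i < m; l < n; x \<in> carrier (ent X (i, l)); mat L (i, l) x = y\<rbrakk>
    \<Longrightarrow> mat (inv2 L) (i, l) y = x"
  using mat_inv2[of n m X Y L i l x] by simp


section \<open>Evaluating the witness axioms\<close>

text \<open>The data of a witness without the snake equations, \<open>Compare \<cdot> Copy = id\<close> and commutativity. The
  2-cells are determined by the vector \<open>\<eta>\<close> in the sum of the \<open>R\<^sub>j \<otimes> L\<^sub>j\<close> and the vectors \<open>\<kappa> i\<close> in \<open>L\<^sub>i \<otimes> R\<^sub>i\<close>, the images of \<open>1\<close> under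
  \<open>Create\<close> and \<open>Copy\<close>: their adjoints \<open>Delete\<close> and \<open>Compare\<close> are the inner products with these
  vectors.\<close>

locale witness_cells =
  fixes n :: nat and W :: "('a, 'b) witness_data"
  assumes WL_cell: "is_cell1 1 n (WL W)"
    and WR_cell: "is_cell1 n 1 (WR W)"
    and Create_cell: "is_cell2 (id1 1) (WL W \<Zcomp> WR W) (Create W)"
    and Delete_eq: "Delete W = dagger (Create W)"
    and Copy_cell: "is_cell2 (id1 n) (WR W \<Zcomp> WL W) (Copy W)"
    and Compare_eq: "Compare W = dagger (Copy W)"
begin

abbreviation "L \<equiv> WL W"
abbreviation "R \<equiv> WR W"
abbreviation "LR \<equiv> ent (L \<Zcomp> R) (0, 0)"
abbreviation "HL i \<equiv> ent L (i, 0)"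
abbreviation "HR i \<equiv> ent R (0, i)"

definition \<eta> where "\<eta> = mat (Create W) (0, 0) 1"

definition \<kappa> where "\<kappa> i = mat (Copy W) (i, i) 1"

lemma LR_cell: "is_cell1 1 1 (L \<Zcomp> R)" and RL_cell: "is_cell1 n n (R \<Zcomp> L)"
  by (rule comp_cell[OF WL_cell WR_cell], rule comp_cell[OF WR_cell WL_cell])

lemma fd_L: "i < n \<Longrightarrow> fd_hilbert (HL i)" and fd_R: "i < n \<Longrightarrow> fd_hilbert (HR i)"
  using cell1_fd[OF WL_cell, of i 0] cell1_fd[OF WR_cell, of 0 i] by auto

lemmas fd_LR = cell1_fd[OF LR_cell zero_less_one zero_less_one]

lemmas fd_RL = cell1_fd[OF RL_cell]

lemma Create_two_cell: "two_cell 1 1 (id1 1) (L \<Zcomp> R) (Create W)"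
  and Copy_two_cell: "two_cell n n (id1 n) (R \<Zcomp> L) (Copy W)"
  by (simp_all add: two_cell_def id1_cell LR_cell RL_cell Create_cell Copy_cell del: One_nat_def)

lemma Delete_two_cell: "two_cell 1 1 (L \<Zcomp> R) (id1 1) (Delete W)"
  and Compare_two_cell: "two_cell n n (R \<Zcomp> L) (id1 n) (Compare W)"
  unfolding Delete_eq Compare_eq by (intro dagger_cell Create_two_cell Copy_two_cell)+

lemma \<eta>_closed: "\<eta> \<in> carrier LR"
  unfolding \<eta>_def by (rule two_cellD(7)[OF Create_two_cell]) simp_all

lemma \<kappa>_closed: "i < n \<Longrightarrow> \<kappa> i \<in> carrier (ent (R \<Zcomp> L) (i, i))"
  unfolding \<kappa>_def by (rule two_cellD(7)[OF Copy_two_cell]) simp_all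

lemma mat_Delete:
  assumes u: "u \<in> carrier LR"
  shows "mat (Delete W) (0, 0) u = ip LR \<eta> u"
  using ip_dagger[OF Create_two_cell, of 0 0 u 1] u by (simp add: Delete_eq \<eta>_def)

lemma mat_Compare:
  assumes il: "i < n" "l < n" and u: "u \<in> carrier (ent (R \<Zcomp> L) (i, l))"
  shows "mat (Compare W) (i, l) u = (if i = l then ip (ent (R \<Zcomp> L) (i, i)) (\<kappa> i) u else 0)"
proof (cases "i = l")
  case True
  then show ?thesis
    using ip_dagger[OF Copy_two_cell, of i i u 1] u il by (simp add: Compare_eq \<kappa>_def)
next
  case False
  then show ?thesis using two_cellD(7)[OF Compare_two_cell il u] by simp
qed

text \<open>The bilinear form that \<open>Compare\<close> defines on the \<open>i\<close>-th entries.\<close>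

definition \<beta> where "\<beta> i x y = ip (ent (R \<Zcomp> L) (i, i)) (\<kappa> i) (gen R L i i 0 x y)"

abbreviation "in_L i x \<equiv> x \<in> carrier (HL i)"
abbreviation "in_R i y \<equiv> y \<in> carrier (HR i)"

lemma LR_closed: "\<lbrakk>j < n; in_R j y; in_L j x\<rbrakk> \<Longrightarrow> gen L R 0 0 j y x \<in> carrier LR"
  by (rule gen_closed[OF WL_cell WR_cell]) simp_all

lemma RL_closed:
  "\<lbrakk>i < n; l < n; in_L i x; in_R l y\<rbrakk> \<Longrightarrow> gen R L i l 0 x y \<in> carrier (ent (R \<Zcomp> L) (i, l))"
  by (rule gen_closed[OF WR_cell WL_cell]) simp_all

lemma spans_LR: "spans LR {gen L R 0 0 j y x |j y x. j < n \<and> in_R j y \<and> in_L j x}"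
  by (rule spans_comp[OF WL_cell WR_cell _ _ spans_carrier spans_carrier]) simp_all

lemma spans_RL: "\<lbrakk>i < n; l < n\<rbrakk> \<Longrightarrow>
    spans (ent (R \<Zcomp> L) (i, l)) {gen R L i l j x y |j x y. j < 1 \<and> x \<in> carrier (ent L (i, j)) \<and> y \<in> carrier (ent R (j, l))}"
  by (rule spans_comp[OF WR_cell WL_cell _ _ spans_carrier spans_carrier]) simp_all

lemma ip_LR:
  assumes "j < n" "in_R j y" "in_L j x" "j' < n" "in_R j' y'" "in_L j' x'"
  shows "ip LR (gen L R 0 0 j y x) (gen L R 0 0 j' y' x') =
    (if j = j' then ip (HR j) y y' * ip (HL j) x x' else 0)"
  by (rule ip_gen_gen[OF WL_cell WR_cell _ _ assms]) simp_all

lemma ip_RL: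
  assumes "i < n" "l < n" "in_L i x" "in_R l y" "in_L i x'" "in_R l y'"
  shows "ip (ent (R \<Zcomp> L) (i, l)) (gen R L i l 0 x y) (gen R L i l 0 x' y') =
    ip (HL i) x x' * ip (HR l) y y'"
  using ip_gen_gen[OF WR_cell WL_cell assms(1,2) zero_less_one assms(3,4) zero_less_one assms(5,6)]
  by simp

lemma ip_LR_\<eta>: "\<lbrakk>j < n; in_R j y; in_L j x\<rbrakk> \<Longrightarrow>
    ip LR (gen L R 0 0 j y x) \<eta> = \<eta> j (y, x)"
  by (rule ip_gen[OF WL_cell WR_cell _ _ _ _ _ \<eta>_closed]) simp_all

lemma two_cell_facts:
  "two_cell n 1 (id1 n \<Zcomp> R) R (lunit2 R)" "two_cell n 1 (R \<Zcomp> id1 1) R (runit2 R)"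
  "two_cell 1 n (id1 1 \<Zcomp> L) L (lunit2 L)" "two_cell 1 n (L \<Zcomp> id1 n) L (runit2 L)"
  "two_cell n 1 R (id1 n \<Zcomp> R) (inv2 (lunit2 R))" "two_cell n 1 R (R \<Zcomp> id1 1) (inv2 (runit2 R))"
  "two_cell 1 n L (id1 1 \<Zcomp> L) (inv2 (lunit2 L))" "two_cell 1 n L (L \<Zcomp> id1 n) (inv2 (runit2 L))"
  "two_cell n 1 ((R \<Zcomp> L) \<Zcomp> R) (R \<Zcomp> (L \<Zcomp> R)) (assoc2 R L R)"
  "two_cell 1 n ((L \<Zcomp> R) \<Zcomp> L) (L \<Zcomp> (R \<Zcomp> L)) (assoc2 L R L)"
  "two_cell n 1 (R \<Zcomp> (L \<Zcomp> R)) ((R \<Zcomp> L) \<Zcomp> R) (inv2 (assoc2 R L R))"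
  "two_cell 1 n (L \<Zcomp> (R \<Zcomp> L)) ((L \<Zcomp> R) \<Zcomp> L) (inv2 (assoc2 L R L))"
  "two_cell 1 1 ((L \<Zcomp> R) \<Zcomp> (L \<Zcomp> R)) (L \<Zcomp> (R \<Zcomp> (L \<Zcomp> R))) (assoc2 L R (L \<Zcomp> R))"
  "two_cell n 1 R R (id2 R)" "two_cell 1 n L L (id2 L)"
  by (rule iso2_cell[OF lunit2_iso] iso2_cell[OF runit2_iso] iso2_cell[OF assoc2_iso]
      inv2_cell[OF lunit2_iso] inv2_cell[OF runit2_iso] inv2_cell[OF assoc2_iso] id2_cell
      WL_cell WR_cell LR_cell)+

lemma inv_runit_R: "\<lbrakk>l < n; in_R l r\<rbrakk> \<Longrightarrow> mat (inv2 (runit2 R)) (0, l) r = gen R (id1 1) 0 l 0 1 r"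
  by (rule mat_inv2_eqI[OF runit2_iso[OF WR_cell]])
    (simp_all add: mat_runit2[OF WR_cell, of 0 l r 1, simplified] fd_R
      gen_closed[OF WR_cell id1_cell[of 1], simplified])

lemma inv_lunit_R: "\<lbrakk>l < n; in_R l r\<rbrakk> \<Longrightarrow> mat (inv2 (lunit2 R)) (0, l) r = gen (id1 n) R 0 l l r 1"
  by (rule mat_inv2_eqI[OF lunit2_iso[OF WR_cell]])
    (simp_all add: mat_lunit2[OF WR_cell, of 0 l r 1, simplified] fd_R
      gen_closed[OF id1_cell WR_cell, simplified])

lemma inv_runit_L: "\<lbrakk>i < n; in_L i x\<rbrakk> \<Longrightarrow> mat (inv2 (runit2 L)) (i, 0) x = gen L (id1 n) i 0 i 1 x"
  by (rule mat_inv2_eqI[OF runit2_iso[OF WL_cell]])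
    (simp_all add: mat_runit2[OF WL_cell, of i 0 x 1, simplified] fd_L
      gen_closed[OF WL_cell id1_cell, simplified])

lemma inv_lunit_L: "\<lbrakk>i < n; in_L i x\<rbrakk> \<Longrightarrow> mat (inv2 (lunit2 L)) (i, 0) x = gen (id1 1) L i 0 0 x 1"
  by (rule mat_inv2_eqI[OF lunit2_iso[OF WL_cell]])
    (simp_all add: mat_lunit2[OF WL_cell, of i 0 x 1, simplified] fd_L
      gen_closed[OF id1_cell[of 1] WL_cell, simplified])


text \<open>Each snake equation is a \<open>cup\<close>, which inserts \<open>\<eta>\<close> or \<open>\<kappa>\<close> next to an identity, followed by a \<open>cap\<close>,
  which rebrackets and removes a pair by an inner product. The first cap also occurs in the
  multiplication.\<close>

definition "cap\<^sub>1 = lunit2 R \<cdot> (Compare W \<Zcomp>\<^sub>2 id2 R) \<cdot> inv2 (assoc2 R L R)"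
definition "cap\<^sub>2 = runit2 R \<cdot> (id2 R \<Zcomp>\<^sub>2 Delete W) \<cdot> assoc2 R L R"
definition "cap\<^sub>3 = runit2 L \<cdot> (id2 L \<Zcomp>\<^sub>2 Compare W) \<cdot> assoc2 L R L"
definition "cap\<^sub>4 = lunit2 L \<cdot> (Delete W \<Zcomp>\<^sub>2 id2 L) \<cdot> inv2 (assoc2 L R L)"

lemma cap_cells:
  "two_cell n 1 (R \<Zcomp> (L \<Zcomp> R)) R cap\<^sub>1" "two_cell n 1 ((R \<Zcomp> L) \<Zcomp> R) R cap\<^sub>2"
  "two_cell 1 n ((L \<Zcomp> R) \<Zcomp> L) L cap\<^sub>3" "two_cell 1 n (L \<Zcomp> (R \<Zcomp> L)) L cap\<^sub>4"
  unfolding cap\<^sub>1_def cap\<^sub>2_def cap\<^sub>3_def cap\<^sub>4_def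
  by (rule vcomp_cell two_cell_facts hcomp_cell Compare_two_cell Delete_two_cell)+

text \<open>In the caps that contain \<open>Compare\<close>, the summands with \<open>j\<close> different from the index of the fixed
  vector vanish, because \<open>Compare\<close> is zero off the diagonal.\<close>

lemma mat_cap\<^sub>1:
  assumes l: "l < n" and r: "in_R l r" and j: "j < n" and y: "in_R j y" and x: "in_L j x"
  shows "mat cap\<^sub>1 (0, l) (gen R (L \<Zcomp> R) 0 l 0 (gen L R 0 0 j y x) r) =
    (if j = l then \<beta> l x r \<odot>\<^bsub>HR l\<^esub> y else \<zero>\<^bsub>HR l\<^esub>)"
proof -
  have w: "gen R L j l 0 x r \<in> carrier (ent (R \<Zcomp> L) (j, l))" by (rule RL_closed[OF j l x r])
  have g: "gen (R \<Zcomp> L) R 0 l j y (gen R L j l 0 x r) \<in> carrier (ent ((R \<Zcomp> L) \<Zcomp> R) (0, l))"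
    using gen_closed[OF RL_cell WR_cell _ l j y w] by simp
  have g': "gen R (L \<Zcomp> R) 0 l 0 (gen L R 0 0 j y x) r \<in> carrier (ent (R \<Zcomp> (L \<Zcomp> R)) (0, l))"
    using gen_closed[OF WR_cell LR_cell _ l _ LR_closed[OF j y x] r] by simp
  have 1: "mat (inv2 (assoc2 R L R)) (0, l) (gen R (L \<Zcomp> R) 0 l 0 (gen L R 0 0 j y x) r) =
    gen (R \<Zcomp> L) R 0 l j y (gen R L j l 0 x r)"
    by (rule mat_inv2_eqI[OF assoc2_iso[OF WR_cell WL_cell WR_cell] _ l g])
      (simp_all add: mat_assoc2[OF WR_cell WL_cell WR_cell] l r j y x)
  have 2: "mat (Compare W \<Zcomp>\<^sub>2 id2 R) (0, l) (gen (R \<Zcomp> L) R 0 l j y (gen R L j l 0 x r)) =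
    gen (id1 n) R 0 l j y (if j = l then \<beta> l x r else 0)"
    using mat_hcomp[OF Compare_two_cell two_cell_facts(14) zero_less_one l j y w]
    by (simp add: mat_id2[OF WR_cell] mat_Compare j l w y \<beta>_def)
  have 3: "mat (lunit2 R) (0, l) (gen (id1 n) R 0 l j y (if j = l then \<beta> l x r else 0)) =
    (if j = l then \<beta> l x r \<odot>\<^bsub>HR l\<^esub> y else \<zero>\<^bsub>HR l\<^esub>)"
  proof (cases "j = l")
    case True
    then show ?thesis using mat_lunit2[OF WR_cell, of 0 l y] l y by simp
  next
    case False
    have "gen (id1 n) R 0 l j y \<zero>\<^bsub>ent (id1 n) (j, l)\<^esub> = \<zero>\<^bsub>ent (id1 n \<Zcomp> R) (0, l)\<^esub>"
      by (rule gen_bilinear(6)[OF id1_cell WR_cell _ l j y]) simp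
    moreover have "mat (lunit2 R) (0, l) \<zero>\<^bsub>ent (id1 n \<Zcomp> R) (0, l)\<^esub> = \<zero>\<^bsub>HR l\<^esub>"
      by (rule lin_zero[OF _ fd_R[OF l] two_cellD(6)[OF two_cell_facts(1) _ l]])
        (simp_all add: cell1_fd[OF two_cellD(1)[OF two_cell_facts(1)]] l)
    ultimately show ?thesis using False by simp
  qed
  note c = vcomp_cell[OF two_cell_facts(11) hcomp_cell[OF Compare_two_cell two_cell_facts(14)]]
  show ?thesis unfolding cap\<^sub>1_def
    using mat_vcomp[OF c zero_less_one l g', of "lunit2 R"]
      mat_vcomp[OF two_cell_facts(11) zero_less_one l g', of "Compare W \<Zcomp>\<^sub>2 id2 R"]
    by (simp add: 1 2 3)
qed

lemma mat_cap\<^sub>2: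
  assumes l: "l < n" and r: "in_R l r" and j: "j < n" and y: "in_R j y" and x: "in_L j x"
  shows "mat cap\<^sub>2 (0, l) (gen (R \<Zcomp> L) R 0 l j y (gen R L j l 0 x r)) =
    ip LR \<eta> (gen L R 0 0 j y x) \<odot>\<^bsub>HR l\<^esub> r"
proof -
  have w: "gen R L j l 0 x r \<in> carrier (ent (R \<Zcomp> L) (j, l))" by (rule RL_closed[OF j l x r])
  have g: "gen (R \<Zcomp> L) R 0 l j y (gen R L j l 0 x r) \<in> carrier (ent ((R \<Zcomp> L) \<Zcomp> R) (0, l))"
    using gen_closed[OF RL_cell WR_cell _ l j y w] by simp
  note w' = LR_closed[OF j y x]
  have 1: "mat (assoc2 R L R) (0, l) (gen (R \<Zcomp> L) R 0 l j y (gen R L j l 0 x r)) =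
    gen R (L \<Zcomp> R) 0 l 0 (gen L R 0 0 j y x) r"
    by (rule mat_assoc2[OF WR_cell WL_cell WR_cell]) (simp_all add: l r j y x)
  have 2: "mat (id2 R \<Zcomp>\<^sub>2 Delete W) (0, l) (gen R (L \<Zcomp> R) 0 l 0 (gen L R 0 0 j y x) r) =
    gen R (id1 1) 0 l 0 (ip LR \<eta> (gen L R 0 0 j y x)) r"
    using mat_hcomp[OF two_cell_facts(14) Delete_two_cell zero_less_one l zero_less_one w' r]
    by (simp add: mat_id2[OF WR_cell] mat_Delete l w' r)
  note c = vcomp_cell[OF two_cell_facts(9) hcomp_cell[OF two_cell_facts(14) Delete_two_cell]]
  show ?thesis unfolding cap\<^sub>2_def
    using mat_vcomp[OF c zero_less_one l g, of "runit2 R"]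
      mat_vcomp[OF two_cell_facts(9) zero_less_one l g, of "id2 R \<Zcomp>\<^sub>2 Delete W"]
      mat_runit2[OF WR_cell zero_less_one l r]
    by (simp add: 1 2)
qed

lemma mat_cap\<^sub>3:
  assumes i: "i < n" and x: "in_L i x" and j: "j < n" and y: "in_R j y" and x': "in_L j x'"
  shows "mat cap\<^sub>3 (i, 0) (gen (L \<Zcomp> R) L i 0 0 x (gen L R 0 0 j y x')) =
    (if j = i then \<beta> i x y \<odot>\<^bsub>HL i\<^esub> x' else \<zero>\<^bsub>HL i\<^esub>)"
proof -
  have w: "gen R L i j 0 x y \<in> carrier (ent (R \<Zcomp> L) (i, j))" by (rule RL_closed[OF i j x y])
  have g: "gen (L \<Zcomp> R) L i 0 0 x (gen L R 0 0 j y x') \<in> carrier (ent ((L \<Zcomp> R) \<Zcomp> L) (i, 0))"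
    using gen_closed[OF LR_cell WL_cell i _ _ x LR_closed[OF j y x']] by simp
  have 1: "mat (assoc2 L R L) (i, 0) (gen (L \<Zcomp> R) L i 0 0 x (gen L R 0 0 j y x')) =
    gen L (R \<Zcomp> L) i 0 j (gen R L i j 0 x y) x'"
    by (rule mat_assoc2[OF WL_cell WR_cell WL_cell]) (simp_all add: i x j y x')
  have 2: "mat (id2 L \<Zcomp>\<^sub>2 Compare W) (i, 0) (gen L (R \<Zcomp> L) i 0 j (gen R L i j 0 x y) x') =
    gen L (id1 n) i 0 j (if j = i then \<beta> i x y else 0) x'"
    using mat_hcomp[OF two_cell_facts(15) Compare_two_cell i zero_less_one j w x']
    by (auto simp: mat_id2[OF WL_cell] mat_Compare i j w x' \<beta>_def)
  have 3: "mat (runit2 L) (i, 0) (gen L (id1 n) i 0 j (if j = i then \<beta> i x y else 0) x') =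
    (if j = i then \<beta> i x y \<odot>\<^bsub>HL i\<^esub> x' else \<zero>\<^bsub>HL i\<^esub>)"
  proof (cases "j = i")
    case True
    then show ?thesis using mat_runit2[OF WL_cell, of i 0 x'] i x' by simp
  next
    case False
    have "gen L (id1 n) i 0 j \<zero>\<^bsub>ent (id1 n) (i, j)\<^esub> x' = \<zero>\<^bsub>ent (L \<Zcomp> id1 n) (i, 0)\<^esub>"
      by (rule gen_bilinear(5)[OF WL_cell id1_cell i _ j x']) simp
    moreover have "mat (runit2 L) (i, 0) \<zero>\<^bsub>ent (L \<Zcomp> id1 n) (i, 0)\<^esub> = \<zero>\<^bsub>HL i\<^esub>"
      by (rule lin_zero[OF _ fd_L[OF i] two_cellD(6)[OF two_cell_facts(4) i]])
        (simp_all add: cell1_fd[OF two_cellD(1)[OF two_cell_facts(4)]] i)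
    ultimately show ?thesis using False by auto
  qed
  note c = vcomp_cell[OF two_cell_facts(10) hcomp_cell[OF two_cell_facts(15) Compare_two_cell]]
  show ?thesis unfolding cap\<^sub>3_def
    using mat_vcomp[OF c i zero_less_one g, of "runit2 L"]
      mat_vcomp[OF two_cell_facts(10) i zero_less_one g, of "id2 L \<Zcomp>\<^sub>2 Compare W"]
    by (simp add: 1 2 3)
qed

lemma mat_cap\<^sub>4:
  assumes i: "i < n" and x: "in_L i x" and j: "j < n" and y: "in_R j y" and x': "in_L j x'"
  shows "mat cap\<^sub>4 (i, 0) (gen L (R \<Zcomp> L) i 0 j (gen R L i j 0 x y) x') =
    ip LR \<eta> (gen L R 0 0 j y x') \<odot>\<^bsub>HL i\<^esub> x"
proof -
  have w: "gen R L i j 0 x y \<in> carrier (ent (R \<Zcomp> L) (i, j))" by (rule RL_closed[OF i j x y])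
  have g': "gen L (R \<Zcomp> L) i 0 j (gen R L i j 0 x y) x' \<in> carrier (ent (L \<Zcomp> (R \<Zcomp> L)) (i, 0))"
    using gen_closed[OF WL_cell RL_cell i _ j w x'] by simp
  note w' = LR_closed[OF j y x']
  have g: "gen (L \<Zcomp> R) L i 0 0 x (gen L R 0 0 j y x') \<in> carrier (ent ((L \<Zcomp> R) \<Zcomp> L) (i, 0))"
    using gen_closed[OF LR_cell WL_cell i _ _ x w'] by simp
  have 1: "mat (inv2 (assoc2 L R L)) (i, 0) (gen L (R \<Zcomp> L) i 0 j (gen R L i j 0 x y) x') =
    gen (L \<Zcomp> R) L i 0 0 x (gen L R 0 0 j y x')"
    by (rule mat_inv2_eqI[OF assoc2_iso[OF WL_cell WR_cell WL_cell] i _ g])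
      (simp_all add: mat_assoc2[OF WL_cell WR_cell WL_cell] i x j y x')
  have 2: "mat (Delete W \<Zcomp>\<^sub>2 id2 L) (i, 0) (gen (L \<Zcomp> R) L i 0 0 x (gen L R 0 0 j y x')) =
    gen (id1 1) L i 0 0 x (ip LR \<eta> (gen L R 0 0 j y x'))"
    using mat_hcomp[OF Delete_two_cell two_cell_facts(15) i zero_less_one zero_less_one x w']
    by (simp add: mat_id2[OF WL_cell] mat_Delete i w' x)
  note c = vcomp_cell[OF two_cell_facts(12) hcomp_cell[OF Delete_two_cell two_cell_facts(15)]]
  show ?thesis unfolding cap\<^sub>4_def
    using mat_vcomp[OF c i zero_less_one g', of "lunit2 L"]
      mat_vcomp[OF two_cell_facts(12) i zero_less_one g', of "Delete W \<Zcomp>\<^sub>2 id2 L"]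
      mat_lunit2[OF WL_cell i zero_less_one x]
    by (simp add: 1 2)
qed

end


lemma vcomp_assoc:
  assumes "two_cell n m X Y L" "two_cell n m Y Z M" "two_cell n m Z V N"
  shows "(N \<cdot> M) \<cdot> L = N \<cdot> (M \<cdot> L)"
proof (rule two_cell_eqI[OF vcomp_cell[OF assms(1) vcomp_cell[OF assms(2,3)]]
      vcomp_cell[OF vcomp_cell[OF assms(1,2)] assms(3)]])
  fix i l x assume *: "i < m" "l < n" "x \<in> carrier (ent X (i, l))"
  show "mat ((N \<cdot> M) \<cdot> L) (i, l) x = mat (N \<cdot> (M \<cdot> L)) (i, l) x"
    using mat_vcomp[OF assms(1) *, of "N \<cdot> M"] mat_vcomp[OF assms(1) *, of M]
      mat_vcomp[OF assms(2) *(1,2) two_cellD(7)[OF assms(1) *], of N]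
      mat_vcomp[OF vcomp_cell[OF assms(1,2)] *, of N] by simp
qed

context witness_cells
begin

definition "cup\<^sub>1 = (id2 R \<Zcomp>\<^sub>2 Create W) \<cdot> inv2 (runit2 R)"
definition "cup\<^sub>2 = (Copy W \<Zcomp>\<^sub>2 id2 R) \<cdot> inv2 (lunit2 R)"
definition "cup\<^sub>3 = (Create W \<Zcomp>\<^sub>2 id2 L) \<cdot> inv2 (lunit2 L)"
definition "cup\<^sub>4 = (id2 L \<Zcomp>\<^sub>2 Copy W) \<cdot> inv2 (runit2 L)"

lemma cup_cells:
  "two_cell n 1 R (R \<Zcomp> (L \<Zcomp> R)) cup\<^sub>1" "two_cell n 1 R ((R \<Zcomp> L) \<Zcomp> R) cup\<^sub>2"
  "two_cell 1 n L ((L \<Zcomp> R) \<Zcomp> L) cup\<^sub>3" "two_cell 1 n L (L \<Zcomp> (R \<Zcomp> L)) cup\<^sub>4"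
  unfolding cup\<^sub>1_def cup\<^sub>2_def cup\<^sub>3_def cup\<^sub>4_def
  by (rule vcomp_cell two_cell_facts hcomp_cell Create_two_cell Copy_two_cell)+

lemma mat_cup\<^sub>1: "\<lbrakk>l < n; in_R l r\<rbrakk> \<Longrightarrow> mat cup\<^sub>1 (0, l) r = gen R (L \<Zcomp> R) 0 l 0 \<eta> r"
  using mat_vcomp[OF two_cell_facts(6), of 0 l r "id2 R \<Zcomp>\<^sub>2 Create W"]
    mat_hcomp[OF two_cell_facts(14) Create_two_cell, of 0 l 0 1 r]
  by (simp add: cup\<^sub>1_def inv_runit_R mat_id2[OF WR_cell] \<eta>_def)

lemma mat_cup\<^sub>2: "\<lbrakk>l < n; in_R l r\<rbrakk> \<Longrightarrow> mat cup\<^sub>2 (0, l) r = gen (R \<Zcomp> L) R 0 l l r (\<kappa> l)"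
  using mat_vcomp[OF two_cell_facts(5), of 0 l r "Copy W \<Zcomp>\<^sub>2 id2 R"]
    mat_hcomp[OF Copy_two_cell two_cell_facts(14), of 0 l l r 1]
  by (simp add: cup\<^sub>2_def inv_lunit_R mat_id2[OF WR_cell] \<kappa>_def)

lemma mat_cup\<^sub>3: "\<lbrakk>i < n; in_L i x\<rbrakk> \<Longrightarrow> mat cup\<^sub>3 (i, 0) x = gen (L \<Zcomp> R) L i 0 0 x \<eta>"
  using mat_vcomp[OF two_cell_facts(7), of i 0 x "Create W \<Zcomp>\<^sub>2 id2 L"]
    mat_hcomp[OF Create_two_cell two_cell_facts(15), of i 0 0 x 1]
  by (simp add: cup\<^sub>3_def inv_lunit_L mat_id2[OF WL_cell] \<eta>_def)

lemma mat_cup\<^sub>4: "\<lbrakk>i < n; in_L i x\<rbrakk> \<Longrightarrow> mat cup\<^sub>4 (i, 0) x = gen L (R \<Zcomp> L) i 0 i (\<kappa> i) x"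
  using mat_vcomp[OF two_cell_facts(8), of i 0 x "id2 L \<Zcomp>\<^sub>2 Copy W"]
    mat_hcomp[OF two_cell_facts(15) Copy_two_cell, of i 0 i 1 x]
  by (simp add: cup\<^sub>4_def inv_runit_L mat_id2[OF WL_cell] \<kappa>_def)

lemma snakes:
  "lunit2 R \<cdot> (Compare W \<Zcomp>\<^sub>2 id2 R) \<cdot> inv2 (assoc2 R L R) \<cdot> (id2 R \<Zcomp>\<^sub>2 Create W) \<cdot> inv2 (runit2 R)
    = cap\<^sub>1 \<cdot> cup\<^sub>1"
  "runit2 R \<cdot> (id2 R \<Zcomp>\<^sub>2 Delete W) \<cdot> assoc2 R L R \<cdot> (Copy W \<Zcomp>\<^sub>2 id2 R) \<cdot> inv2 (lunit2 R)
    = cap\<^sub>2 \<cdot> cup\<^sub>2"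
  "runit2 L \<cdot> (id2 L \<Zcomp>\<^sub>2 Compare W) \<cdot> assoc2 L R L \<cdot> (Create W \<Zcomp>\<^sub>2 id2 L) \<cdot> inv2 (lunit2 L)
    = cap\<^sub>3 \<cdot> cup\<^sub>3"
  "lunit2 L \<cdot> (Delete W \<Zcomp>\<^sub>2 id2 L) \<cdot> inv2 (assoc2 L R L) \<cdot> (id2 L \<Zcomp>\<^sub>2 Copy W) \<cdot> inv2 (runit2 L)
    = cap\<^sub>4 \<cdot> cup\<^sub>4"
proof -
  note CR = hcomp_cell[OF Compare_two_cell two_cell_facts(14)]
    and DR = hcomp_cell[OF two_cell_facts(14) Delete_two_cell]
    and CL = hcomp_cell[OF two_cell_facts(15) Compare_two_cell]
    and DL = hcomp_cell[OF Delete_two_cell two_cell_facts(15)]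
  note f = two_cell_facts
  show "lunit2 R \<cdot> (Compare W \<Zcomp>\<^sub>2 id2 R) \<cdot> inv2 (assoc2 R L R) \<cdot> (id2 R \<Zcomp>\<^sub>2 Create W) \<cdot> inv2 (runit2 R)
    = cap\<^sub>1 \<cdot> cup\<^sub>1"
    unfolding cap\<^sub>1_def cup\<^sub>1_def[symmetric]
      vcomp_assoc[OF cup_cells(1) vcomp_cell[OF f(11) CR] f(1)] vcomp_assoc[OF cup_cells(1) f(11) CR] ..
  show "runit2 R \<cdot> (id2 R \<Zcomp>\<^sub>2 Delete W) \<cdot> assoc2 R L R \<cdot> (Copy W \<Zcomp>\<^sub>2 id2 R) \<cdot> inv2 (lunit2 R)
    = cap\<^sub>2 \<cdot> cup\<^sub>2"
    unfolding cap\<^sub>2_def cup\<^sub>2_def[symmetric]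
      vcomp_assoc[OF cup_cells(2) vcomp_cell[OF f(9) DR] f(2)] vcomp_assoc[OF cup_cells(2) f(9) DR] ..
  show "runit2 L \<cdot> (id2 L \<Zcomp>\<^sub>2 Compare W) \<cdot> assoc2 L R L \<cdot> (Create W \<Zcomp>\<^sub>2 id2 L) \<cdot> inv2 (lunit2 L)
    = cap\<^sub>3 \<cdot> cup\<^sub>3"
    unfolding cap\<^sub>3_def cup\<^sub>3_def[symmetric]
      vcomp_assoc[OF cup_cells(3) vcomp_cell[OF f(10) CL] f(4)] vcomp_assoc[OF cup_cells(3) f(10) CL] ..
  show "lunit2 L \<cdot> (Delete W \<Zcomp>\<^sub>2 id2 L) \<cdot> inv2 (assoc2 L R L) \<cdot> (id2 L \<Zcomp>\<^sub>2 Copy W) \<cdot> inv2 (runit2 L)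
    = cap\<^sub>4 \<cdot> cup\<^sub>4"
    unfolding cap\<^sub>4_def cup\<^sub>4_def[symmetric]
      vcomp_assoc[OF cup_cells(4) vcomp_cell[OF f(12) DL] f(3)] vcomp_assoc[OF cup_cells(4) f(12) DL] ..
qed

lemma mult_cell: "two_cell 1 1 ((L \<Zcomp> R) \<Zcomp> (L \<Zcomp> R)) (L \<Zcomp> R) (witness_mult W)"
  unfolding witness_mult_def cap\<^sub>1_def[symmetric]
  by (rule vcomp_cell two_cell_facts hcomp_cell cap_cells)+

lemma spans_mult_source: "spans (ent ((L \<Zcomp> R) \<Zcomp> (L \<Zcomp> R)) (0, 0))
   {gen (L \<Zcomp> R) (L \<Zcomp> R) 0 0 0 (gen L R 0 0 j' y' x') (gen L R 0 0 j y x) |j' y' x' j y x.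
      j' < n \<and> in_R j' y' \<and> in_L j' x' \<and> j < n \<and> in_R j y \<and> in_L j x}" (is "spans _ ?S")
proof (rule spans_mono[OF spans_comp[OF LR_cell LR_cell zero_less_one zero_less_one]])
  show "spans (ent (L \<Zcomp> R) (0, j)) {gen L R 0 0 j y x |j y x. j < n \<and> in_R j y \<and> in_L j x}"
    "spans (ent (L \<Zcomp> R) (j, 0)) {gen L R 0 0 j y x |j y x. j < n \<and> in_R j y \<and> in_L j x}"
    if "j < 1" for j using spans_LR that by simp_all
  show "{gen (L \<Zcomp> R) (L \<Zcomp> R) 0 0 j v u |j v u. j < 1 \<and>
      v \<in> {gen L R 0 0 j y x |j y x. j < n \<and> in_R j y \<and> in_L j x} \<and>
      u \<in> {gen L R 0 0 j y x |j y x. j < n \<and> in_R j y \<and> in_L j x}} \<subseteq> ?S"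
    by fastforce
  show "?S \<subseteq> carrier (ent ((L \<Zcomp> R) \<Zcomp> (L \<Zcomp> R)) (0, 0))"
    by (auto intro!: gen_closed[OF LR_cell LR_cell] LR_closed)
qed

text \<open>When \<open>\<beta>\<close> makes \<open>L\<^sub>j\<close> the dual of \<open>R\<^sub>j\<close>, this is the composition of the rank-one operators
  \<open>r \<mapsto> \<beta>(x, r) y\<close> in the direct sum of the matrix algebras \<open>End(R\<^sub>j)\<close>.\<close>

lemma mat_mult:
  assumes j': "j' < n" "in_R j' y'" "in_L j' x'" and j: "j < n" "in_R j y" "in_L j x"
  shows "mat (witness_mult W) (0, 0)
      (gen (L \<Zcomp> R) (L \<Zcomp> R) 0 0 0 (gen L R 0 0 j' y' x') (gen L R 0 0 j y x)) =
    (if j' = j then \<beta> j x' y \<odot>\<^bsub>LR\<^esub> gen L R 0 0 j y' x else \<zero>\<^bsub>LR\<^esub>)"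
proof -
  let ?w = "gen L R 0 0 j' y' x'"
  have w: "?w \<in> carrier LR" by (rule LR_closed[OF j'])
  have g: "gen (L \<Zcomp> R) (L \<Zcomp> R) 0 0 0 ?w (gen L R 0 0 j y x) \<in> carrier (ent ((L \<Zcomp> R) \<Zcomp> (L \<Zcomp> R)) (0, 0))"
    by (rule gen_closed[OF LR_cell LR_cell]) (simp_all add: w LR_closed[OF j])
  have h: "gen R (L \<Zcomp> R) 0 j 0 ?w y \<in> carrier (ent (R \<Zcomp> (L \<Zcomp> R)) (0, j))"
    by (rule gen_closed[OF WR_cell LR_cell]) (simp_all add: w j)
  have 1: "mat (assoc2 L R (L \<Zcomp> R)) (0, 0) (gen (L \<Zcomp> R) (L \<Zcomp> R) 0 0 0 ?w (gen L R 0 0 j y x)) =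
    gen L (R \<Zcomp> (L \<Zcomp> R)) 0 0 j (gen R (L \<Zcomp> R) 0 j 0 ?w y) x"
    by (rule mat_assoc2[OF WL_cell WR_cell LR_cell]) (simp_all add: w j)
  have 2: "mat (id2 L \<Zcomp>\<^sub>2 cap\<^sub>1) (0, 0) (gen L (R \<Zcomp> (L \<Zcomp> R)) 0 0 j (gen R (L \<Zcomp> R) 0 j 0 ?w y) x) =
    gen L R 0 0 j (if j' = j then \<beta> j x' y \<odot>\<^bsub>HR j\<^esub> y' else \<zero>\<^bsub>HR j\<^esub>) x"
    using mat_hcomp[OF two_cell_facts(15) cap_cells(1) zero_less_one zero_less_one j(1) h j(3)]
    by (simp add: mat_id2[OF WL_cell] j mat_cap\<^sub>1[OF j(1,2) j'])
  have 3: "gen L R 0 0 j (if j' = j then \<beta> j x' y \<odot>\<^bsub>HR j\<^esub> y' else \<zero>\<^bsub>HR j\<^esub>) x =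
    (if j' = j then \<beta> j x' y \<odot>\<^bsub>LR\<^esub> gen L R 0 0 j y' x else \<zero>\<^bsub>LR\<^esub>)"
    using j' j gen_bilinear(3,5)[OF WL_cell WR_cell zero_less_one zero_less_one j(1)] by auto
  show ?thesis unfolding witness_mult_def cap\<^sub>1_def[symmetric]
    using mat_vcomp[OF two_cell_facts(13) zero_less_one zero_less_one g, of "id2 L \<Zcomp>\<^sub>2 cap\<^sub>1"]
    by (simp add: 1 2 3)
qed

text \<open>Products of two pure tensors span the source of the multiplication, and those of tensors from
  different summands vanish.\<close>

lemma commutative_iff: "witness_mult W \<cdot> sym2 (L \<Zcomp> R) (L \<Zcomp> R) = witness_mult W \<longleftrightarrow>
  (\<forall>j<n. \<forall>y y' x x'. in_R j y \<longrightarrow> in_R j y' \<longrightarrow> in_L j x \<longrightarrow> in_L j x' \<longrightarrow>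
     \<beta> j x' y \<odot>\<^bsub>LR\<^esub> gen L R 0 0 j y' x = \<beta> j x y' \<odot>\<^bsub>LR\<^esub> gen L R 0 0 j y x')"
  (is "_ \<longleftrightarrow> ?C")
proof -
  let ?m = "witness_mult W" and ?s = "sym2 (L \<Zcomp> R) (L \<Zcomp> R)"
  note s = sym2_cell[OF LR_cell LR_cell]
  have val: "mat (?m \<cdot> ?s) (0, 0) (gen (L \<Zcomp> R) (L \<Zcomp> R) 0 0 0 u v) =
      mat ?m (0, 0) (gen (L \<Zcomp> R) (L \<Zcomp> R) 0 0 0 v u)"
    if u: "u \<in> carrier LR" and v: "v \<in> carrier LR" for u v
    using mat_vcomp[OF s zero_less_one zero_less_one, of "gen (L \<Zcomp> R) (L \<Zcomp> R) 0 0 0 u v" ?m]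
      mat_sym2[OF LR_cell LR_cell v u] gen_closed[OF LR_cell LR_cell zero_less_one zero_less_one zero_less_one u v]
    by simp
  show ?thesis
  proof
    assume com: "?m \<cdot> ?s = ?m"
    show ?C
    proof (intro allI impI)
      fix j y y' x x' assume j: "j < n" and y: "in_R j y" "in_R j y'" and x: "in_L j x" "in_L j x'"
      show "\<beta> j x' y \<odot>\<^bsub>LR\<^esub> gen L R 0 0 j y' x =
        \<beta> j x y' \<odot>\<^bsub>LR\<^esub> gen L R 0 0 j y x'"
        using val[OF LR_closed[OF j y(2) x(2)] LR_closed[OF j y(1) x(1)], unfolded com]
          mat_mult[OF j y(2) x(2) j y(1) x(1)] mat_mult[OF j y(1) x(1) j y(2) x(2)] by simp
    qed
  next
    assume *: ?C
    have 00: "mat (?m \<cdot> ?s) (0, 0) = mat ?m (0, 0)"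
    proof (rule mat_eqI[OF vcomp_cell[OF s mult_cell] mult_cell zero_less_one zero_less_one spans_mult_source])
      fix g assume "g \<in> {gen (L \<Zcomp> R) (L \<Zcomp> R) 0 0 0 (gen L R 0 0 j' y' x') (gen L R 0 0 j y x) |j' y' x' j y x.
        j' < n \<and> in_R j' y' \<and> in_L j' x' \<and> j < n \<and> in_R j y \<and> in_L j x}"
      then obtain j' y' x' j y x where g: "g = gen (L \<Zcomp> R) (L \<Zcomp> R) 0 0 0 (gen L R 0 0 j' y' x') (gen L R 0 0 j y x)"
        and j': "j' < n" "in_R j' y'" "in_L j' x'" and j: "j < n" "in_R j y" "in_L j x" by blast
      show "mat (?m \<cdot> ?s) (0, 0) g = mat ?m (0, 0) g"
        unfolding g val[OF LR_closed[OF j'] LR_closed[OF j]] mat_mult[OF j' j] mat_mult[OF j j']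
        using * j' j by auto
    qed
    show "?m \<cdot> ?s = ?m"
      by (rule two_cell_eqI[OF vcomp_cell[OF s mult_cell] mult_cell]) (simp add: 00)
  qed
qed

end


section \<open>Witness frames\<close>

text \<open>A frame consists of unit vectors that span the entries of \<open>W\<^sub>L\<close> and \<open>W\<^sub>R\<close>, such that \<open>\<kappa> i\<close> and the
  components of \<open>\<eta>\<close> are their tensor products. The condition on \<open>\<kappa>\<close> comes first, because it alone
  determines the caps built from \<open>Compare\<close>. That is what is needed to derive the condition on
  \<open>\<eta>\<close> from a snake equation.\<close>

locale half_framed = witness_cells n W for n :: nat and W :: "('a, 'b) witness_data" +
  fixes a :: "nat \<Rightarrow> 'a" and b :: "nat \<Rightarrow> 'b"
  assumes a_closed: "i < n \<Longrightarrow> in_L i (a i)" and b_closed: "i < n \<Longrightarrow> in_R i (b i)"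
    and a_unit: "i < n \<Longrightarrow> ip (HL i) (a i) (a i) = 1"
    and b_unit: "i < n \<Longrightarrow> ip (HR i) (b i) (b i) = 1"
    and a_expand: "\<lbrakk>i < n; in_L i x\<rbrakk> \<Longrightarrow> x = ip (HL i) (a i) x \<odot>\<^bsub>HL i\<^esub> a i"
    and b_expand: "\<lbrakk>i < n; in_R i y\<rbrakk> \<Longrightarrow> y = ip (HR i) (b i) y \<odot>\<^bsub>HR i\<^esub> b i"
    and \<kappa>_eq: "i < n \<Longrightarrow> \<kappa> i = gen R L i i 0 (a i) (b i)"
begin

lemma \<beta>_eq: "\<lbrakk>i < n; in_L i x; in_R i y\<rbrakk> \<Longrightarrow> \<beta> i x y = ip (HL i) (a i) x * ip (HR i) (b i) y"
  by (simp add: \<beta>_def \<kappa>_eq ip_RL a_closed b_closed)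

lemma ip_expand_L:
  assumes "i < n" "in_L i x" "in_L i x'"
  shows "ip (HL i) x x' = ip (HL i) x (a i) * ip (HL i) (a i) x'"
  by (subst a_expand[OF assms(1,3)]) (simp add: fd_L assms a_closed)

lemma ip_expand_R:
  assumes "i < n" "in_R i y" "in_R i y'"
  shows "ip (HR i) y y' = ip (HR i) y (b i) * ip (HR i) (b i) y'"
  by (subst b_expand[OF assms(1,3)]) (simp add: fd_R assms b_closed)

lemma gen_expand:
  assumes "j < n" "in_R j y" "in_L j x"
  shows "gen L R 0 0 j y x = (ip (HR j) (b j) y * ip (HL j) (a j) x)
    \<odot>\<^bsub>LR\<^esub> gen L R 0 0 j (b j) (a j)"
proof -
  note bil = gen_bilinear(3,4)[OF WL_cell WR_cell zero_less_one zero_less_one assms(1)]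
  have "gen L R 0 0 j y x = gen L R 0 0 j (ip (HR j) (b j) y \<odot>\<^bsub>HR j\<^esub> b j)
      (ip (HL j) (a j) x \<odot>\<^bsub>HL j\<^esub> a j)"
    using a_expand[OF assms(1,3)] b_expand[OF assms(1,2)] by simp
  also have "\<dots> = (ip (HR j) (b j) y * ip (HL j) (a j) x)
    \<odot>\<^bsub>LR\<^esub> gen L R 0 0 j (b j) (a j)"
    using assms(1) by (simp add: bil a_closed b_closed fd_L fd_R smult_assoc_fd[OF fd_LR LR_closed]
        mult.commute)
  finally show ?thesis .
qed

text \<open>The vector \<open>\<eta>\<close> is a sum of pure tensors that is never written out: both sides below are linear
  in \<open>u\<close> and agree on pure tensors, so \<open>u\<close> can be \<open>\<eta>\<close>.\<close>

lemma cap\<^sub>1_left: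
  assumes l: "l < n" and r: "in_R l r" and u: "u \<in> carrier LR"
  shows "mat cap\<^sub>1 (0, l) (gen R (L \<Zcomp> R) 0 l 0 u r) =
    ip LR (gen L R 0 0 l (b l) (a l)) u \<odot>\<^bsub>HR l\<^esub> r" (is "?F u = ?G u")
proof (rule linear_eqI[OF fd_LR fd_R[OF l] spans_LR _ _ _ u])
  show "restrict ?F (carrier LR) \<in> lin_maps LR (HR l)"
    by (rule lin_chain[OF fd_LR gen_left_lin[OF WR_cell LR_cell zero_less_one l zero_less_one r]
          two_cellD(6)[OF cap_cells(1) zero_less_one l]])
  show "restrict ?G (carrier LR) \<in> lin_maps LR (HR l)"
    by (rule rank_one_lin[OF fd_LR fd_R[OF l] LR_closed[OF l b_closed[OF l] a_closed[OF l]] r])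
  fix g assume "g \<in> {gen L R 0 0 j y x |j y x. j < n \<and> in_R j y \<and> in_L j x}"
  then obtain j y x where g: "g = gen L R 0 0 j y x" and j: "j < n" "in_R j y" "in_L j x" by blast
  have "\<beta> l x r \<odot>\<^bsub>HR l\<^esub> y =
      (ip (HR l) (b l) y * ip (HL l) (a l) x) \<odot>\<^bsub>HR l\<^esub> r" if "j = l"
  proof (rule fd_hilbert_eqI[OF fd_R[OF l]])
    fix z assume z: "in_R l z"
    show "ip (HR l) z (\<beta> l x r \<odot>\<^bsub>HR l\<^esub> y) =
      ip (HR l) z ((ip (HR l) (b l) y * ip (HL l) (a l) x) \<odot>\<^bsub>HR l\<^esub> r)"
      using j that ip_expand_R[OF l z r] ip_expand_R[OF l z, of y]
      by (simp add: fd_R l r z \<beta>_eq)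
  qed (use j that l r in \<open>simp_all add: fd_R\<close>)
  then show "?F g = ?G g"
    using l r unfolding g mat_cap\<^sub>1[OF l r j] ip_LR[OF l b_closed[OF l] a_closed[OF l] j]
    by (auto simp: fd_R)
qed

lemma cap\<^sub>3_right:
  assumes i: "i < n" and x: "in_L i x" and u: "u \<in> carrier LR"
  shows "mat cap\<^sub>3 (i, 0) (gen (L \<Zcomp> R) L i 0 0 x u) =
    ip LR (gen L R 0 0 i (b i) (a i)) u \<odot>\<^bsub>HL i\<^esub> x" (is "?F u = ?G u")
proof (rule linear_eqI[OF fd_LR fd_L[OF i] spans_LR _ _ _ u])
  show "restrict ?F (carrier LR) \<in> lin_maps LR (HL i)"
    by (rule lin_chain[OF fd_LR gen_right_lin[OF LR_cell WL_cell i zero_less_one zero_less_one x]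
          two_cellD(6)[OF cap_cells(3) i zero_less_one]])
  show "restrict ?G (carrier LR) \<in> lin_maps LR (HL i)"
    by (rule rank_one_lin[OF fd_LR fd_L[OF i] LR_closed[OF i b_closed[OF i] a_closed[OF i]] x])
  fix g assume "g \<in> {gen L R 0 0 j y x |j y x. j < n \<and> in_R j y \<and> in_L j x}"
  then obtain j y x' where g: "g = gen L R 0 0 j y x'" and j: "j < n" "in_R j y" "in_L j x'" by blast
  have "\<beta> i x y \<odot>\<^bsub>HL i\<^esub> x' =
      (ip (HR i) (b i) y * ip (HL i) (a i) x') \<odot>\<^bsub>HL i\<^esub> x" if "j = i"
  proof (rule fd_hilbert_eqI[OF fd_L[OF i]])
    fix z assume z: "in_L i z"
    show "ip (HL i) z (\<beta> i x y \<odot>\<^bsub>HL i\<^esub> x') =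
      ip (HL i) z ((ip (HR i) (b i) y * ip (HL i) (a i) x') \<odot>\<^bsub>HL i\<^esub> x)"
      using j that ip_expand_L[OF i z x] ip_expand_L[OF i z, of x']
      by (simp add: fd_L i x z \<beta>_eq)
  qed (use j that i x in \<open>simp_all add: fd_L\<close>)
  then show "?F g = ?G g"
    using i x unfolding g mat_cap\<^sub>3[OF i x j] ip_LR[OF i b_closed[OF i] a_closed[OF i] j]
    by (auto simp: fd_L)
qed

end

locale framed = half_framed n W a b for n :: nat and W :: "('a, 'b) witness_data" and a b +
  assumes \<eta>_eq: "\<lbrakk>j < n; in_R j y; in_L j x\<rbrakk>
    \<Longrightarrow> \<eta> j (y, x) = ip (HR j) y (b j) * ip (HL j) x (a j)"
begin

lemma ip_\<eta>_LR:
  assumes "j < n" "in_R j y" "in_L j x"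
  shows "ip LR \<eta> (gen L R 0 0 j y x) =
    ip (HR j) (b j) y * ip (HL j) (a j) x"
proof -
  have "ip LR \<eta> (gen L R 0 0 j y x) =
    cnj (ip (HR j) y (b j) * ip (HL j) x (a j))"
    using ip_swap[OF fd_LR LR_closed[OF assms] \<eta>_closed] by (simp only: ip_LR_\<eta>[OF assms] \<eta>_eq[OF assms])
  then show ?thesis
    using assms ip_swap[OF fd_R[OF assms(1)] assms(2) b_closed] ip_swap[OF fd_L[OF assms(1)] assms(3) a_closed]
    by simp
qed

text \<open>The first and third composites reduce to the coefficient \<open>1\<close> of \<open>\<eta>\<close> at \<open>b j \<otimes> a j\<close>, the other two
  to the expansion of a vector in the frame.\<close>

lemma snake_identities:
  "cap\<^sub>1 \<cdot> cup\<^sub>1 = id2 R" "cap\<^sub>2 \<cdot> cup\<^sub>2 = id2 R" "cap\<^sub>3 \<cdot> cup\<^sub>3 = id2 L" "cap\<^sub>4 \<cdot> cup\<^sub>4 = id2 L"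
proof -
  have one: "ip LR (gen L R 0 0 l (b l) (a l)) \<eta> = 1" if "l < n" for l
    using that by (simp add: ip_LR_\<eta> \<eta>_eq a_closed b_closed a_unit b_unit)
  show "cap\<^sub>1 \<cdot> cup\<^sub>1 = id2 R"
  proof (rule two_cell_eqI[OF vcomp_cell[OF cup_cells(1) cap_cells(1)] two_cell_facts(14)])
    fix i l r assume il: "i < 1" "l < n" and r: "r \<in> carrier (ent R (i, l))"
    then show "mat (cap\<^sub>1 \<cdot> cup\<^sub>1) (i, l) r = mat (id2 R) (i, l) r"
      using mat_vcomp[OF cup_cells(1) il r, of cap\<^sub>1] cap\<^sub>1_left[OF il(2) _ \<eta>_closed, of r]
      by (simp add: mat_cup\<^sub>1 mat_id2[OF WR_cell] one fd_R)
  qed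
  show "cap\<^sub>2 \<cdot> cup\<^sub>2 = id2 R"
  proof (rule two_cell_eqI[OF vcomp_cell[OF cup_cells(2) cap_cells(2)] two_cell_facts(14)])
    fix i l r assume il: "i < 1" "l < n" and r: "r \<in> carrier (ent R (i, l))"
    then have r': "in_R l r" by simp
    have "mat (cap\<^sub>2 \<cdot> cup\<^sub>2) (i, l) r = ip (HR l) (b l) r \<odot>\<^bsub>HR l\<^esub> b l"
      using il mat_vcomp[OF cup_cells(2) il r, of cap\<^sub>2]
        mat_cap\<^sub>2[OF il(2) b_closed[OF il(2)] il(2) r' a_closed[OF il(2)]]
      by (simp add: mat_cup\<^sub>2 r' \<kappa>_eq ip_\<eta>_LR a_closed a_unit)
    then show "mat (cap\<^sub>2 \<cdot> cup\<^sub>2) (i, l) r = mat (id2 R) (i, l) r"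
      using b_expand[OF il(2) r'] il r' by (simp add: mat_id2[OF WR_cell])
  qed
  show "cap\<^sub>3 \<cdot> cup\<^sub>3 = id2 L"
  proof (rule two_cell_eqI[OF vcomp_cell[OF cup_cells(3) cap_cells(3)] two_cell_facts(15)])
    fix i l x assume il: "i < n" "l < 1" and x: "x \<in> carrier (ent L (i, l))"
    then show "mat (cap\<^sub>3 \<cdot> cup\<^sub>3) (i, l) x = mat (id2 L) (i, l) x"
      using mat_vcomp[OF cup_cells(3) il x, of cap\<^sub>3] cap\<^sub>3_right[OF il(1) _ \<eta>_closed, of x]
      by (simp add: mat_cup\<^sub>3 mat_id2[OF WL_cell] one fd_L)
  qed
  show "cap\<^sub>4 \<cdot> cup\<^sub>4 = id2 L"
  proof (rule two_cell_eqI[OF vcomp_cell[OF cup_cells(4) cap_cells(4)] two_cell_facts(15)])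
    fix i l x assume il: "i < n" "l < 1" and x: "x \<in> carrier (ent L (i, l))"
    then have x': "in_L i x" by simp
    have "mat (cap\<^sub>4 \<cdot> cup\<^sub>4) (i, l) x = ip (HL i) (a i) x \<odot>\<^bsub>HL i\<^esub> a i"
      using il mat_vcomp[OF cup_cells(4) il x, of cap\<^sub>4]
        mat_cap\<^sub>4[OF il(1) a_closed[OF il(1)] il(1) b_closed[OF il(1)] x']
      by (simp add: mat_cup\<^sub>4 x' \<kappa>_eq ip_\<eta>_LR b_closed b_unit)
    then show "mat (cap\<^sub>4 \<cdot> cup\<^sub>4) (i, l) x = mat (id2 L) (i, l) x"
      using a_expand[OF il(1) x'] il x' by (simp add: mat_id2[OF WL_cell])
  qed
qed

lemma Compare_Copy: "Compare W \<cdot> Copy W = id2 (id1 n)"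
proof (rule id1_source_eqI[OF vcomp_cell[OF Copy_two_cell Compare_two_cell] id2_cell[OF id1_cell]])
  fix i assume i: "i < n"
  have "mat (Compare W \<cdot> Copy W) (i, i) 1 = mat (Compare W) (i, i) (\<kappa> i)"
    using mat_vcomp[OF Copy_two_cell i i, of 1 "Compare W"] by (simp add: \<kappa>_def)
  also have "\<dots> = 1" using i mat_Compare[OF i i \<kappa>_closed[OF i]]
    by (simp add: \<kappa>_eq ip_RL a_closed b_closed a_unit b_unit)
  also have "\<dots> = mat (id2 (id1 n)) (i, i) 1" using mat_id2[OF id1_cell i i, of 1] by simp
  finally show "mat (Compare W \<cdot> Copy W) (i, i) 1 = mat (id2 (id1 n)) (i, i) 1" .
qed

lemma commutative: "witness_mult W \<cdot> sym2 (L \<Zcomp> R) (L \<Zcomp> R) = witness_mult W"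
  unfolding commutative_iff
proof (intro allI impI)
  fix j y y' x x' assume j: "j < n" and y: "in_R j y" "in_R j y'" and x: "in_L j x" "in_L j x'"
  show "\<beta> j x' y \<odot>\<^bsub>LR\<^esub> gen L R 0 0 j y' x = \<beta> j x y' \<odot>\<^bsub>LR\<^esub> gen L R 0 0 j y x'"
    unfolding \<beta>_eq[OF j x(2) y(1)] \<beta>_eq[OF j x(1) y(2)] gen_expand[OF j y(2) x(1)] gen_expand[OF j y(1) x(2)]
    using j by (simp add: smult_assoc_fd[OF fd_LR LR_closed] a_closed b_closed mult_ac)
qed

lemma witness: "witness n W"
  using WL_cell WR_cell Create_cell Delete_eq Copy_cell Compare_eq snakes snake_identities
    Compare_Copy commutative
  by (intro witness.intro) simp_all

end


section \<open>Every witness has a frame\<close>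

lemma unit_vector:
  assumes H: "fd_hilbert H" and x: "x \<in> carrier H" and nz: "x \<noteq> \<zero>\<^bsub>H\<^esub>"
  obtains v c where "v \<in> carrier H" "ip H v v = 1" "x = c \<odot>\<^bsub>H\<^esub> v"
proof
  define r where "r = Re (ip H x x)"
  have r: "0 < r" "ip H x x = complex_of_real r"
    using fd_hilbert.ip_pos[OF H x nz] ip_self_real[OF H x] by (simp_all add: r_def)
  let ?v = "complex_of_real (1 / sqrt r) \<odot>\<^bsub>H\<^esub> x"
  show "?v \<in> carrier H" using H x by simp
  show "ip H ?v ?v = 1" using r H x by (simp flip: of_real_mult)
  show "x = complex_of_real (sqrt r) \<odot>\<^bsub>H\<^esub> ?v"
    using r H x by (simp add: smult_assoc_fd flip: of_real_mult)
qed

context witness_cells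
begin

lemma \<beta>_smult: "\<lbrakk>i < n; in_L i x; in_R i y\<rbrakk> \<Longrightarrow>
    \<beta> i (c \<odot>\<^bsub>HL i\<^esub> x) (d \<odot>\<^bsub>HR i\<^esub> y) = c * d * \<beta> i x y"
  using gen_bilinear(3,4)[OF WR_cell WL_cell, of i i 0]
  by (simp add: \<beta>_def fd_L fd_R fd_RL RL_closed \<kappa>_closed)

lemma \<beta>_nonzero:
  assumes i: "i < n" and \<kappa>: "\<kappa> i \<noteq> \<zero>\<^bsub>ent (R \<Zcomp> L) (i, i)\<^esub>"
  obtains x y where "in_L i x" "in_R i y" "ip (HL i) x x = 1" "ip (HR i) y y = 1"
    "\<beta> i x y \<noteq> 0"
proof -
  note fd = fd_RL[OF i i]
  have "\<exists>x y. in_L i x \<and> in_R i y \<and> \<beta> i x y \<noteq> 0"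
  proof (rule ccontr)
    assume "\<nexists>x y. in_L i x \<and> in_R i y \<and> \<beta> i x y \<noteq> 0"
    then have 0: "\<beta> i x y = 0" if "in_L i x" "in_R i y" for x y using that by blast
    have "\<kappa> i = \<zero>\<^bsub>ent (R \<Zcomp> L) (i, i)\<^esub>"
    proof (rule comp_eqI[OF WR_cell WL_cell i i \<kappa>_closed[OF i] fd_zero_closed[OF fd]])
      fix j x y assume "j < (1::nat)" and xy: "x \<in> carrier (ent L (i, j))" "y \<in> carrier (ent R (j, i))"
      then have j: "j = 0" by simp
      note xy = xy[unfolded j]
      note g = ip_gen[OF WR_cell WL_cell i i zero_less_one xy]
      have "\<kappa> i 0 (x, y) = cnj (\<beta> i x y)"
        using g[OF \<kappa>_closed[OF i]] ip_swap[OF fd \<kappa>_closed[OF i] RL_closed[OF i i xy]]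
        by (simp only: \<beta>_def)
      moreover have "\<zero>\<^bsub>ent (R \<Zcomp> L) (i, i)\<^esub> 0 (x, y) = 0"
        using g[OF fd_zero_closed[OF fd]] ip_zero_right[OF fd RL_closed[OF i i xy]] by simp
      ultimately show "\<kappa> i j (x, y) = \<zero>\<^bsub>ent (R \<Zcomp> L) (i, i)\<^esub> j (x, y)"
        using 0[OF xy] j by simp
    qed
    then show False using \<kappa> by simp
  qed
  then obtain x y where xy: "in_L i x" "in_R i y" "\<beta> i x y \<noteq> 0" by blast
  note bil = gen_bilinear(5,6)[OF WR_cell WL_cell i i zero_less_one]
  have "x \<noteq> \<zero>\<^bsub>HL i\<^esub>" "y \<noteq> \<zero>\<^bsub>HR i\<^esub>"
    using xy bil ip_zero_right[OF fd \<kappa>_closed[OF i]] by (auto simp: \<beta>_def)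
  then obtain v c w d where v: "in_L i v" "ip (HL i) v v = 1" "x = c \<odot>\<^bsub>HL i\<^esub> v"
    and w: "in_R i w" "ip (HR i) w w = 1" "y = d \<odot>\<^bsub>HR i\<^esub> w"
    using unit_vector[OF fd_L[OF i] xy(1)] unit_vector[OF fd_R[OF i] xy(2)] by metis
  have "\<beta> i v w \<noteq> 0" using xy(3) \<beta>_smult[OF i v(1) w(1)] v(3) w(3) by auto
  then show ?thesis using v w that by blast
qed

end

text \<open>In the \<open>j\<close>-th summand the multiplication sends \<open>(y' \<otimes> x') \<otimes> (y \<otimes> x)\<close> to \<open>\<beta>(x', y) y' \<otimes> x\<close>. When it is commutative,
  fixing \<open>x'\<close> and \<open>y\<close> with \<open>\<beta>(x', y) \<noteq> 0\<close> makes every \<open>y' \<otimes> x\<close> a multiple of \<open>y \<otimes> x'\<close>. This makes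
  the entries one-dimensional, with \<open>\<kappa>\<close> a unit multiple of a pure tensor of unit vectors. The
  coefficients of \<open>\<eta>\<close> then follow from the first snake equation.\<close>

lemma witness_has_frame:
  assumes W: "witness n W"
  obtains a b where "framed n W a b"
proof -
  interpret w: witness n W by fact
  interpret witness_cells n W
    by (intro witness_cells.intro w.WL_cell w.WR_cell w.Create_cell w.Delete_eq w.Copy_cell w.Compare_eq)
  let ?frame = "\<lambda>i a b. in_L i a \<and> in_R i b \<and> ip (HL i) a a = 1 \<and> ip (HR i) b b = 1 \<and>
    (\<forall>x. in_L i x \<longrightarrow> x = ip (HL i) a x \<odot>\<^bsub>HL i\<^esub> a) \<and>
    (\<forall>y. in_R i y \<longrightarrow> y = ip (HR i) b y \<odot>\<^bsub>HR i\<^esub> b) \<and> \<kappa> i = gen R L i i 0 a b"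
  have "\<exists>a b. ?frame i a b" if i: "i < n" for i
  proof -
    note fd = fd_L[OF i] fd_R[OF i] fd_RL[OF i i]
    have "mat (Compare W) (i, i) (\<kappa> i) = 1"
      using mat_vcomp[OF Copy_two_cell i i, of 1 "Compare W"] mat_id2[OF id1_cell i i, of 1]
      by (simp add: w.Compare_Copy \<kappa>_def)
    then have \<kappa>1: "ip (ent (R \<Zcomp> L) (i, i)) (\<kappa> i) (\<kappa> i) = 1"
      using mat_Compare[OF i i \<kappa>_closed[OF i]] by simp
    then have "\<kappa> i \<noteq> \<zero>\<^bsub>ent (R \<Zcomp> L) (i, i)\<^esub>" using fd by auto
    from \<beta>_nonzero[OF i this] obtain a b where a: "in_L i a" "ip (HL i) a a = 1"
      and b: "in_R i b" "ip (HR i) b b = 1" and nz: "\<beta> i a b \<noteq> 0" by metis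
    have rel: "\<beta> i a b * (ip (HR i) z y * ip (HL i) w x) =
      \<beta> i x y * (ip (HR i) z b * ip (HL i) w a)"
      if "in_R i z" "in_R i y" "in_L i w" "in_L i x" for z y w x
    proof -
      have "\<beta> i a b \<odot>\<^bsub>LR\<^esub> gen L R 0 0 i y x =
        \<beta> i x y \<odot>\<^bsub>LR\<^esub> gen L R 0 0 i b a"
        using w.commutative[unfolded commutative_iff] i that a b by blast
      from arg_cong[OF this, of "ip LR (gen L R 0 0 i z w)"]
      show ?thesis using that i a b by (simp add: fd_LR LR_closed ip_LR)
    qed
    have \<beta>: "\<beta> i x y = \<beta> i a b * (ip (HR i) b y * ip (HL i) a x)"
      if "in_R i y" "in_L i x" for x y
      using rel[OF b(1) that(1) a(1) that(2)] a b by simp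
    have xa: "ip (HL i) w x = ip (HL i) a x * ip (HL i) w a"
      if "in_L i w" "in_L i x" for w x
      using rel[OF b(1) b(1) that] \<beta>[OF b(1) that(2)] nz b by simp
    have yb: "ip (HR i) z y = ip (HR i) b y * ip (HR i) z b"
      if "in_R i z" "in_R i y" for z y
      using rel[OF that a(1) a(1)] \<beta>[OF that(2) a(1)] nz a by simp
    have xa': "x = ip (HL i) a x \<odot>\<^bsub>HL i\<^esub> a" if "in_L i x" for x
    proof (rule fd_hilbert_eqI[OF fd(1) that])
      show "ip (HL i) z x = ip (HL i) z (ip (HL i) a x \<odot>\<^bsub>HL i\<^esub> a)"
        if z: "in_L i z" for z
        unfolding ip_smult_right[OF fd(1) z a(1)] by (rule xa[OF z \<open>in_L i x\<close>])
    qed (simp add: fd a)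
    have yb': "y = ip (HR i) b y \<odot>\<^bsub>HR i\<^esub> b" if "in_R i y" for y
    proof (rule fd_hilbert_eqI[OF fd(2) that])
      show "ip (HR i) z y = ip (HR i) z (ip (HR i) b y \<odot>\<^bsub>HR i\<^esub> b)"
        if z: "in_R i z" for z
        unfolding ip_smult_right[OF fd(2) z b(1)] by (rule yb[OF z \<open>in_R i y\<close>])
    qed (simp add: fd b)
    \<comment> \<open>The phase that \<open>\<kappa> i\<close> leaves over is absorbed into the first vector.\<close>
    let ?c = "cnj (\<beta> i a b)"
    have ab: "gen R L i i 0 a b \<in> carrier (ent (R \<Zcomp> L) (i, i))" by (rule RL_closed[OF i i a(1) b(1)])
    have \<kappa>: "\<kappa> i = ?c \<odot>\<^bsub>ent (R \<Zcomp> L) (i, i)\<^esub> gen R L i i 0 a b"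
    proof (rule comp_eqI[OF WR_cell WL_cell i i \<kappa>_closed[OF i] fd_smult_closed[OF fd(3) ab]])
      fix j x y assume "j < (1::nat)" and xy: "x \<in> carrier (ent L (i, j))" "y \<in> carrier (ent R (j, i))"
      then have j: "j = 0" by simp
      note xy = xy[unfolded j]
      note g = ip_gen[OF WR_cell WL_cell i i zero_less_one xy]
      have "\<kappa> i 0 (x, y) = cnj (\<beta> i x y)"
        using g[OF \<kappa>_closed[OF i]] ip_swap[OF fd(3) \<kappa>_closed[OF i] RL_closed[OF i i xy]]
        by (simp only: \<beta>_def)
      also have "\<dots> = ?c * (ip (HL i) x a * ip (HR i) y b)"
        using \<beta>[OF xy(2,1)] ip_swap[OF fd(1) a(1) xy(1)] ip_swap[OF fd(2) b(1) xy(2)] by simp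
      also have "\<dots> = (?c \<odot>\<^bsub>ent (R \<Zcomp> L) (i, i)\<^esub> gen R L i i 0 a b) 0 (x, y)"
        using g[OF fd_smult_closed[OF fd(3) ab]] RL_closed[OF i i xy] ab i xy a b
        by (simp add: fd ip_RL)
      finally show "\<kappa> i j (x, y) = (?c \<odot>\<^bsub>ent (R \<Zcomp> L) (i, i)\<^esub> gen R L i i 0 a b) j (x, y)"
        using j by simp
    qed
    have c1: "?c * cnj ?c = 1"
      using \<kappa>1 unfolding \<kappa> using i a b ab by (simp add: fd ip_RL mult_ac)
    let ?a = "?c \<odot>\<^bsub>HL i\<^esub> a"
    have "in_L i ?a" "ip (HL i) ?a ?a = 1" "\<kappa> i = gen R L i i 0 ?a b"
      using \<kappa> c1 a b i gen_bilinear(3)[OF WR_cell WL_cell i i zero_less_one a(1) b(1)]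
      by (simp_all add: fd mult_ac)
    moreover have "x = ip (HL i) ?a x \<odot>\<^bsub>HL i\<^esub> ?a" if "in_L i x" for x
    proof -
      have "ip (HL i) ?a x \<odot>\<^bsub>HL i\<^esub> ?a =
        (?c * cnj ?c * ip (HL i) a x) \<odot>\<^bsub>HL i\<^esub> a"
        using that a fd by (simp add: smult_assoc_fd mult_ac)
      then show ?thesis using xa'[OF that] c1 by simp
    qed
    ultimately show ?thesis using b yb' by blast
  qed
  then obtain a b where ab: "\<And>i. i < n \<Longrightarrow> ?frame i (a i) (b i)" by metis
  interpret half_framed n W a b
    by unfold_locales (use ab in blast)+
  have "framed n W a b"
  proof
    fix j y x assume j: "j < n" and y: "in_R j y" and x: "in_L j x"
    note bj = b_closed[OF j] and aj = a_closed[OF j]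
    let ?g = "gen L R 0 0 j (b j) (a j)"
    have "mat (cap\<^sub>1 \<cdot> cup\<^sub>1) (0, j) (b j) = b j"
      using w.snake1 mat_id2[OF WR_cell zero_less_one j bj] unfolding snakes(1) by simp
    then have "ip LR ?g \<eta> \<odot>\<^bsub>HR j\<^esub> b j = b j"
      using mat_vcomp[OF cup_cells(1) zero_less_one j bj, of cap\<^sub>1] mat_cup\<^sub>1[OF j bj]
        cap\<^sub>1_left[OF j bj \<eta>_closed] by simp
    from arg_cong[OF this, of "ip (HR j) (b j)"]
    have 1: "ip LR ?g \<eta> = 1"
      using bj by (simp add: fd_R[OF j] b_unit[OF j])
    have "\<eta> j (y, x) = ip LR (gen L R 0 0 j y x) \<eta>"
      by (rule ip_LR_\<eta>[OF j y x, symmetric])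
    also have "\<dots> = cnj (ip (HR j) (b j) y * ip (HL j) (a j) x)"
      unfolding gen_expand[OF j y x]
      using ip_smult_left[OF fd_LR \<eta>_closed LR_closed[OF j bj aj]] 1 by simp
    also have "\<dots> = ip (HR j) y (b j) * ip (HL j) x (a j)"
      using ip_swap[OF fd_R[OF j] bj y] ip_swap[OF fd_L[OF j] aj x] by simp
    finally show "\<eta> j (y, x) = ip (HR j) y (b j) * ip (HL j) x (a j)" .
  qed
  then show ?thesis by (rule that)
qed


section \<open>Uniqueness\<close>

text \<open>The 2-cell with entries \<open>|w\<rangle>\<langle>v|\<close>, which sends the unit vector \<open>v p\<close> to \<open>w p\<close>.\<close>

definition transport :: "'a cell1 \<Rightarrow> 'b cell1 \<Rightarrow> (nat \<times> nat \<Rightarrow> 'a) \<Rightarrow> (nat \<times> nat \<Rightarrow> 'b) \<Rightarrow> ('a, 'b) cell2"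
  where "transport X Y v w = \<lparr>src2 = X, tgt2 = Y,
    mat = (\<lambda>p\<in>idx X. \<lambda>x\<in>carrier (ent X p). ip (ent X p) (v p) x \<odot>\<^bsub>ent Y p\<^esub> w p)\<rparr>"

context
  fixes X :: "'a cell1" and Y :: "'b cell1" and n m :: nat and v w
  assumes X: "is_cell1 n m X" and Y: "is_cell1 n m Y"
    and v: "\<And>i l. \<lbrakk>i < m; l < n\<rbrakk> \<Longrightarrow> v (i, l) \<in> carrier (ent X (i, l))"
    and w: "\<And>i l. \<lbrakk>i < m; l < n\<rbrakk> \<Longrightarrow> w (i, l) \<in> carrier (ent Y (i, l))"
begin

lemma mat_transport: "\<lbrakk>i < m; l < n; x \<in> carrier (ent X (i, l))\<rbrakk> \<Longrightarrow>
    mat (transport X Y v w) (i, l) x = ip (ent X (i, l)) (v (i, l)) x \<odot>\<^bsub>ent Y (i, l)\<^esub> w (i, l)"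
  using cell1_dims[OF X] by (simp add: transport_def idx_def)

lemma transport_cell: "two_cell n m X Y (transport X Y v w)"
proof (rule two_cellI[OF X Y])
  fix i l assume il: "i < m" "l < n"
  have "mat (transport X Y v w) (i, l) =
    (\<lambda>x\<in>carrier (ent X (i, l)). ip (ent X (i, l)) (v (i, l)) x \<odot>\<^bsub>ent Y (i, l)\<^esub> w (i, l))"
    using cell1_dims[OF X] il by (simp add: transport_def idx_def)
  then show "mat (transport X Y v w) (i, l) \<in> lin_maps (ent X (i, l)) (ent Y (i, l))"
    using rank_one_lin[OF cell1_fd[OF X il] cell1_fd[OF Y il] v[OF il] w[OF il]] by simp
qed (auto simp: transport_def)

end

lemma transport_unitary:
  assumes X: "is_cell1 n m X" and Y: "is_cell1 n m Y"
    and v: "\<And>i l. \<lbrakk>i < m; l < n\<rbrakk> \<Longrightarrow> v (i, l) \<in> carrier (ent X (i, l))"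
      "\<And>i l. \<lbrakk>i < m; l < n\<rbrakk> \<Longrightarrow> ip (ent X (i, l)) (v (i, l)) (v (i, l)) = 1"
      "\<And>i l x. \<lbrakk>i < m; l < n; x \<in> carrier (ent X (i, l))\<rbrakk> \<Longrightarrow>
        x = ip (ent X (i, l)) (v (i, l)) x \<odot>\<^bsub>ent X (i, l)\<^esub> v (i, l)"
    and w: "\<And>i l. \<lbrakk>i < m; l < n\<rbrakk> \<Longrightarrow> w (i, l) \<in> carrier (ent Y (i, l))"
      "\<And>i l. \<lbrakk>i < m; l < n\<rbrakk> \<Longrightarrow> ip (ent Y (i, l)) (w (i, l)) (w (i, l)) = 1"
      "\<And>i l y. \<lbrakk>i < m; l < n; y \<in> carrier (ent Y (i, l))\<rbrakk> \<Longrightarrow>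
        y = ip (ent Y (i, l)) (w (i, l)) y \<odot>\<^bsub>ent Y (i, l)\<^esub> w (i, l)"
  shows "unitary2 (transport X Y v w)"
proof -
  let ?T = "transport X Y v w" and ?U = "transport Y X w v"
  note T = transport_cell[OF X Y, of v w, OF v(1) w(1)]
    and U = transport_cell[OF Y X, of w v, OF w(1) v(1)]
  note mT = mat_transport[OF X Y, of v w, OF v(1) w(1)]
    and mU = mat_transport[OF Y X, of w v, OF w(1) v(1)]
  have dT: "?U = dagger ?T"
  proof (rule dagger_eqI[OF T])
    show "mat ?U \<in> extensional (idx X)"
      using cell1_dims[OF X] cell1_dims[OF Y] by (simp add: transport_def idx_def)
    fix i l assume il: "i < m" "l < n"
    note fd = cell1_fd[OF X il] cell1_fd[OF Y il]
    show "mat ?U (i, l) \<in> extensional (carrier (ent Y (i, l)))"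
      using cell1_dims[OF Y] il by (simp add: transport_def idx_def)
    fix y assume y: "y \<in> carrier (ent Y (i, l))"
    show "mat ?U (i, l) y \<in> carrier (ent X (i, l))" by (rule two_cellD(7)[OF U il y])
    fix z assume z: "z \<in> carrier (ent X (i, l))"
    show "ip (ent X (i, l)) z (mat ?U (i, l) y) = ip (ent Y (i, l)) (mat ?T (i, l) z) y"
      using ip_swap[OF fd(1) v(1)[OF il] z] il y z by (simp add: mT mU fd v(1) w(1))
  qed (simp_all add: transport_def)
  have "?U \<cdot> ?T = id2 X"
  proof (rule two_cell_eqI[OF vcomp_cell[OF T U] id2_cell[OF X]])
    fix i l x assume *: "i < m" "l < n" "x \<in> carrier (ent X (i, l))"
    note fd = cell1_fd[OF X *(1,2)] cell1_fd[OF Y *(1,2)]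
    have "mat (?U \<cdot> ?T) (i, l) x = ip (ent X (i, l)) (v (i, l)) x \<odot>\<^bsub>ent X (i, l)\<^esub> v (i, l)"
      using * by (simp add: mat_vcomp[OF T] mT mU fd v(1) w(1,2))
    then show "mat (?U \<cdot> ?T) (i, l) x = mat (id2 X) (i, l) x"
      using v(3)[OF *] mat_id2[OF X *] by simp
  qed
  moreover have "?T \<cdot> ?U = id2 Y"
  proof (rule two_cell_eqI[OF vcomp_cell[OF U T] id2_cell[OF Y]])
    fix i l y assume *: "i < m" "l < n" "y \<in> carrier (ent Y (i, l))"
    note fd = cell1_fd[OF X *(1,2)] cell1_fd[OF Y *(1,2)]
    have "mat (?T \<cdot> ?U) (i, l) y = ip (ent Y (i, l)) (w (i, l)) y \<odot>\<^bsub>ent Y (i, l)\<^esub> w (i, l)"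
      using * by (simp add: mat_vcomp[OF U] mT mU fd w(1) v(1,2))
    then show "mat (?T \<cdot> ?U) (i, l) y = mat (id2 Y) (i, l) y"
      using w(3)[OF *] mat_id2[OF Y *] by simp
  qed
  ultimately show ?thesis
    using dT two_cellD(4,5)[OF T] by (simp add: unitary2_def)
qed

text \<open>The maps \<open>a i \<mapsto> a' i\<close> and \<open>b i \<mapsto> b' i\<close> carry one witness to the other, as all structure is
  expressed in terms of the frames.\<close>

lemma frames_isomorphic:
  assumes "framed n W a b" and "framed n W' a' b'"
  shows "unitarily_isomorphic W W'"
proof -
  interpret A: framed n W a b by fact
  interpret B: framed n W' a' b' by fact
  define \<phi> where "\<phi> = transport (WL W) (WL W') (\<lambda>(i, l). a i) (\<lambda>(i, l). a' i)"
  define \<psi> where "\<psi> = transport (WR W) (WR W') (\<lambda>(i, l). b l) (\<lambda>(i, l). b' l)"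
  have \<phi>: "two_cell 1 n (WL W) (WL W') \<phi>" unfolding \<phi>_def
    by (rule transport_cell[OF A.WL_cell B.WL_cell]) (simp_all add: A.a_closed B.a_closed)
  have \<psi>: "two_cell n 1 (WR W) (WR W') \<psi>" unfolding \<psi>_def
    by (rule transport_cell[OF A.WR_cell B.WR_cell]) (simp_all add: A.b_closed B.b_closed)
  have m\<phi>: "mat \<phi> (i, 0) x = ip (A.HL i) (a i) x \<odot>\<^bsub>B.HL i\<^esub> a' i"
    if "i < n" "A.in_L i x" for i x
    using that mat_transport[OF A.WL_cell B.WL_cell, of "\<lambda>(i, l). a i" "\<lambda>(i, l). a' i" i 0 x]
    by (simp add: \<phi>_def A.a_closed B.a_closed)
  have m\<psi>: "mat \<psi> (0, i) y = ip (A.HR i) (b i) y \<odot>\<^bsub>B.HR i\<^esub> b' i"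
    if "i < n" "A.in_R i y" for i y
    using that mat_transport[OF A.WR_cell B.WR_cell, of "\<lambda>(i, l). b l" "\<lambda>(i, l). b' l" 0 i y]
    by (simp add: \<psi>_def A.b_closed B.b_closed)
  have uni: "unitary2 \<phi>" "unitary2 \<psi>" unfolding \<phi>_def \<psi>_def
    by (rule transport_unitary[OF A.WL_cell B.WL_cell] transport_unitary[OF A.WR_cell B.WR_cell];
        simp add: A.a_closed B.a_closed A.a_unit B.a_unit A.b_closed B.b_closed A.b_unit B.b_unit
          flip: A.a_expand B.a_expand A.b_expand B.b_expand)+
  note \<phi>\<psi> = hcomp_cell[OF \<phi> \<psi>] and \<psi>\<phi> = hcomp_cell[OF \<psi> \<phi>]
  note closed = A.a_closed B.a_closed A.b_closed B.b_closed
  note fd = A.fd_L A.fd_R B.fd_L B.fd_R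
  have m\<phi>\<psi>: "mat (\<phi> \<Zcomp>\<^sub>2 \<psi>) (0, 0) (gen (WL W) (WR W) 0 0 j y x) =
    gen (WL W') (WR W') 0 0 j (mat \<psi> (0, j) y) (mat \<phi> (j, 0) x)"
    if "j < n" "A.in_R j y" "A.in_L j x" for j y x
    by (rule mat_hcomp[OF \<phi> \<psi>]) (use that in simp_all)
  have m\<psi>\<phi>: "mat (\<psi> \<Zcomp>\<^sub>2 \<phi>) (i, l) (gen (WR W) (WL W) i l 0 x y) =
    gen (WR W') (WL W') i l 0 (mat \<phi> (i, 0) x) (mat \<psi> (0, l) y)"
    if "i < n" "l < n" "A.in_L i x" "A.in_R l y" for i l x y
    by (rule mat_hcomp[OF \<psi> \<phi>]) (use that in simp_all)
  have \<phi>c: "B.in_L i (mat \<phi> (i, 0) x)" if "i < n" "A.in_L i x" for i x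
    using two_cellD(7)[OF \<phi> that(1) zero_less_one that(2)] .
  have \<psi>c: "B.in_R i (mat \<psi> (0, i) y)" if "i < n" "A.in_R i y" for i y
    using two_cellD(7)[OF \<psi> zero_less_one that(1,2)] .
  have "(\<phi> \<Zcomp>\<^sub>2 \<psi>) \<cdot> Create W = Create W'"
  proof (rule id1_source_eqI[OF vcomp_cell[OF A.Create_two_cell \<phi>\<psi>] B.Create_two_cell])
    fix i :: nat assume "i < 1"
    then have i: "i = 0" by simp
    note z = zero_less_one zero_less_one
    have E: "mat (\<phi> \<Zcomp>\<^sub>2 \<psi>) (0, 0) A.\<eta> \<in> carrier B.LR"
      using two_cellD(7)[OF \<phi>\<psi> z A.\<eta>_closed] .
    have "mat (\<phi> \<Zcomp>\<^sub>2 \<psi>) (0, 0) A.\<eta> = B.\<eta>"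
    proof (rule comp_eqI[OF B.WL_cell B.WR_cell z E B.\<eta>_closed])
      fix j y x assume j: "j < n" and y: "B.in_R j y" and x: "B.in_L j x"
      let ?g = "gen (WL W') (WR W') 0 0 j y x"
      let ?c = "ip (B.HR j) y (b' j) * ip (B.HL j) x (a' j)"
      \<comment> \<open>Both sides are scalars. They are written as multiples of vectors of \<open>\<complex>\<close> so that they are
        values of linear maps of rank one.\<close>
      let ?F = "\<lambda>u. ip B.LR ?g (mat (\<phi> \<Zcomp>\<^sub>2 \<psi>) (0, 0) u) \<odot>\<^bsub>scalar_hilb\<^esub> 1"
      let ?G = "\<lambda>u. ip A.LR (gen (WL W) (WR W) 0 0 j (b j) (a j)) u \<odot>\<^bsub>scalar_hilb\<^esub> ?c"
      have "?F u = ?G u" if u: "u \<in> carrier A.LR" for u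
      proof (rule linear_eqI[OF A.fd_LR fd_scalar_hilb A.spans_LR _ _ _ u])
        let ?r = "\<lambda>v\<in>carrier B.LR. ip B.LR ?g v \<odot>\<^bsub>scalar_hilb\<^esub> 1"
        have r: "?r \<in> lin_maps B.LR scalar_hilb"
          by (rule rank_one_lin[OF B.fd_LR fd_scalar_hilb B.LR_closed[OF j y x]]) simp
        have "compose (carrier A.LR) ?r (mat (\<phi> \<Zcomp>\<^sub>2 \<psi>) (0, 0)) = restrict ?F (carrier A.LR)"
          unfolding compose_def by (rule restrict_ext) (use two_cellD(7)[OF \<phi>\<psi> z] in simp)
        with compose_lin[OF A.fd_LR two_cellD(6)[OF \<phi>\<psi> z] r]
        show "restrict ?F (carrier A.LR) \<in> lin_maps A.LR scalar_hilb" by simp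
        show "restrict ?G (carrier A.LR) \<in> lin_maps A.LR scalar_hilb"
          by (rule rank_one_lin[OF A.fd_LR fd_scalar_hilb A.LR_closed]) (simp_all add: j closed)
        fix h assume "h \<in> {gen (WL W) (WR W) 0 0 j y x |j y x. j < n \<and> A.in_R j y \<and> A.in_L j x}"
        then obtain k s t where h: "h = gen (WL W) (WR W) 0 0 k s t"
          and k: "k < n" "A.in_R k s" "A.in_L k t" by blast
        show "?F h = ?G h"
          unfolding h m\<phi>\<psi>[OF k] B.ip_LR[OF j y x k(1) \<psi>c[OF k(1,2)] \<phi>c[OF k(1,3)]]
            A.ip_LR[OF j A.b_closed[OF j] A.a_closed[OF j] k]
          using j y x k by (auto simp: m\<phi> m\<psi> closed fd)
      qed
      from this[OF A.\<eta>_closed] have "ip B.LR ?g (mat (\<phi> \<Zcomp>\<^sub>2 \<psi>) (0, 0) A.\<eta>) = ?c"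
        using A.ip_LR_\<eta>[OF j A.b_closed[OF j] A.a_closed[OF j]]
          A.\<eta>_eq[OF j A.b_closed[OF j] A.a_closed[OF j]] j by (simp add: A.a_unit A.b_unit)
      then show "mat (\<phi> \<Zcomp>\<^sub>2 \<psi>) (0, 0) A.\<eta> j (y, x) = B.\<eta> j (y, x)"
        unfolding B.\<eta>_eq[OF j y x] ip_gen[OF B.WL_cell B.WR_cell z j y x E] .
    qed
    then show "mat ((\<phi> \<Zcomp>\<^sub>2 \<psi>) \<cdot> Create W) (i, i) 1 = mat (Create W') (i, i) 1"
      unfolding i using mat_vcomp[OF A.Create_two_cell z, of 1 "\<phi> \<Zcomp>\<^sub>2 \<psi>"]
      by (simp add: A.\<eta>_def B.\<eta>_def)
  qed
  moreover have "Delete W = Delete W' \<cdot> (\<phi> \<Zcomp>\<^sub>2 \<psi>)"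
  proof -
    note D = vcomp_cell[OF \<phi>\<psi> B.Delete_two_cell]
    note z = zero_less_one zero_less_one
    have "mat (Delete W) (0, 0) = mat (Delete W' \<cdot> (\<phi> \<Zcomp>\<^sub>2 \<psi>)) (0, 0)"
    proof (rule mat_eqI[OF A.Delete_two_cell D z A.spans_LR])
      fix g assume "g \<in> {gen (WL W) (WR W) 0 0 j y x |j y x. j < n \<and> A.in_R j y \<and> A.in_L j x}"
      then obtain j y x where g: "g = gen (WL W) (WR W) 0 0 j y x"
        and j: "j < n" "A.in_R j y" "A.in_L j x" by blast
      note c = \<psi>c[OF j(1,2)] \<phi>c[OF j(1,3)]
      show "mat (Delete W) (0, 0) g = mat (Delete W' \<cdot> (\<phi> \<Zcomp>\<^sub>2 \<psi>)) (0, 0) g"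
        unfolding g mat_vcomp[OF \<phi>\<psi> z A.LR_closed[OF j]] m\<phi>\<psi>[OF j] A.mat_Delete[OF A.LR_closed[OF j]]
          B.mat_Delete[OF B.LR_closed[OF j(1) c]] A.ip_\<eta>_LR[OF j] B.ip_\<eta>_LR[OF j(1) c]
        using j by (simp add: m\<phi> m\<psi> closed fd B.a_unit B.b_unit)
    qed
    then show ?thesis by (intro two_cell_eqI[OF A.Delete_two_cell D]) simp
  qed
  moreover have "(\<psi> \<Zcomp>\<^sub>2 \<phi>) \<cdot> Copy W = Copy W'"
  proof (rule id1_source_eqI[OF vcomp_cell[OF A.Copy_two_cell \<psi>\<phi>] B.Copy_two_cell])
    fix i assume i: "i < n"
    have "mat ((\<psi> \<Zcomp>\<^sub>2 \<phi>) \<cdot> Copy W) (i, i) 1 = mat (\<psi> \<Zcomp>\<^sub>2 \<phi>) (i, i) (A.\<kappa> i)"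
      using mat_vcomp[OF A.Copy_two_cell i i, of 1 "\<psi> \<Zcomp>\<^sub>2 \<phi>"] by (simp add: A.\<kappa>_def)
    also have "\<dots> = B.\<kappa> i"
      unfolding A.\<kappa>_eq[OF i] B.\<kappa>_eq[OF i] m\<psi>\<phi>[OF i i A.a_closed[OF i] A.b_closed[OF i]]
      using i by (simp add: m\<phi> m\<psi> closed fd A.a_unit A.b_unit)
    finally show "mat ((\<psi> \<Zcomp>\<^sub>2 \<phi>) \<cdot> Copy W) (i, i) 1 = mat (Copy W') (i, i) 1" by (simp add: B.\<kappa>_def)
  qed
  moreover have "Compare W = Compare W' \<cdot> (\<psi> \<Zcomp>\<^sub>2 \<phi>)"
  proof -
    note C = vcomp_cell[OF \<psi>\<phi> B.Compare_two_cell]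
    have "mat (Compare W) (i, l) = mat (Compare W' \<cdot> (\<psi> \<Zcomp>\<^sub>2 \<phi>)) (i, l)" if il: "i < n" "l < n" for i l
    proof (rule mat_eqI[OF A.Compare_two_cell C il A.spans_RL[OF il]])
      fix g assume "g \<in> {gen (WR W) (WL W) i l j x y |j x y.
        j < 1 \<and> x \<in> carrier (ent (WL W) (i, j)) \<and> y \<in> carrier (ent (WR W) (j, l))}"
      then obtain x y where g: "g = gen (WR W) (WL W) i l 0 x y"
        and xy: "A.in_L i x" "A.in_R l y" by auto
      note c = \<phi>c[OF il(1) xy(1)] \<psi>c[OF il(2) xy(2)]
      show "mat (Compare W) (i, l) g = mat (Compare W' \<cdot> (\<psi> \<Zcomp>\<^sub>2 \<phi>)) (i, l) g"
        unfolding g mat_vcomp[OF \<psi>\<phi> il A.RL_closed[OF il xy]] m\<psi>\<phi>[OF il xy]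
          A.mat_Compare[OF il A.RL_closed[OF il xy]] B.mat_Compare[OF il B.RL_closed[OF il c]]
        using il xy c by (auto simp: A.\<kappa>_eq B.\<kappa>_eq A.ip_RL B.ip_RL m\<phi> m\<psi> closed fd B.a_unit B.b_unit)
    qed
    then show ?thesis by (intro two_cell_eqI[OF A.Compare_two_cell C]) simp
  qed
  ultimately show ?thesis
    unfolding unitarily_isomorphic_def unitary_witness_iso_def
    using uni two_cellD(3)[OF \<phi>] two_cellD(3)[OF \<psi>] by blast
qed


section \<open>The standard witness\<close>

lemma std_cells: "is_cell1 1 n (std_WL n)" "is_cell1 n 1 (std_WR n)"
  by (auto simp: is_cell1_def std_WL_def std_WR_def)

lemma ent_std [simp]: "ent (std_WL n) p = scalar_hilb" "ent (std_WR n) p = scalar_hilb"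
  by (simp_all add: std_WL_def std_WR_def)

abbreviation "CC \<equiv> tensor scalar_hilb scalar_hilb"

lemma to_CC_linear:
  "to_CC (x + y) = to_CC x \<oplus>\<^bsub>CC\<^esub> to_CC y"
  "to_CC (c * x) = c \<odot>\<^bsub>CC\<^esub> to_CC x"
  unfolding to_CC_def
  using pure_tensor_bilinear(1,3)[OF fd_scalar_hilb fd_scalar_hilb] by simp_all

lemma to_CC_closed: "to_CC x \<in> carrier CC"
  by (simp add: to_CC_def pure_tensor_closed)

lemma to_CC_apply: "to_CC z (x, y) = cnj x * z * cnj y"
  by (simp add: to_CC_def)

text \<open>By conjugate-linearity \<open>F(z, 1)\<close> is \<open>cnj z * F(1, 1)\<close>.\<close>

lemma ip_to_CC:
  assumes "F \<in> carrier CC"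
  shows "ip CC (to_CC z) F = cnj z * of_CC F"
proof -
  have "conj_bilinear scalar_hilb scalar_hilb F" using assms by (simp add: tensor_carrier)
  from conj_bilinear_simps(3)[OF this, of 1 1 z] show ?thesis
    using ip_pure_left[OF fd_scalar_hilb fd_scalar_hilb assms, of z 1] by (simp add: to_CC_def of_CC_def)
qed

lemma std_LR: "ent (std_WL n \<Zcomp> std_WR n) (0, 0) = dsum n (\<lambda>_. CC)"
  and std_RL: "ent (std_WR n \<Zcomp> std_WL n) (i, l) = dsum 1 (\<lambda>_. CC)"
  by (simp_all add: comp1_def std_WL_def std_WR_def)

lemma std_Create_cell: "two_cell 1 1 (id1 1) (std_WL n \<Zcomp> std_WR n) (std_Create n)"
proof (rule two_cellI[OF id1_cell comp_cell[OF std_cells]])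
  fix i l :: nat assume "i < 1" "l < 1"
  then have il: "i = 0" "l = 0" by auto
  show "mat (std_Create n) (i, l) \<in> lin_maps (ent (id1 1) (i, l)) (ent (std_WL n \<Zcomp> std_WR n) (i, l))"
    unfolding il std_LR
    by (rule lin_mapsI) (auto simp: std_Create_def to_CC_closed to_CC_linear intro!: restrict_ext)
qed (auto simp: std_Create_def idx_def)

lemma std_Copy_cell: "two_cell n n (id1 n) (std_WR n \<Zcomp> std_WL n) (std_Copy n)"
proof (rule two_cellI[OF id1_cell comp_cell[OF std_cells(2,1)]])
  fix i l assume il: "i < n" "l < n"
  have fd: "fd_hilbert (ent (std_WR n \<Zcomp> std_WL n) (i, l))"
    by (rule fd_comp[OF std_cells(2,1) il])
  show "mat (std_Copy n) (i, l) \<in> lin_maps (ent (id1 n) (i, l)) (ent (std_WR n \<Zcomp> std_WL n) (i, l))"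
  proof (cases "i = l")
    case True
    then show ?thesis using il unfolding std_RL
      by (intro lin_mapsI) (auto simp: std_Copy_def to_CC_closed to_CC_linear intro!: restrict_ext)
  next
    case False
    then show ?thesis using il
      by (intro lin_mapsI) (auto simp: std_Copy_def fd smult_zero_fd zero_add_zero_fd)
  qed
qed (auto simp: std_Copy_def idx_def)

lemma std_Delete_dagger: "std_Delete n = dagger (std_Create n)"
proof (rule dagger_eqI[OF std_Create_cell])
  fix i l :: nat assume "i < 1" "l < 1"
  then have il: "i = 0" "l = 0" by auto
  show "mat (std_Delete n) (i, l) \<in> extensional (carrier (ent (std_WL n \<Zcomp> std_WR n) (i, l)))"
    by (simp add: il std_Delete_def)
  fix u assume u: "u \<in> carrier (ent (std_WL n \<Zcomp> std_WR n) (i, l))"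
  show "mat (std_Delete n) (i, l) u \<in> carrier (ent (id1 1) (i, l))" by (simp add: il)
  fix z assume "z \<in> carrier (ent (id1 1) (i, l))"
  have "ip (dsum n (\<lambda>_. CC)) (\<lambda>i\<in>{..<n}. to_CC z) u =
    (\<Sum>i<n. cnj z * of_CC (u i))"
    unfolding dsum_simps using u il
    by (intro sum.cong) (auto simp: std_LR PiE_def Pi_def ip_to_CC)
  then show "ip (ent (id1 1) (i, l)) z (mat (std_Delete n) (i, l) u) =
    ip (ent (std_WL n \<Zcomp> std_WR n) (i, l)) (mat (std_Create n) (i, l) z) u"
    using u unfolding il by (simp add: std_Delete_def std_Create_def std_LR sum_distrib_left del: dsum_simps)
qed (auto simp: std_Delete_def idx_def)

lemma std_Compare_dagger: "std_Compare n = dagger (std_Copy n)"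
proof (rule dagger_eqI[OF std_Copy_cell])
  fix i l assume il: "i < n" "l < n"
  have fd: "fd_hilbert (ent (std_WR n \<Zcomp> std_WL n) (i, l))"
    by (rule fd_comp[OF std_cells(2,1) il])
  show "mat (std_Compare n) (i, l) \<in> extensional (carrier (ent (std_WR n \<Zcomp> std_WL n) (i, l)))"
    by (simp add: il std_Compare_def)
  fix u assume u: "u \<in> carrier (ent (std_WR n \<Zcomp> std_WL n) (i, l))"
  show "mat (std_Compare n) (i, l) u \<in> carrier (ent (id1 n) (i, l))"
    using u il by (simp add: std_Compare_def)
  fix z assume z: "z \<in> carrier (ent (id1 n) (i, l))"
  show "ip (ent (id1 n) (i, l)) z (mat (std_Compare n) (i, l) u) =
    ip (ent (std_WR n \<Zcomp> std_WL n) (i, l)) (mat (std_Copy n) (i, l) z) u"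
  proof (cases "i = l")
    case True
    have "u 0 \<in> carrier CC" using u by (simp add: std_RL PiE_def Pi_def)
    then have "ip (dsum 1 (\<lambda>_. CC)) (\<lambda>k\<in>{..<1}. to_CC z) u = cnj z * of_CC (u 0)"
      by (simp add: ip_to_CC)
    then show ?thesis using True u il by (simp add: std_Compare_def std_Copy_def std_RL del: dsum_simps)
  next
    case False
    then show ?thesis using u z il by (simp add: std_Compare_def std_Copy_def fd)
  qed
qed (auto simp: std_Compare_def idx_def)

text \<open>All frame vectors of the standard witness are \<open>1\<close>, so all the witness equations hold for it by
  the general computation for frames.\<close>

lemma std_framed: "framed n (std_witness n) (\<lambda>_. 1) (\<lambda>_. 1)"
proof -
  have simps: "WL (std_witness n) = std_WL n" "WR (std_witness n) = std_WR n"
    "Create (std_witness n) = std_Create n" "Copy (std_witness n) = std_Copy n"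
    "Delete (std_witness n) = std_Delete n" "Compare (std_witness n) = std_Compare n"
    by (simp_all add: std_witness_def)
  interpret witness_cells n "std_witness n"
    by unfold_locales
      (simp_all add: simps std_cells[unfolded One_nat_def] std_Delete_dagger std_Compare_dagger
        two_cellD(3)[OF std_Create_cell, unfolded One_nat_def] two_cellD(3)[OF std_Copy_cell])
  show ?thesis
  proof unfold_locales
    fix i assume i: "i < n"
    show "\<kappa> i = gen (WR (std_witness n)) (WL (std_witness n)) i i 0 1 1"
      using i by (simp add: \<kappa>_def simps std_Copy_def gen_apply[OF std_cells(2,1) i i] to_CC_def
          cong: restrict_cong)
  next
    fix j y x assume j: "j < n"
    show "\<eta> j (y, x) = ip (ent (WR (std_witness n)) (0, j)) y 1 * ip (ent (WL (std_witness n)) (j, 0)) x 1"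
      using j by (simp add: \<eta>_def simps std_Create_def to_CC_apply)
  qed (simp_all add: simps)
qed

theorem theorem3p3:
  fixes n :: nat
  shows "witness n (std_witness n) \<and>
    (\<forall>(W :: ('a, 'b) witness_data) (W' :: ('c, 'd) witness_data).
       witness n W \<and> witness n W' \<longrightarrow> unitarily_isomorphic W W')"
proof (intro conjI allI impI)
  show "witness n (std_witness n)" by (rule framed.witness[OF std_framed])
  fix W :: "('a, 'b) witness_data" and W' :: "('c, 'd) witness_data"
  assume "witness n W \<and> witness n W'"
  then show "unitarily_isomorphic W W'"
    by (metis witness_has_frame frames_isomorphic)
qed


end
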